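(* Let $r\ge1$ be an integer and let $m$ be an $L^{2r}(\mathbb{R})$ multiplier supported in $(-1/2,1/2]$. There is a constant $C_{2r}$ such that the following holds. Let $Z$ be a finite relatively prime set of integers contained in $(1,q(Z)]$. Then as long as $0<\varepsilon<r^{-1}q(Z)^{-2r}$, for all $f\in\ell^{2r}(\mathbb{Z})$, $$\Big\|\sum_{a/q\in\mathcal{R}(Z)}f_{a/q}\Big\|_{\ell^{2r}(\mathbb{Z})}\le C_{2r}\,\big(2^{\Omega(Z)}\big)^{1-1/r}\,\|f\|_{\ell^{2r}(\mathbb{Z})},$$ where the constant $C_{2r}$ is independent of $Z$, $\varepsilon$ and $f$.
   Context: For $f\in\ell^1(\mathbb{Z})$ put $\widehat f(\xi)=\sum_{n\in\mathbb{Z}}f(n)e^{-2\pi i n\xi}$, a 1-periodic function; for a 1-periodic $h\in L^2_{\mathrm{loc}}(\mathbb{R})$ the inverse transform is $\check h(n)=\int_{(-1/2,1/2]}h(\xi)e^{2\pi i n\xi}\,d\xi$. Let $\mathscr{F}$ be the Euclidean Fourier transform on $\mathbb{R}$. A bounded measurable function $m:\mathbb{R}\to\mathbb{C}$ is an $L^p(\mathbb{R})$ multiplier of norm $B_p$ if $Tf=\mathscr{F}^{-1}(m\cdot\mathscr{F}f)$ satisfies $\|Tf\|_{L^p}\le B_p\|f\|_{L^p}$ for all $f\in L^p(\mathbb{R})$. For a finite set $Z$ of positive integers, $\mathcal{R}(Z)=\{a/q: q\in Z,\ 1\le a\le q,\ \gcd(a,q)=1\}$. $Z$ is a relatively prime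 set if $\gcd(q,q')=1$ for all distinct $q,q'\in Z$. $q(Z)$ denotes a number with $Z\subset(1,q(Z)]$. $\omega(q)$ is the number of distinct prime divisors of $q$, and $\Omega(Z)=\max\{\omega(q):q\in Z\}$. Given $m$ and $\varepsilon$, the function $f_{a/q}$ on $\mathbb{Z}$ is defined for $f\in\ell^1(\mathbb{Z})$ by $$\widehat{f_{a/q}}(\xi)=\sum_{\ell\in\mathbb{Z}}m\big(\varepsilon^{-1}(\xi-\ell-a/q)\big)\,\widehat f(\xi);$$ for $f\in\ell^{2r}(\mathbb{Z})$ the operators $f\mapsto f_{a/q}$ are understood as the bounded extensions by density. *)

theory Defs
  imports "HOL-Analysis.Analysis" "HOL-Computational_Algebra.Primes"
begin

text \<open>
  Elements of \<open>L\<^sup>p(M)\<close> are represented by functions rather than by classes modulo null sets.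
  \<open>\<ell>\<^sup>p(\<int>)\<close> is the case of the counting measure, where almost everywhere means everywhere.
\<close>

definition Lp :: "real \<Rightarrow> 'a measure \<Rightarrow> ('a \<Rightarrow> complex) set" where
  "Lp p M = {f \<in> borel_measurable M. integrable M (\<lambda>x. norm (f x) powr p)}"

definition Lp_norm :: "real \<Rightarrow> 'a measure \<Rightarrow> ('a \<Rightarrow> complex) \<Rightarrow> real" where
  "Lp_norm p M f = (\<integral>x. norm (f x) powr p \<partial>M) powr (1 / p)"

abbreviation lp_Z :: "real \<Rightarrow> (int \<Rightarrow> complex) set" where
  "lp_Z p \<equiv> Lp p (count_space UNIV)"

abbreviation lp_Z_norm :: "real \<Rightarrow> (int \<Rightarrow> complex) \<Rightarrow> real" where
  "lp_Z_norm p \<equiv> Lp_norm p (count_space UNIV)"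

text \<open>
  \<open>S\<close> is a linear operator on \<open>L\<^sup>p(M)\<close> of norm at most \<open>B\<close> extending \<open>T\<close>, which is given on \<open>D\<close>.
  When \<open>D \<inter> L\<^sup>p(M)\<close> is dense in \<open>L\<^sup>p(M)\<close>, there is at most one such \<open>S\<close> up to null sets.
\<close>

definition bounded_Lp_extension ::
  "real \<Rightarrow> 'a measure \<Rightarrow> ('a \<Rightarrow> complex) set \<Rightarrow> (('a \<Rightarrow> complex) \<Rightarrow> 'a \<Rightarrow> complex) \<Rightarrow>
   (('a \<Rightarrow> complex) \<Rightarrow> 'a \<Rightarrow> complex) \<Rightarrow> real \<Rightarrow> bool" where
  "bounded_Lp_extension p M D T S B \<longleftrightarrow>
     (\<forall>f \<in> Lp p M. S f \<in> Lp p M \<and> Lp_norm p M (S f) \<le> B * Lp_norm p M f) \<and>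
     (\<forall>f \<in> Lp p M. \<forall>g \<in> Lp p M. AE x in M. S (\<lambda>y. f y + g y) x = S f x + S g x) \<and>
     (\<forall>f \<in> Lp p M. \<forall>c. AE x in M. S (\<lambda>y. c * f y) x = c * S f x) \<and>
     (\<forall>f \<in> D \<inter> Lp p M. AE x in M. S f x = T f x)"

definition fourier_R :: "(real \<Rightarrow> complex) \<Rightarrow> real \<Rightarrow> complex" where
  "fourier_R f \<xi> = (\<integral>x. f x * cis (- 2 * pi * x * \<xi>) \<partial>lebesgue)"

definition inv_fourier_R :: "(real \<Rightarrow> complex) \<Rightarrow> real \<Rightarrow> complex" where
  "inv_fourier_R g x = (\<integral>\<xi>. g \<xi> * cis (2 * pi * x * \<xi>) \<partial>lebesgue)"

text \<open>
  For \<open>f \<in> L\<^sup>p\<close> the formula \<open>\<F>\<^sup>-\<^sup>1(m \<F>f)\<close> has no literal meaning as an integral in general. It is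
  imposed on those \<open>f \<in> L\<^sup>1 \<inter> L\<^sup>p\<close> for which both integrals converge absolutely (this class contains
  all Schwartz functions, hence is dense for \<open>1 \<le> p < \<infinity>\<close>), and extended to \<open>L\<^sup>p\<close> by boundedness.
\<close>

definition Lp_multiplier :: "real \<Rightarrow> (real \<Rightarrow> complex) \<Rightarrow> real \<Rightarrow> bool" where
  "Lp_multiplier p m B \<longleftrightarrow>
     m \<in> borel_measurable lebesgue \<and> bounded (range m) \<and>
     (\<exists>S. bounded_Lp_extension p lebesgue
            {f \<in> Lp 1 lebesgue. integrable lebesgue (\<lambda>\<xi>. m \<xi> * fourier_R f \<xi>)}
            (\<lambda>f. inv_fourier_R (\<lambda>\<xi>. m \<xi> * fourier_R f \<xi>)) S B)"

definition fourier_Z :: "(int \<Rightarrow> complex) \<Rightarrow> real \<Rightarrow> complex" where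
  "fourier_Z f \<xi> = (\<Sum>\<^sub>\<infinity>n. f n * cis (- 2 * pi * of_int n * \<xi>))"

definition inv_fourier_Z :: "(real \<Rightarrow> complex) \<Rightarrow> int \<Rightarrow> complex" where
  "inv_fourier_Z h n = (LINT \<xi>:{-1/2<..1/2}|lebesgue. h \<xi> * cis (2 * pi * of_int n * \<xi>))"

text \<open>
  The operator \<open>f \<mapsto> f\<^bsub>a/q\<^esub>\<close> on \<open>\<ell>\<^sup>1(\<int>)\<close>, with \<open>\<theta> = a/q\<close>: the function on \<open>\<int>\<close> whose Fourier series is the
  given bounded 1-periodic function. If \<open>m\<close> vanishes off a bounded set and \<open>\<epsilon> > 0\<close>, only finitely
  many terms of the inner sum are nonzero.
\<close>

definition frac_op :: "(real \<Rightarrow> complex) \<Rightarrow> real \<Rightarrow> real \<Rightarrow> (int \<Rightarrow> complex) \<Rightarrow> int \<Rightarrow> complex" where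
  "frac_op m \<epsilon> \<theta> f =
     inv_fourier_Z (\<lambda>\<xi>. \<Sum>\<^sub>\<infinity>l::int. m (inverse \<epsilon> * (\<xi> - of_int l - \<theta>)) * fourier_Z f \<xi>)"

abbreviation is_frac_ext ::
  "real \<Rightarrow> (real \<Rightarrow> complex) \<Rightarrow> real \<Rightarrow> real \<Rightarrow> ((int \<Rightarrow> complex) \<Rightarrow> int \<Rightarrow> complex) \<Rightarrow> bool" where
  "is_frac_ext p m \<epsilon> \<theta> S \<equiv>
     (\<exists>B. bounded_Lp_extension p (count_space UNIV) (lp_Z 1) (frac_op m \<epsilon> \<theta>) S B)"

text \<open>
  The bounded extension to \<open>\<ell>\<^sup>p(\<int>)\<close>. It is uniquely determined on \<open>\<ell>\<^sup>p(\<int>)\<close> for \<open>1 \<le> p < \<infinity>\<close>, so the choice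
  only matters off \<open>\<ell>\<^sup>p(\<int>)\<close>; it is meaningful only where \<^const>\<open>is_frac_ext\<close> is satisfiable.
\<close>

definition frac_ext ::
  "real \<Rightarrow> (real \<Rightarrow> complex) \<Rightarrow> real \<Rightarrow> real \<Rightarrow> (int \<Rightarrow> complex) \<Rightarrow> int \<Rightarrow> complex" where
  "frac_ext p m \<epsilon> \<theta> = (SOME S. is_frac_ext p m \<epsilon> \<theta> S)"

definition reduced_fracs :: "nat set \<Rightarrow> real set" where
  "reduced_fracs Z = {real a / real q | a q. q \<in> Z \<and> 1 \<le> a \<and> a \<le> q \<and> coprime a q}"

definition omega :: "nat \<Rightarrow> nat" where
  "omega q = card (prime_factors q)"

text \<open>The inserted \<open>0\<close> only serves to give the empty set the value \<open>0\<close>.\<close>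

definition Omega :: "nat set \<Rightarrow> nat" where
  "Omega Z = Max (insert 0 (omega ` Z))"

end

theory Submission
  imports Defs "HOL-Number_Theory.Cong" "HOL-Probability.Sinc_Integral" "HOL-Real_Asymp.Real_Asymp"
begin

text \<open>
  Write \<open>f\<^bsub>a/q\<^esub>(n) = e(an/q) \<phi>\<^bsub>a/q\<^esub>(n)\<close>, where \<open>\<phi>\<^bsub>a/q\<^esub>\<close> has frequencies in \<open>[-\<epsilon>/2, \<epsilon>/2]\<close>. Expanding the
  \<open>2r\<close>-th power, every combination of \<open>2r\<close> fractions is either an integer or at distance at least
  \<open>q(Z)\<^sup>-\<^sup>2\<^sup>r > r\<epsilon>\<close> from the integers, so the phases \<open>e(an/q)\<close> may be replaced by the average over
  \<open>u\<close> modulo \<open>\<Prod>Z\<close> of the constant phases \<open>e(au/q)\<close>. For fixed \<open>u\<close> one transfers the multiplier bound from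
  \<open>\<real>\<close> to \<open>\<int>\<close>; this replaces \<open>m\<close> by a nice kernel at scale \<open>1/\<epsilon>\<close>. By the Chinese remainder theorem the blocks
  belonging to distinct \<open>q\<close> are independent random variables of mean zero in \<open>u\<close>, so Rosenthal's inequality
  bounds the average by a square function, which the large sieve controls, plus the sum over \<open>q\<close> of the \<open>2r\<close>-th moments
  of the blocks. The latter is obtained by interpolating between an \<open>L\<^sup>2\<close> bound independent of \<open>Z\<close> and an \<open>L\<^sup>\<infinity>\<close>
  bound \<open>2\<^sup>\<omega>\<^sup>(\<^sup>q\<^sup>)\<close> for kernels given by Ramanujan sums. For \<open>r = 1\<close> the supports are disjoint and
  Bessel's inequality suffices.
\<close>

section \<open>Elementary inequalities\<close>

text \<open>The multiplier is known only through its norm; its kernel need not be summable, so its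
  values cannot be estimated one by one. Freezing \<open>u\<close> removes this obstacle: all
  fractions then sit at frequency 0, they merge into the coefficients of a single convolution with
  the kernel of \<open>m\<close>, and the norm of \<open>m\<close> is spent once, however many
  fractions there are. What is left involves only \<open>vker\<close>, whose transform is 1 on the
  support of \<open>m\<close> and which is dominated by \<open>decay\<close>. The exponent comes
  from the interpolation: an L-infinity bound \<open>D\<close> enters the \<open>2r\<close>-th
  moment as \<open>D ^ (2 * r - 2)\<close>, and the \<open>2r\<close>-th root turns
  \<open>2 ^ Omega Z\<close> into its power \<open>1 - 1 / r\<close>. The square function carries no
  such factor. The interpolation runs over all moduli and residues at once, so the number of moduli
  costs nothing. The large sieve is fed with the crude count \<open>qZ ^ 2\<close> of fractions and
  their spacing \<open>1 / qZ ^ 2\<close>, hence needs \<open>\<epsilon> * qZ ^ 4 \<le> 1\<close>.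
  The bound on \<open>\<epsilon>\<close> supplies this when \<open>4 \<le> 2 * r\<close>, which is
  why \<open>r = 1\<close> stands apart.\<close>

lemma subset_int_interval:
  fixes A :: "int set"
  assumes "finite A"
  obtains M :: nat where "A \<subseteq> {- int M..int M}"
proof
  show "A \<subseteq> {- int (nat (Max (insert 0 (abs ` A))))..int (nat (Max (insert 0 (abs ` A))))}"
  proof
    fix a assume "a \<in> A"
    then have "\<bar>a\<bar> \<le> Max (insert 0 (abs ` A))" using assms by (intro Max_ge) auto
    then show "a \<in> {- int (nat (Max (insert 0 (abs ` A))))..int (nat (Max (insert 0 (abs ` A))))}" by auto
  qed
qed

text \<open>Its primitive is \<open>arctan\<close>, so integrals and lattice sums of it are
  explicit. It serves as the common majorant for \<open>vker\<close> and for the weights on the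
  integers.\<close>

definition decay :: "real \<Rightarrow> real" where
  "decay s = 1 / (1 + s\<^sup>2)"

lemma decay_pos [simp]: "decay s > 0"
  by (simp add: decay_def add_pos_nonneg)

lemma decay_nonneg [simp]: "decay s \<ge> 0"
  using decay_pos[of s] by linarith

lemma decay_le_1: "decay s \<le> 1"
  by (simp add: decay_def divide_simps add_pos_nonneg)

lemma decay_minus [simp]: "decay (- s) = decay s"
  by (simp add: decay_def)

lemma decay_comparable:
  assumes "\<bar>s - t\<bar> \<le> 1"
  shows "decay s \<le> 3 * decay t"
proof -
  have "(s - t)\<^sup>2 \<le> 1"
    using assms by (metis abs_square_le_1)
  moreover have "t\<^sup>2 \<le> 2 * s\<^sup>2 + 2 * (s - t)\<^sup>2"
    using zero_le_power2[of "2 * s - t"] by (simp add: power2_eq_square algebra_simps)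
  ultimately have "t\<^sup>2 \<le> 2 * s\<^sup>2 + 2"
    unfolding power2_diff by (simp add: algebra_simps)
  then have "1 + t\<^sup>2 \<le> 3 * (1 + s\<^sup>2)"
    by (smt (verit) zero_le_power2)
  then show ?thesis
    by (simp add: decay_def divide_simps add_pos_nonneg)
qed

text \<open>The derivative of \<open>decay\<close> is bounded by \<open>decay\<close> itself. In
  this form the total variation of samples with spacing \<open>\<epsilon>\<close> is at most
  \<open>\<epsilon>\<close> times a sum of the samples, which is what partial summation
  needs.\<close>

lemma decay_diff: "\<bar>decay s - decay t\<bar> \<le> \<bar>s - t\<bar> * (decay s + decay t)"
proof -
  have *: "\<bar>u\<bar> * decay u \<le> 1" for u :: real
  proof -
    have "\<bar>u\<bar> \<le> 1 + u\<^sup>2"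
      using zero_le_power2[of "\<bar>u\<bar> - 1"] zero_le_power2[of u]
      by (simp add: power2_eq_square algebra_simps)
    then show ?thesis by (simp add: decay_def divide_simps add_pos_nonneg)
  qed
  have pos: "1 + s\<^sup>2 > 0" "1 + t\<^sup>2 > 0" by (simp_all add: add_pos_nonneg)
  have "decay s - decay t = (t - s) * (t + s) * (decay s * decay t)"
    using pos by (simp add: decay_def field_simps power2_eq_square)
  then have "\<bar>decay s - decay t\<bar> = \<bar>s - t\<bar> * (\<bar>t + s\<bar> * (decay s * decay t))"
    by (simp only: abs_mult abs_minus_commute[of t s] mult.assoc) (simp add: abs_mult)
  also have "\<bar>t + s\<bar> * (decay s * decay t) \<le> (\<bar>t\<bar> + \<bar>s\<bar>) * (decay s * decay t)"
    by (intro mult_right_mono) auto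
  also have "\<dots> = (\<bar>t\<bar> * decay t) * decay s + (\<bar>s\<bar> * decay s) * decay t"
    by (simp add: algebra_simps)
  also have "\<dots> \<le> 1 * decay s + 1 * decay t"
    by (intro add_mono mult_right_mono *) auto
  finally show ?thesis
    by (simp add: mult_left_mono)
qed

text \<open>By the mean value theorem and \<open>decay_comparable\<close>, each term times
  \<open>\<delta>\<close> is at most three increments of \<open>arctan\<close> over a cell of length
  \<open>\<delta>\<close>. The increments telescope, and \<open>arctan\<close> oscillates by at most
  \<open>pi\<close>.\<close>

lemma sum_decay_le:
  fixes A :: "int set"
  assumes "0 < \<delta>" "\<delta> \<le> 1" "finite A"
  shows "(\<Sum>i\<in>A. decay (y - \<delta> * of_int i)) \<le> 3 * pi / \<delta>"
proof -
  define g where "g i = arctan (\<delta> * of_int i - y)" for i :: int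
  have step: "\<delta> * decay (y - \<delta> * of_int i) \<le> 3 * (g (i + 1) - g i)" for i
  proof -
    let ?a = "\<delta> * of_int i - y"
    have "\<exists>z. ?a < z \<and> z < ?a + \<delta> \<and> arctan (?a + \<delta>) - arctan ?a = (?a + \<delta> - ?a) * inverse (1 + z\<^sup>2)"
      by (rule MVT2) (use assms in \<open>auto intro: DERIV_arctan\<close>)
    then obtain z where z: "?a < z" "z < ?a + \<delta>"
      "arctan (?a + \<delta>) - arctan ?a = \<delta> * decay z"
      by (auto simp: decay_def inverse_eq_divide)
    have "decay (y - \<delta> * of_int i) = decay ?a"
      using decay_minus[of ?a] by simp
    also have "\<dots> \<le> 3 * decay z"
      by (rule decay_comparable) (use z assms in auto)
    finally have "\<delta> * decay (y - \<delta> * of_int i) \<le> 3 * (\<delta> * decay z)"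
      using assms by simp
    moreover have "g (i + 1) = arctan (?a + \<delta>)"
      by (simp add: g_def algebra_simps)
    ultimately show ?thesis using z(3) by (simp add: g_def)
  qed
  obtain M where M: "A \<subseteq> {- int M..int M}" using subset_int_interval[OF assms(3)] .
  define N where "N = int M + 1"
  have N: "A \<subseteq> {-N..<N}" "N \<ge> 0" using M by (force simp: N_def)+
  have tele: "(\<Sum>i\<in>{-int n..<int n}. g (i + 1) - g i) = g (int n) - g (- int n)" for n
  proof (induction n)
    case (Suc n)
    have "{-int (Suc n)..<int (Suc n)} = insert (-int (Suc n)) (insert (int n) {-int n..<int n})"
      by auto
    then show ?case using Suc by (simp add: algebra_simps)
  qed simp
  have "\<delta> * (\<Sum>i\<in>A. decay (y - \<delta> * of_int i)) \<le> \<delta> * (\<Sum>i\<in>{-N..<N}. decay (y - \<delta> * of_int i))"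
    using assms N by (intro mult_left_mono sum_mono2) auto
  also have "\<dots> \<le> (\<Sum>i\<in>{-N..<N}. 3 * (g (i + 1) - g i))"
    unfolding sum_distrib_left by (intro sum_mono step)
  also have "\<dots> = 3 * (g N - g (- N))"
    unfolding sum_distrib_left[symmetric] using tele[of "nat N"] N by simp
  also have "\<dots> \<le> 3 * pi"
    using arctan_bounded[of "\<delta> * of_int N - y"] arctan_bounded[of "\<delta> * of_int (-N) - y"]
    by (simp add: g_def)
  finally show ?thesis
    using assms by (simp add: field_simps)
qed

text \<open>Optimising \<open>\<lambda>\<close> in \<open>t \<le> t\<^sup>p / \<lambda>\<^sup>p\<^sup>-\<^sup>1 + \<lambda>\<close> replaces Hoelder's inequality throughout.\<close>

lemma le_power_div_plus:
  fixes t l :: real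
  assumes "t \<ge> 0" "l > 0" "p \<ge> 1"
  shows "t \<le> t ^ p / l ^ (p - 1) + l"
proof (cases "t \<le> l")
  case True
  have "0 \<le> t ^ p / l ^ (p - 1)" using assms by simp
  then show ?thesis using True by linarith
next
  case False
  then have "l ^ (p - 1) \<le> t ^ (p - 1)" using assms by (intro power_mono) auto
  then have "t * l ^ (p - 1) \<le> t * t ^ (p - 1)" using assms by (intro mult_left_mono) auto
  also have "\<dots> = t ^ p" using assms by (metis Suc_diff_le diff_Suc_1 le_add_diff_inverse plus_1_eq_Suc power_Suc)
  finally have "t \<le> t ^ p / l ^ (p - 1)" using assms by (simp add: field_simps)
  then show ?thesis using assms by linarith
qed

text \<open>With \<open>l\<close> the \<open>p\<close>-th root of \<open>I\<close> both terms on the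
  right are multiples of \<open>l\<close>. For \<open>I = 0\<close> this \<open>l\<close> is not
  admissible; there arbitrarily small \<open>l\<close> force \<open>x \<le> 0\<close>.\<close>

lemma power_le_of_young:
  fixes x I c :: real
  assumes "p \<ge> 1" "x \<ge> 0" "I \<ge> 0" "c \<ge> 0"
    and le: "\<And>l. l > 0 \<Longrightarrow> x \<le> I / l ^ (p - 1) + c * l"
  shows "x ^ p \<le> (1 + c) ^ p * I"
proof (cases "I = 0")
  case True
  have "x \<le> 0"
  proof (rule field_le_epsilon)
    fix e :: real assume "e > 0"
    have "x \<le> c * (e / (c + 1))"
      using le[of "e / (c + 1)"] True \<open>e > 0\<close> assms by simp
    also have "\<dots> \<le> e" using \<open>e > 0\<close> assms by (simp add: field_simps)
    finally show "x \<le> 0 + e" by simp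
  qed
  then show ?thesis using assms True by (simp add: power_0_left)
next
  case False
  define l where "l = root p I"
  have l: "l > 0" "l ^ p = I" using assms False by (auto simp: l_def)
  have "I / l ^ (p - 1) = l"
    using l assms by (metis (no_types, lifting) Suc_diff_1 Suc_le_eq One_nat_def nonzero_mult_div_cancel_right power_Suc power_not_zero less_irrefl)
  then have "x \<le> (1 + c) * l" using le[OF l(1)] by (simp add: algebra_simps)
  then have "x ^ p \<le> ((1 + c) * l) ^ p" using assms by (intro power_mono) auto
  then show ?thesis using l by (simp add: power_mult_distrib)
qed

text \<open>Jensen's inequality for a measure of mass at most \<open>c\<close>. The optimisation in
  \<open>l\<close> yields \<open>(1 + c) ^ p\<close> where Hoelder would yield
  \<open>c ^ (p - 1)\<close>.\<close>

lemma weighted_sum_power_le: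
  fixes w a :: "'a \<Rightarrow> real"
  assumes "p \<ge> 1" "\<And>i. i \<in> A \<Longrightarrow> w i \<ge> 0" "\<And>i. i \<in> A \<Longrightarrow> a i \<ge> 0" "(\<Sum>i\<in>A. w i) \<le> c"
  shows "(\<Sum>i\<in>A. w i * a i) ^ p \<le> (1 + c) ^ p * (\<Sum>i\<in>A. w i * a i ^ p)"
proof (rule power_le_of_young)
  fix l :: real assume l: "l > 0"
  have "(\<Sum>i\<in>A. w i * a i) \<le> (\<Sum>i\<in>A. w i * (a i ^ p / l ^ (p - 1) + l))"
    using assms l by (intro sum_mono mult_left_mono le_power_div_plus) auto
  also have "\<dots> = (\<Sum>i\<in>A. w i * a i ^ p) / l ^ (p - 1) + (\<Sum>i\<in>A. w i) * l"
    by (simp add: ring_distribs sum.distrib sum_divide_distrib sum_distrib_right)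
  also have "\<dots> \<le> (\<Sum>i\<in>A. w i * a i ^ p) / l ^ (p - 1) + c * l"
    using assms l by (intro add_mono mult_right_mono) auto
  finally show "(\<Sum>i\<in>A. w i * a i) \<le> (\<Sum>i\<in>A. w i * a i ^ p) / l ^ (p - 1) + c * l" .
next
  have "sum w A \<ge> 0" by (intro sum_nonneg assms)
  then show "c \<ge> 0" using assms by linarith
qed (use assms in \<open>auto intro!: sum_nonneg\<close>)

section \<open>A kernel whose Fourier transform is 1 near the origin\<close>

lemma integrable_decay: "integrable lborel decay"
  and integral_decay: "(LBINT x. decay x) = pi"
proof -
  show "integrable lborel decay"
    using integrable_inverse_1_plus_square
    by (simp add: set_integrable_def decay_def[abs_def] inverse_eq_divide)
  show "(LBINT x. decay x) = pi"
    using LBINT_inverse_1_plus_square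
    by (simp add: interval_lebesgue_integral_def set_lebesgue_integral_def decay_def[abs_def] inverse_eq_divide)
qed

text \<open>Integration by parts: \<open>Si x - (1 - cos x) / x\<close> is a primitive on the
  positive half-line, so the Dirichlet integral gives \<open>pi / 2\<close> there. Since the
  integrand is nonnegative, existence of the limits of the primitive already gives integrability,
  and reflection gives the other half.\<close>

lemma has_bochner_integral_one_minus_cos:
  "has_bochner_integral lborel (\<lambda>x. (1 - cos x) / x\<^sup>2) pi"
proof -
  define f where "f x = (1 - cos x) / x\<^sup>2" for x :: real
  define F where "F x = (if x = 0 then 0 else Si x - (1 - cos x) / x)" for x :: real
  have f_nonneg: "f x \<ge> 0" for x by (simp add: f_def)
  have [measurable]: "f \<in> borel_measurable borel" by (simp add: f_def[abs_def])
  have DF: "(F has_real_derivative f x) (at x)" if "x > 0" for x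
  proof -
    have "((\<lambda>x. Si x - (1 - cos x) / x) has_real_derivative f x) (at x)"
      using that by (auto intro!: derivative_eq_intros DERIV_Si simp: f_def field_simps power2_eq_square)
    then show ?thesis
    proof (rule has_field_derivative_transform_within_open)
      show "open {0::real<..}" by simp
    qed (use that in \<open>auto simp: F_def\<close>)
  qed
  have F0: "(F \<longlongrightarrow> 0) (at_right 0)"
  proof -
    have 1: "((\<lambda>x. Si x) \<longlongrightarrow> Si 0) (at_right 0)"
      using isCont_Si[of 0] by (metis isCont_def filterlim_at_split)
    have 2: "((\<lambda>x::real. (1 - cos x) / x) \<longlongrightarrow> 0) (at_right 0)"
      by real_asymp
    have "Si 0 = 0"
      unfolding Si_def zero_ereal_def[symmetric] by (rule interval_integral_endpoints_same)
    then have "((\<lambda>x. Si x - (1 - cos x) / x) \<longlongrightarrow> 0) (at_right 0)"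
      using tendsto_diff[OF 1 2] by simp
    then show ?thesis
      by (rule Lim_transform_eventually)
         (auto simp: F_def eventually_at_filter)
  qed
  have Finf: "(F \<longlongrightarrow> pi / 2) at_top"
  proof -
    have 2: "((\<lambda>x::real. (1 - cos x) / x) \<longlongrightarrow> 0) at_top"
    proof (rule Lim_null_comparison)
      show "\<forall>\<^sub>F x::real in at_top. norm ((1 - cos x) / x) \<le> 2 / x"
        using eventually_gt_at_top[of "0::real"]
      proof eventually_elim
        case (elim x)
        have "\<bar>1 - cos x\<bar> \<le> 2" using cos_ge_minus_one[of x] cos_le_one[of x] by linarith
        then show ?case using elim by (simp add: divide_right_mono abs_divide)
      qed
      show "((\<lambda>x::real. 2 / x) \<longlongrightarrow> 0) at_top" by real_asymp
    qed
    have "((\<lambda>x. Si x - (1 - cos x) / x) \<longlongrightarrow> pi / 2) at_top"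
      using tendsto_diff[OF Si_at_top 2] by simp
    then show ?thesis
      by (rule Lim_transform_eventually)
         (use eventually_gt_at_top[of "0::real"] in \<open>eventually_elim, auto simp: F_def\<close>)
  qed
  have half: "set_integrable lborel (einterval 0 \<infinity>) f" "(LBINT x=0..\<infinity>. f x) = pi / 2 - 0"
  proof -
    have c: "isCont f x" if "0 < ereal x" for x
      using that by (auto simp: f_def[abs_def] intro!: continuous_intros)
    have a: "((F \<circ> real_of_ereal) \<longlongrightarrow> 0) (at_right 0)"
      using F0 by (simp add: zero_ereal_def ereal_tendsto_simps)
    have b: "((F \<circ> real_of_ereal) \<longlongrightarrow> pi / 2) (at_left \<infinity>)"
      using Finf by (simp add: ereal_tendsto_simps)
    show "set_integrable lborel (einterval 0 \<infinity>) f" "(LBINT x=0..\<infinity>. f x) = pi / 2 - 0"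
      by (rule interval_integral_FTC_nonneg[of 0 \<infinity> F f 0 "pi / 2"];
          use DF c a b f_nonneg in \<open>auto simp: zero_ereal_def\<close>)+
  qed
  have e0: "einterval 0 \<infinity> = {0<..}" by (auto simp: einterval_def)
  have h: "has_bochner_integral lborel (\<lambda>x. indicator {0<..} x * f x) (pi / 2)"
    using half by (simp add: has_bochner_integral_iff set_integrable_def interval_lebesgue_integral_def
                   set_lebesgue_integral_def e0)
  have h': "has_bochner_integral lborel (\<lambda>x. indicator {0<..} (- x) * f (- x)) (pi / 2)"
    using lborel_has_bochner_integral_real_affine_iff[of "-1" "\<lambda>x. indicator {0<..} x * f x" "pi / 2" 0] h
    by simp
  have "has_bochner_integral lborel (\<lambda>x. indicator {0<..} x * f x + indicator {0<..} (- x) * f (- x)) (pi / 2 + pi / 2)"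
    using h h' by (rule has_bochner_integral_add)
  \<comment> \<open>At \<open>x = 0\<close> both indicators vanish, and so does \<open>f\<close>,
    because division by zero yields 0.\<close>
  moreover have "indicator {0<..} x * f x + indicator {0<..} (- x) * f (- x) = f x" for x
    by (auto simp: f_def indicator_def not_less)
  ultimately show ?thesis by (simp add: f_def[abs_def])
qed

text \<open>The value is proportional to the absolute value of \<open>c\<close>. When
  \<open>c\<close> depends linearly on a frequency, combinations of such integrals are piecewise
  linear in it; this is how a trapezoid arises below.\<close>

lemma has_bochner_integral_one_minus_cos_scaled:
  "has_bochner_integral lborel (\<lambda>x. (1 - cos (c * x)) / x\<^sup>2) (pi * \<bar>c\<bar>)"
proof (cases "c = 0")
  case False
  have "has_bochner_integral lborel (\<lambda>x. (1 - cos (c * x)) / (c * x)\<^sup>2) (pi / \<bar>c\<bar>)"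
    using lborel_has_bochner_integral_real_affine_iff[of c "\<lambda>x. (1 - cos x) / x\<^sup>2" pi 0]
      has_bochner_integral_one_minus_cos False by (simp add: field_simps)
  from has_bochner_integral_mult_right[OF this, of "c\<^sup>2"] False
  have "has_bochner_integral lborel (\<lambda>x. (1 - cos (c * x)) / x\<^sup>2) (c\<^sup>2 * (pi / \<bar>c\<bar>))"
    by (simp add: power_mult_distrib)
  moreover have "c\<^sup>2 * (pi / \<bar>c\<bar>) = pi * \<bar>c\<bar>"
    using False by (auto simp: power2_eq_square abs_if field_simps)
  ultimately show ?thesis by simp
qed (simp add: has_bochner_integral_zero)

text \<open>The inverse Fourier transform of the trapezoid equal to \<open>1\<close> on \<open>[-1/2, 1/2]\<close> and supported in \<open>[-1, 1]\<close>,
  with junk value \<open>0\<close> at the origin.\<close>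

definition vker :: "real \<Rightarrow> real" where
  "vker x = (cos (pi * x) - cos (2 * pi * x)) / (pi * x)\<^sup>2"

lemma borel_measurable_vker [measurable]: "vker \<in> borel_measurable borel"
  by (simp add: vker_def[abs_def])

lemma vker_minus [simp]: "vker (- x) = vker x"
  by (simp add: vker_def)

text \<open>Near the origin the difference of cosines is a product of two sines, giving the bound 2;
  far out it is at most 2, and \<open>2 \<le> pi\<^sup>2\<close> gives the bound
  \<open>1 / x\<^sup>2\<close>.\<close>

lemma abs_vker_le: "\<bar>vker x\<bar> \<le> 4 * decay x"
proof (cases "x = 0")
  case False
  have 1: "\<bar>vker x\<bar> \<le> 2"
  proof -
    have "cos (pi * x) - cos (2 * pi * x) = 2 * sin (3 * pi * x / 2) * sin (pi * x / 2)"
      using cos_diff_cos[of "pi * x" "2 * pi * x"] by (simp add: algebra_simps add_divide_distrib)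
    also have "\<bar>\<dots>\<bar> \<le> 2 * \<bar>3 * pi * x / 2\<bar> * \<bar>pi * x / 2\<bar>"
      unfolding abs_mult by (intro mult_mono abs_sin_x_le_abs_x) auto
    also have "\<dots> \<le> 2 * (pi * x)\<^sup>2"
      by (simp add: abs_mult power2_eq_square)
    finally show ?thesis using False by (simp add: vker_def abs_divide divide_simps)
  qed
  have 2: "x\<^sup>2 * \<bar>vker x\<bar> \<le> 1"
  proof -
    have "\<bar>cos (pi * x) - cos (2 * pi * x)\<bar> \<le> 2"
      using abs_cos_le_one[of "pi * x"] abs_cos_le_one[of "2 * pi * x"] by linarith
    also have "2 \<le> pi\<^sup>2"
      using pi_gt3 power_mono[of 2 pi 2] by simp
    finally show ?thesis using False
      by (simp add: vker_def abs_divide divide_simps power_mult_distrib)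
  qed
  have "(1 + x\<^sup>2) * \<bar>vker x\<bar> \<le> 4" using 1 2 by (simp add: distrib_right)
  then show ?thesis by (simp add: decay_def field_simps add_pos_nonneg)
qed (simp add: vker_def)

text \<open>Product-to-sum formulas reduce the integrand to four terms
  \<open>(1 - cos (c * x)) / x\<^sup>2\<close> with \<open>c\<close> proportional to
  \<open>1 + \<xi>\<close>, \<open>1 - \<xi>\<close>, \<open>1 + 2 * \<xi>\<close> and
  \<open>1 - 2 * \<xi>\<close>. All four are nonnegative precisely on the stated range, and there
  the absolute values open up so that \<open>\<xi>\<close> cancels.\<close>

lemma has_bochner_integral_vker_cos:
  assumes "\<bar>\<xi>\<bar> \<le> 1/2"
  shows "has_bochner_integral lborel (\<lambda>x. vker x * cos (2 * pi * x * \<xi>)) 1"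
proof -
  let ?h = "\<lambda>c x. (1 - cos (c * x)) / x\<^sup>2"
  have eq: "vker x * cos (2 * pi * x * \<xi>) = (1 / (2 * pi\<^sup>2)) *
     (?h (2 * pi * (1 + \<xi>)) x + ?h (2 * pi * (1 - \<xi>)) x - ?h (pi * (1 + 2 * \<xi>)) x - ?h (pi * (1 - 2 * \<xi>)) x)" for x
  proof -
    have "cos (pi * x) * cos (2 * pi * x * \<xi>) = (cos (pi * (1 + 2 * \<xi>) * x) + cos (pi * (1 - 2 * \<xi>) * x)) / 2"
      "cos (2 * pi * x) * cos (2 * pi * x * \<xi>) = (cos (2 * pi * (1 + \<xi>) * x) + cos (2 * pi * (1 - \<xi>) * x)) / 2"
      by (simp_all add: cos_times_cos algebra_simps)
    moreover have "vker x * cos (2 * pi * x * \<xi>) =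
      (cos (pi * x) * cos (2 * pi * x * \<xi>) - cos (2 * pi * x) * cos (2 * pi * x * \<xi>)) / (pi * x)\<^sup>2"
      by (simp add: vker_def left_diff_distrib)
    ultimately have "vker x * cos (2 * pi * x * \<xi>) =
      ((cos (pi * (1 + 2 * \<xi>) * x) + cos (pi * (1 - 2 * \<xi>) * x)) / 2 -
       (cos (2 * pi * (1 + \<xi>) * x) + cos (2 * pi * (1 - \<xi>) * x)) / 2) / (pi * x)\<^sup>2"
      by (simp only:)
    then show ?thesis
      by (simp only: diff_divide_distrib[symmetric] add_divide_distrib[symmetric] power_mult_distrib)
         (simp add: divide_simps)
  qed
  have "has_bochner_integral lborel (\<lambda>x. (1 / (2 * pi\<^sup>2)) *
     (?h (2 * pi * (1 + \<xi>)) x + ?h (2 * pi * (1 - \<xi>)) x - ?h (pi * (1 + 2 * \<xi>)) x - ?h (pi * (1 - 2 * \<xi>)) x))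
     ((1 / (2 * pi\<^sup>2)) * (pi * \<bar>2 * pi * (1 + \<xi>)\<bar> + pi * \<bar>2 * pi * (1 - \<xi>)\<bar> - pi * \<bar>pi * (1 + 2 * \<xi>)\<bar> - pi * \<bar>pi * (1 - 2 * \<xi>)\<bar>))"
    by (intro has_bochner_integral_mult_right has_bochner_integral_diff has_bochner_integral_add
        has_bochner_integral_one_minus_cos_scaled)
  moreover have "(1 / (2 * pi\<^sup>2)) * (pi * \<bar>2 * pi * (1 + \<xi>)\<bar> + pi * \<bar>2 * pi * (1 - \<xi>)\<bar> - pi * \<bar>pi * (1 + 2 * \<xi>)\<bar> - pi * \<bar>pi * (1 - 2 * \<xi>)\<bar>) = 1"
  proof -
    have eqs: "\<bar>2 * pi * (1 + \<xi>)\<bar> = 2 * pi * (1 + \<xi>)" "\<bar>2 * pi * (1 - \<xi>)\<bar> = 2 * pi * (1 - \<xi>)"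
      "\<bar>pi * (1 + 2 * \<xi>)\<bar> = pi * (1 + 2 * \<xi>)" "\<bar>pi * (1 - 2 * \<xi>)\<bar> = pi * (1 - 2 * \<xi>)"
      using assms by (auto intro!: abs_of_nonneg mult_nonneg_nonneg)
    show ?thesis unfolding eqs by (simp add: power2_eq_square field_simps)
  qed
  ultimately show ?thesis by (simp only: eq)
qed

lemma integrable_vker: "integrable lborel vker"
proof (rule Bochner_Integration.integrable_bound)
  show "integrable lborel (\<lambda>x. 4 * decay x)" using integrable_decay by simp
qed (use abs_vker_le in auto)

lemma fourier_vker:
  assumes "\<bar>\<xi>\<bar> \<le> 1/2"
  shows "(\<integral>x. complex_of_real (vker x) * cis (2 * pi * x * \<xi>) \<partial>lborel) = 1"
proof -
  have i1: "integrable lborel (\<lambda>x. vker x * cos (2 * pi * x * \<xi>))"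
    using has_bochner_integral_vker_cos[OF assms] by (simp add: has_bochner_integral_iff)
  have i2: "integrable lborel (\<lambda>x. vker x * sin (2 * pi * x * \<xi>))"
    by (rule Bochner_Integration.integrable_bound[OF integrable_vker])
       (auto simp: abs_mult intro!: mult_left_le)
  have odd: "(LBINT x. vker x * sin (2 * pi * x * \<xi>)) = 0"
    using lborel_integral_real_affine[of "-1" "\<lambda>x. vker x * sin (2 * pi * x * \<xi>)" 0] by simp
  have "(\<integral>x. complex_of_real (vker x) * cis (2 * pi * x * \<xi>) \<partial>lborel) =
    (\<integral>x. complex_of_real (vker x * cos (2 * pi * x * \<xi>)) + \<i> * complex_of_real (vker x * sin (2 * pi * x * \<xi>)) \<partial>lborel)"
    by (intro Bochner_Integration.integral_cong refl) (simp add: complex_eq_iff)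
  also have "\<dots> = complex_of_real (LBINT x. vker x * cos (2 * pi * x * \<xi>)) + \<i> * complex_of_real (LBINT x. vker x * sin (2 * pi * x * \<xi>))"
    using i1 i2 by (subst Bochner_Integration.integral_add) (auto simp del: of_real_mult)
  also have "\<dots> = 1"
    using has_bochner_integral_vker_cos[OF assms] odd by (simp add: has_bochner_integral_iff)
  finally show ?thesis .
qed

section \<open>Band-limited sequences\<close>

definition ex :: "real \<Rightarrow> complex" where
  "ex x = cis (2 * pi * x)"

lemma norm_ex [simp]: "norm (ex x) = 1"
  by (simp add: ex_def)

lemma ex_0 [simp]: "ex 0 = 1"
  by (simp add: ex_def)

lemma ex_add: "ex (x + y) = ex x * ex y"
  by (simp add: ex_def cis_mult algebra_simps)

lemma cnj_ex [simp]: "cnj (ex x) = ex (- x)"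
  by (simp add: ex_def cis_cnj)

lemma ex_diff: "ex (x - y) = ex x * ex (- y)"
  using ex_add[of x "- y"] by simp

lemma ex_Ints [simp]: "x \<in> \<int> \<Longrightarrow> ex x = 1"
  by (simp add: ex_def)

lemma ex_of_nat_mult: "ex (of_nat n * x) = ex x ^ n"
  by (induction n) (simp_all add: algebra_simps ex_add)

lemma ex_sum: "ex (\<Sum>i\<in>A. f i) = (\<Prod>i\<in>A. ex (f i))"
  by (induction A rule: infinite_finite_induct) (simp_all add: ex_add)

lemma borel_measurable_ex [measurable]: "ex \<in> borel_measurable borel"
proof -
  have "continuous_on UNIV ex"
    unfolding ex_def[abs_def] cis_conv_exp by (intro continuous_intros)
  then show ?thesis by (rule borel_measurable_continuous_onI)
qed

lemma norm_one_minus_ex: "norm (1 - ex t) = 2 * \<bar>sin (pi * t)\<bar>"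
proof -
  have "(norm (1 - ex t))\<^sup>2 = (1 - cos (2 * pi * t))\<^sup>2 + (sin (2 * pi * t))\<^sup>2"
    by (simp add: ex_def cmod_power2)
  also have "\<dots> = 2 - 2 * cos (2 * (pi * t))"
    using sin_cos_squared_add[of "2 * (pi * t)"] by (simp add: power2_eq_square algebra_simps)
  also have "\<dots> = (2 * \<bar>sin (pi * t)\<bar>)\<^sup>2"
    unfolding cos_double_sin by (simp add: power_mult_distrib)
  finally show ?thesis by (rule power2_eq_imp_eq) auto
qed

text \<open>If \<open>s\<close> is the distance of \<open>t\<close> to the nearest integer, the norm
  is \<open>2 * sin (pi * s)\<close>, and this is at least \<open>s\<close> for
  \<open>s \<le> 1/2\<close>. The constant is not sharp, but only the linear dependence on the
  distance matters.\<close>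

lemma norm_one_minus_ex_ge:
  assumes "\<And>l::int. d \<le> \<bar>t - of_int l\<bar>"
  shows "d \<le> norm (1 - ex t)"
proof -
  define s where "s = \<bar>t - of_int (round t)\<bar>"
  have s: "0 \<le> s" "s \<le> 1/2"
    using of_int_round_abs_le[of t] by (auto simp: s_def abs_minus_commute)
  have eq: "norm (1 - ex t) = 2 * sin (pi * s)"
  proof -
    have "\<bar>sin (pi * (t - of_int (round t)))\<bar> = sin (pi * s)"
    proof -
      have "pi * s \<le> pi * 1" using s by (intro mult_left_mono) auto
      then have nn: "sin (pi * s) \<ge> 0"
        using s by (intro sin_ge_zero) auto
      show ?thesis
      proof (cases "t - of_int (round t) \<ge> 0")
        case False
        then have "sin (pi * s) = - sin (pi * (t - of_int (round t)))"
          unfolding sin_minus[symmetric] by (intro arg_cong[where f = sin]) (simp add: s_def algebra_simps)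
        then show ?thesis using nn by simp
      qed (use nn in \<open>simp add: s_def\<close>)
    qed
    moreover have "norm (1 - ex t) = norm (1 - ex (t - of_int (round t)))"
      by (simp add: ex_diff)
    ultimately show ?thesis by (simp add: norm_one_minus_ex)
  qed
  have "s \<le> 2 * sin (pi * s)"
  \<comment> \<open>Up to \<open>1/3\<close> the derivative \<open>cos\<close> is at least
    \<open>1/2\<close>, which gives \<open>sin (pi * s) \<ge> pi * s / 2\<close>. Beyond
    \<open>1/3\<close> the sine is at least its value \<open>sqrt 3 / 2\<close> at
    \<open>pi / 3\<close>.\<close>
  proof (cases "s \<le> 1/3")
    case True
    show ?thesis
    proof (cases "s = 0")
      case False
      then have "pi * s > 0" using s by simp
      then obtain z where z: "0 < z" "z < pi * s" "sin (pi * s) - sin 0 = (pi * s - 0) * cos z"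
        using MVT2[of 0 "pi * s" sin cos] by (auto intro: DERIV_sin)
      have "pi * s \<le> pi * (1/3)" using True by (intro mult_left_mono) auto
      then have "z \<le> pi / 3" using z by linarith
      then have "cos (pi / 3) \<le> cos z" using z by (intro cos_monotone_0_pi_le) auto
      then have "1/2 \<le> cos z" by (simp add: cos_60)
      then have "pi * s * (1/2) \<le> pi * s * cos z"
        using s by (intro mult_left_mono) auto
      then have "pi * s * (1/2) \<le> sin (pi * s)" using z by simp
      moreover have "s \<le> pi * s" using s pi_gt3 by (simp add: mult_le_cancel_right1)
      ultimately show ?thesis by linarith
    qed simp
  next
    case False
    have "pi * (1/3) \<le> pi * s" "pi * s \<le> pi * (1/2)"
      using False s by (auto intro!: mult_left_mono)
    then have "sin (pi / 3) \<le> sin (pi * s)"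
      using pi_gt_zero by (intro sin_monotone_2pi_le) linarith+
    moreover have "sqrt 3 \<ge> 1" by simp
    ultimately show ?thesis using s unfolding sin_60 by linarith
  qed
  moreover have "d \<le> s" using assms by (simp add: s_def)
  ultimately show ?thesis using eq by simp
qed

lemma norm_sum_ex_le:
  "norm (1 - ex t) * norm (\<Sum>j<N. ex (of_nat j * t)) \<le> 2"
proof -
  have "(1 - ex t) * (\<Sum>j<N. ex t ^ j) = 1 - ex t ^ N"
    by (simp add: sum_gp_strict)
  then have "norm (1 - ex t) * norm (\<Sum>j<N. ex t ^ j) = norm (1 - ex t ^ N)"
    by (metis norm_mult)
  also have "\<dots> \<le> 2"
    using norm_triangle_ineq4[of 1 "ex t ^ N"] by (simp add: norm_power)
  finally show ?thesis by (simp add: ex_of_nat_mult)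
qed

section \<open>Band-limited sequences as a class closed under products\<close>

text \<open>A test-function formulation of ``\<open>A\<close> is the Fourier transform of a measure of mass at most \<open>M\<close>
  supported in \<open>[-s, s]\<close>''; it makes closure under products immediate.\<close>

definition bandlimited :: "real \<Rightarrow> real \<Rightarrow> (int \<Rightarrow> complex) \<Rightarrow> bool" where
  "bandlimited s M A \<longleftrightarrow>
     (\<forall>(T :: (nat \<times> nat) set) c \<nu> \<alpha> D. finite T \<longrightarrow>
        (\<forall>\<beta>. \<bar>\<beta> - \<alpha>\<bar> \<le> s \<longrightarrow> norm (\<Sum>t\<in>T. c t * ex (\<beta> * of_int (\<nu> t))) \<le> D) \<longrightarrow>
        norm (\<Sum>t\<in>T. c t * ex (\<alpha> * of_int (\<nu> t)) * A (\<nu> t)) \<le> M * D)"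

lemma bandlimitedD:
  fixes T :: "(nat \<times> nat) set"
  assumes "bandlimited s M A" "finite T"
    and "\<And>\<beta>. \<bar>\<beta> - \<alpha>\<bar> \<le> s \<Longrightarrow> norm (\<Sum>t\<in>T. c t * ex (\<beta> * of_int (\<nu> t))) \<le> D"
  shows "norm (\<Sum>t\<in>T. c t * ex (\<alpha> * of_int (\<nu> t)) * A (\<nu> t)) \<le> M * D"
  by (rule assms(1)[unfolded bandlimited_def, rule_format, OF assms(2)]) (rule assms(3))

lemma bandlimited_one: "bandlimited 0 1 (\<lambda>_. 1)"
  unfolding bandlimited_def by auto

text \<open>The values of \<open>B\<close> are first treated as part of the coefficients, which
  costs a frequency shift up to \<open>s\<close> from \<open>A\<close>; the test for
  \<open>B\<close> then shifts by at most \<open>t\<close> more. In terms of measures this is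
  convolution.\<close>

lemma bandlimited_mult:
  assumes A: "bandlimited s M A" and B: "bandlimited t L B"
  shows "bandlimited (s + t) (M * L) (\<lambda>n. A n * B n)"
  unfolding bandlimited_def
proof (intro allI impI)
  fix T :: "(nat \<times> nat) set" and c \<nu> \<alpha> D
  assume T: "finite T" and D: "\<forall>\<beta>. \<bar>\<beta> - \<alpha>\<bar> \<le> s + t \<longrightarrow> norm (\<Sum>x\<in>T. c x * ex (\<beta> * of_int (\<nu> x))) \<le> D"
  have "norm (\<Sum>x\<in>T. (c x * B (\<nu> x)) * ex (\<alpha> * of_int (\<nu> x)) * A (\<nu> x)) \<le> M * (L * D)"
  proof (rule bandlimitedD[OF A T])
    fix \<beta> assume \<beta>: "\<bar>\<beta> - \<alpha>\<bar> \<le> s"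
    have "norm (\<Sum>x\<in>T. c x * ex (\<beta> * of_int (\<nu> x)) * B (\<nu> x)) \<le> L * D"
    proof (rule bandlimitedD[OF B T])
      fix \<gamma> assume "\<bar>\<gamma> - \<beta>\<bar> \<le> t"
      with \<beta> have "\<bar>\<gamma> - \<alpha>\<bar> \<le> s + t" by linarith
      then show "norm (\<Sum>x\<in>T. c x * ex (\<gamma> * of_int (\<nu> x))) \<le> D" using D by simp
    qed
    then show "norm (\<Sum>x\<in>T. (c x * B (\<nu> x)) * ex (\<beta> * of_int (\<nu> x))) \<le> L * D"
      by (simp add: mult_ac)
  qed
  then show "norm (\<Sum>x\<in>T. c x * ex (\<alpha> * of_int (\<nu> x)) * (A (\<nu> x) * B (\<nu> x))) \<le> M * L * D"
    by (simp add: mult_ac)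
qed

lemma bandlimited_cnj:
  assumes A: "bandlimited s M A"
  shows "bandlimited s M (\<lambda>n. cnj (A n))"
  unfolding bandlimited_def
proof (intro allI impI)
  fix T :: "(nat \<times> nat) set" and c \<nu> \<alpha> D
  assume T: "finite T" and D: "\<forall>\<beta>. \<bar>\<beta> - \<alpha>\<bar> \<le> s \<longrightarrow> norm (\<Sum>x\<in>T. c x * ex (\<beta> * of_int (\<nu> x))) \<le> D"
  have "norm (\<Sum>x\<in>T. cnj (c x) * ex ((- \<alpha>) * of_int (\<nu> x)) * A (\<nu> x)) \<le> M * D"
  proof (rule bandlimitedD[OF A T])
    fix \<beta> assume "\<bar>\<beta> - (- \<alpha>)\<bar> \<le> s"
    then have "\<bar>(- \<beta>) - \<alpha>\<bar> \<le> s" by linarith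
    then have "norm (\<Sum>x\<in>T. c x * ex ((- \<beta>) * of_int (\<nu> x))) \<le> D" using D by blast
    then show "norm (\<Sum>x\<in>T. cnj (c x) * ex (\<beta> * of_int (\<nu> x))) \<le> D"
      by (subst complex_mod_cnj[symmetric]) (simp add: cnj_sum)
  qed
  then show "norm (\<Sum>x\<in>T. c x * ex (\<alpha> * of_int (\<nu> x)) * cnj (A (\<nu> x))) \<le> M * D"
    by (subst complex_mod_cnj[symmetric]) (simp add: cnj_sum)
qed

lemma bandlimited_prod:
  assumes "\<And>i. i < r \<Longrightarrow> bandlimited s M (A i)"
  shows "bandlimited (real r * s) (M ^ r) (\<lambda>n. \<Prod>i<r. A i n)"
  using assms
proof (induction r)
  case (Suc r)
  have "bandlimited (real r * s + s) (M ^ r * M) (\<lambda>n. (\<Prod>i<r. A i n) * A r n)"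
    by (intro bandlimited_mult Suc) auto
  then show ?case by (simp add: algebra_simps)
qed (use bandlimited_one in simp)

text \<open>Moving the finite sum under the integral leaves an average, with weights
  \<open>h \<xi>\<close>, of the exponential sum at the frequencies \<open>\<xi> + \<alpha>\<close>,
  all of which lie within \<open>s\<close> of \<open>\<alpha>\<close>.\<close>

lemma bandlimited_integral:
  assumes meas: "h \<in> borel_measurable lebesgue" and int: "integrable lebesgue h"
    and supp: "\<And>\<xi>. \<bar>\<xi>\<bar> > s \<Longrightarrow> h \<xi> = 0"
  shows "bandlimited s (\<integral>\<xi>. norm (h \<xi>) \<partial>lebesgue) (\<lambda>n. \<integral>\<xi>. h \<xi> * ex (\<xi> * of_int n) \<partial>lebesgue)"
  unfolding bandlimited_def
proof (intro allI impI)
  fix T :: "(nat \<times> nat) set" and c \<nu> \<alpha> D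
  assume T: "finite T" and D: "\<forall>\<beta>. \<bar>\<beta> - \<alpha>\<bar> \<le> s \<longrightarrow> norm (\<Sum>x\<in>T. c x * ex (\<beta> * of_int (\<nu> x))) \<le> D"
  have [measurable]: "(\<lambda>\<xi>. ex (\<xi> * k)) \<in> borel_measurable lebesgue" for k
    by (rule measurable_completion) simp
  note [measurable] = meas
  have int': "integrable lebesgue (\<lambda>\<xi>. h \<xi> * ex (\<xi> * k))" for k
    by (rule Bochner_Integration.integrable_bound[OF int]) (auto simp: norm_mult)
  have "(\<Sum>x\<in>T. c x * ex (\<alpha> * of_int (\<nu> x)) * (\<integral>\<xi>. h \<xi> * ex (\<xi> * of_int (\<nu> x)) \<partial>lebesgue))
      = (\<integral>\<xi>. (\<Sum>x\<in>T. c x * ex (\<alpha> * of_int (\<nu> x)) * (h \<xi> * ex (\<xi> * of_int (\<nu> x)))) \<partial>lebesgue)"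
    using int' by (subst Bochner_Integration.integral_sum) auto
  also have "\<dots> = (\<integral>\<xi>. h \<xi> * (\<Sum>x\<in>T. c x * ex ((\<xi> + \<alpha>) * of_int (\<nu> x))) \<partial>lebesgue)"
    by (intro Bochner_Integration.integral_cong refl) (simp add: sum_distrib_left ex_add distrib_right mult_ac)
  also have "norm \<dots> \<le> (\<integral>\<xi>. norm (h \<xi>) * D \<partial>lebesgue)"
  proof (rule Bochner_Integration.integral_norm_bound_integral)
    show i: "integrable lebesgue (\<lambda>\<xi>. norm (h \<xi>) * D)" using int by simp
    have b: "norm (h \<xi> * (\<Sum>x\<in>T. c x * ex ((\<xi> + \<alpha>) * of_int (\<nu> x)))) \<le> norm (h \<xi>) * D" for \<xi>
    proof (cases "\<bar>\<xi>\<bar> \<le> s")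
      case True
      then show ?thesis using D by (auto simp: norm_mult intro!: mult_left_mono)
    qed (use supp in simp)
    then show "norm (h \<xi> * (\<Sum>x\<in>T. c x * ex ((\<xi> + \<alpha>) * of_int (\<nu> x)))) \<le> norm (h \<xi>) * D" for \<xi> .
    have "(\<lambda>\<xi>. ex ((\<xi> + \<alpha>) * k)) \<in> borel_measurable lebesgue" for k
      by (rule measurable_completion) simp
    note [measurable] = this
    show "integrable lebesgue (\<lambda>\<xi>. h \<xi> * (\<Sum>x\<in>T. c x * ex ((\<xi> + \<alpha>) * of_int (\<nu> x))))"
    proof (rule Bochner_Integration.integrable_bound[OF i])
      show "(\<lambda>\<xi>. h \<xi> * (\<Sum>x\<in>T. c x * ex ((\<xi> + \<alpha>) * of_int (\<nu> x)))) \<in> borel_measurable lebesgue"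
        by measurable
    qed (use order_trans[OF b abs_ge_self] in simp)
  qed
  finally show "norm (\<Sum>x\<in>T. c x * ex (\<alpha> * of_int (\<nu> x)) * (\<integral>\<xi>. h \<xi> * ex (\<xi> * of_int (\<nu> x)) \<partial>lebesgue))
      \<le> (\<integral>\<xi>. norm (h \<xi>) \<partial>lebesgue) * D" by simp
qed

section \<open>Cesaro averages and the replacement of moving phases by frozen ones\<close>

text \<open>Summing over differences \<open>j - k\<close> produces Fejer kernels, which are bounded uniformly in \<open>N\<close> away from \<open>\<int>\<close>.\<close>

lemma bandlimited_cesaro_bounded:
  assumes P: "bandlimited s M P" and d: "d > 0"
    and sep: "\<And>l::int. s + d \<le> \<bar>\<alpha> - of_int l\<bar>"
  shows "norm (\<Sum>(j, k)\<in>{..<N} \<times> {..<N}. ex (\<alpha> * of_int (int j - int k)) * P (int j - int k)) \<le> M * (2 / d)\<^sup>2"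
proof -
  have "norm (\<Sum>t\<in>{..<N} \<times> {..<N}. (1::complex) * ex (\<alpha> * of_int (int (fst t) - int (snd t))) * P (int (fst t) - int (snd t)))
      \<le> M * (2 / d)\<^sup>2"
  proof (rule bandlimitedD[OF P])
    fix \<beta> assume \<beta>: "\<bar>\<beta> - \<alpha>\<bar> \<le> s"
    define G where "G = (\<Sum>j<N. ex (of_nat j * \<beta>))"
    have "d \<le> \<bar>\<beta> - of_int l\<bar>" for l using sep[of l] \<beta> by linarith
    then have dle: "d \<le> norm (1 - ex \<beta>)" by (rule norm_one_minus_ex_ge)
    have "d * norm G \<le> norm (1 - ex \<beta>) * norm G" using dle by (intro mult_right_mono) auto
    also have "\<dots> \<le> 2" unfolding G_def by (rule norm_sum_ex_le)
    finally have G: "norm G \<le> 2 / d" using d by (simp add: field_simps)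
    have "(\<Sum>t\<in>{..<N} \<times> {..<N}. (1::complex) * ex (\<beta> * of_int (int (fst t) - int (snd t)))) = G * cnj G"
      unfolding G_def cnj_sum sum_product sum.cartesian_product
      by (intro sum.cong) (auto simp: ex_add[symmetric] algebra_simps)
    then have "norm (\<Sum>t\<in>{..<N} \<times> {..<N}. (1::complex) * ex (\<beta> * of_int (int (fst t) - int (snd t)))) = (norm G)\<^sup>2"
      by (simp add: norm_mult power2_eq_square)
    also have "\<dots> \<le> (2 / d)\<^sup>2" using G by (intro power_mono) auto
    finally show "norm (\<Sum>t\<in>{..<N} \<times> {..<N}. (1::complex) * ex (\<beta> * of_int (int (fst t) - int (snd t)))) \<le> (2 / d)\<^sup>2" .
  qed simp
  then show ?thesis by (simp add: case_prod_unfold)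
qed

text \<open>This is where the even integer exponent enters: the power is the \<open>r\<close>-th
  power of the sum times its conjugate, so it expands into finitely many products of
  \<open>2 * r\<close> factors, each of which is again band-limited.\<close>

lemma norm_sum_power_expand:
  fixes c :: "'a \<Rightarrow> complex"
  assumes "finite \<Theta>"
  shows "complex_of_real (norm (\<Sum>\<theta>\<in>\<Theta>. c \<theta>) ^ (2 * r)) =
    (\<Sum>(\<tau>, \<sigma>)\<in>({..<r} \<rightarrow>\<^sub>E \<Theta>) \<times> ({..<r} \<rightarrow>\<^sub>E \<Theta>). (\<Prod>i<r. c (\<tau> i)) * cnj (\<Prod>i<r. c (\<sigma> i)))"
proof -
  let ?S = "\<Sum>\<theta>\<in>\<Theta>. c \<theta>"
  have pow: "?S ^ r = (\<Sum>\<tau>\<in>{..<r} \<rightarrow>\<^sub>E \<Theta>. \<Prod>i<r. c (\<tau> i))"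
    using prod_sum_PiE[of "{..<r}" "\<lambda>_. \<Theta>" "\<lambda>_. c"] assms by simp
  have "complex_of_real (norm ?S ^ (2 * r)) = complex_of_real ((norm ?S)\<^sup>2) ^ r"
    by (simp add: power_mult)
  also have "\<dots> = (?S * cnj ?S) ^ r"
    unfolding complex_norm_square ..
  also have "\<dots> = ?S ^ r * cnj (?S ^ r)" by (simp add: power_mult_distrib)
  also have "\<dots> = (\<Sum>(\<tau>, \<sigma>)\<in>({..<r} \<rightarrow>\<^sub>E \<Theta>) \<times> ({..<r} \<rightarrow>\<^sub>E \<Theta>). (\<Prod>i<r. c (\<tau> i)) * cnj (\<Prod>i<r. c (\<sigma> i)))"
    unfolding pow cnj_sum sum_product sum.cartesian_product by simp
  finally show ?thesis .
qed

lemma sum_ex_roots: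
  assumes "\<alpha> * real Q \<in> \<int>" "\<alpha> \<notin> \<int>"
  shows "(\<Sum>u<Q. ex (\<alpha> * real u)) = 0"
proof -
  have ne: "norm (1 - ex \<alpha>) > 0"
  proof -
    have "\<lfloor>\<alpha>\<rfloor> < \<alpha>" using assms(2) by (metis Ints_of_int of_int_floor_le order_le_less)
    then have f: "frac \<alpha> > 0" by (simp add: frac_def)
    moreover have "frac \<alpha> < 1" by (rule frac_lt_1)
    ultimately have d: "min (frac \<alpha>) (1 - frac \<alpha>) > 0" by simp
    have "min (frac \<alpha>) (1 - frac \<alpha>) \<le> \<bar>\<alpha> - of_int l\<bar>" for l
    proof (cases "l \<le> \<lfloor>\<alpha>\<rfloor>")
      case True
      then have "real_of_int l \<le> of_int \<lfloor>\<alpha>\<rfloor>" by simp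
      then show ?thesis using f by (simp add: frac_def)
    next
      case False
      then have "real_of_int l \<ge> of_int \<lfloor>\<alpha>\<rfloor> + 1" by linarith
      then show ?thesis by (simp add: frac_def min_def) linarith
    qed
    then show ?thesis using norm_one_minus_ex_ge d by (meson less_le_trans)
  qed
  have "(1 - ex \<alpha>) * (\<Sum>u<Q. ex \<alpha> ^ u) = 1 - ex \<alpha> ^ Q"
    by (simp add: sum_gp_strict)
  also have "ex \<alpha> ^ Q = 1"
    using assms(1) by (simp add: ex_of_nat_mult[symmetric] mult.commute)
  finally show ?thesis using ne by (simp add: ex_of_nat_mult[symmetric] mult.commute)
qed

text \<open>After expansion both sides consist of terms \<open>ex (al p * x) * P p n\<close>, with
  \<open>x = n\<close> on the left and \<open>x = u\<close> on the right. Averaging over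
  \<open>u\<close> keeps the terms with \<open>al p\<close> integral, where the two phases agree,
  and kills the others. Summed over differences \<open>n = j - k\<close>, those others stay bounded
  on the left as well, because \<open>al p\<close> is farther from the integers than the bandwidth
  of \<open>P p\<close>. So the two sides differ by a bounded amount while the number of shifts
  grows, and the discrepancy disappears in the limit.\<close>

lemma sum_power_transfer:
  fixes \<Theta> :: "real set" and \<phi> :: "real \<Rightarrow> int \<Rightarrow> complex"
  assumes fin: "finite \<Theta>" and Q: "Q > 0" "\<And>\<theta>. \<theta> \<in> \<Theta> \<Longrightarrow> \<theta> * real Q \<in> \<int>"
    and BL: "\<And>\<theta>. \<theta> \<in> \<Theta> \<Longrightarrow> bandlimited s M (\<phi> \<theta>)"
    and d: "d > 0"
    and sep: "\<And>\<tau> \<sigma> (l::int). \<tau> \<in> {..<r} \<rightarrow> \<Theta> \<Longrightarrow> \<sigma> \<in> {..<r} \<rightarrow> \<Theta> \<Longrightarrow>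
        (\<Sum>i<r. \<tau> i) - (\<Sum>i<r. \<sigma> i) \<notin> \<int> \<Longrightarrow>
        2 * real r * s + d \<le> \<bar>(\<Sum>i<r. \<tau> i) - (\<Sum>i<r. \<sigma> i) - of_int l\<bar>"
    and bound: "\<And>u A. u < Q \<Longrightarrow> finite A \<Longrightarrow>
        (\<Sum>n\<in>A. norm (\<Sum>\<theta>\<in>\<Theta>. ex (\<theta> * real u) * \<phi> \<theta> n) ^ (2 * r)) \<le> D u"
    and A: "finite A"
  shows "(\<Sum>n\<in>A. norm (\<Sum>\<theta>\<in>\<Theta>. ex (\<theta> * of_int n) * \<phi> \<theta> n) ^ (2 * r)) \<le> (\<Sum>u<Q. D u) / real Q"
proof -
  define G where "G n = norm (\<Sum>\<theta>\<in>\<Theta>. ex (\<theta> * of_int n) * \<phi> \<theta> n) ^ (2 * r)" for n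
  define H where "H u n = norm (\<Sum>\<theta>\<in>\<Theta>. ex (\<theta> * real u) * \<phi> \<theta> n) ^ (2 * r)" for u n
  define I where "I = ({..<r} \<rightarrow>\<^sub>E \<Theta>) \<times> ({..<r} \<rightarrow>\<^sub>E \<Theta>)"
  define al where "al = (\<lambda>(\<tau>, \<sigma>). (\<Sum>i<r. \<tau> i) - (\<Sum>i<r. \<sigma> i) :: real)"
  define P where "P = (\<lambda>(\<tau>, \<sigma>) n. (\<Prod>i<r. \<phi> (\<tau> i) n) * cnj (\<Prod>i<r. \<phi> (\<sigma> i) n))"
  have finI: "finite I" unfolding I_def using fin by (intro finite_cartesian_product finite_PiE) auto
  have expand: "complex_of_real (norm (\<Sum>\<theta>\<in>\<Theta>. ex (\<theta> * x) * \<phi> \<theta> n) ^ (2 * r)) = (\<Sum>p\<in>I. ex (al p * x) * P p n)" for x n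
    unfolding norm_sum_power_expand[OF fin] I_def
  proof (intro sum.cong refl, clarify)
    fix \<tau> \<sigma> :: "nat \<Rightarrow> real"
    have "ex (al (\<tau>, \<sigma>) * x) = ex (\<Sum>i<r. \<tau> i * x) * cnj (ex (\<Sum>i<r. \<sigma> i * x))"
      by (simp only: al_def prod.case left_diff_distrib sum_distrib_right ex_diff cnj_ex)
    then show "(\<Prod>i<r. ex (\<tau> i * x) * \<phi> (\<tau> i) n) * cnj (\<Prod>i<r. ex (\<sigma> i * x) * \<phi> (\<sigma> i) n)
        = ex (al (\<tau>, \<sigma>) * x) * P (\<tau>, \<sigma>) n"
      by (simp only: ex_sum P_def prod.case prod.distrib complex_cnj_mult mult_ac)
  qed
  have PB: "bandlimited (2 * real r * s) (M ^ r * M ^ r) (P p)" if pI: "p \<in> I" for p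
  proof -
    obtain \<tau> \<sigma> where p: "p = (\<tau>, \<sigma>)" "\<tau> \<in> {..<r} \<rightarrow>\<^sub>E \<Theta>" "\<sigma> \<in> {..<r} \<rightarrow>\<^sub>E \<Theta>"
      using pI by (auto simp: I_def)
    have "bandlimited (real r * s + real r * s) (M ^ r * M ^ r) (\<lambda>n. (\<Prod>i<r. \<phi> (\<tau> i) n) * cnj (\<Prod>i<r. \<phi> (\<sigma> i) n))"
      by (intro bandlimited_mult bandlimited_cnj bandlimited_prod BL) (use p in auto)
    moreover have eq: "real r * s + real r * s = 2 * real r * s" by simp
    moreover have Pp: "P p = (\<lambda>n. (\<Prod>i<r. \<phi> (\<tau> i) n) * cnj (\<Prod>i<r. \<phi> (\<sigma> i) n))"
      unfolding P_def p(1) prod.case ..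
    ultimately show ?thesis unfolding Pp eq by blast
  qed
  \<comment> \<open>Each of the finitely many index pairs contributes at most one Fejer bound,
    independently of \<open>N\<close>.\<close>
  define K where "K = real (card I) * (M ^ r * M ^ r * (2 / d)\<^sup>2)"
  let ?T = "\<lambda>N. {..<N} \<times> {..<N::nat}"
  let ?\<nu> = "\<lambda>t. int (fst t) - int (snd t)"
  have cesaro: "\<bar>(\<Sum>t\<in>?T N. G (?\<nu> t)) - (\<Sum>u<Q. \<Sum>t\<in>?T N. H u (?\<nu> t)) / real Q\<bar> \<le> K" for N
  proof -
    define b where "b p = (\<Sum>u<Q. ex (al p * real u)) / of_nat Q" for p
    have alQ: "al p * real Q \<in> \<int>" if pI: "p \<in> I" for p
    proof -
      obtain \<tau> \<sigma> where p: "p = (\<tau>, \<sigma>)" "\<tau> \<in> {..<r} \<rightarrow>\<^sub>E \<Theta>" "\<sigma> \<in> {..<r} \<rightarrow>\<^sub>E \<Theta>"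
        using pI by (auto simp: I_def)
      have "\<tau> i * real Q \<in> \<int>" "\<sigma> i * real Q \<in> \<int>" if "i < r" for i
        using p that by (auto intro!: Q(2))
      then have "(\<Sum>i<r. \<tau> i * real Q) - (\<Sum>i<r. \<sigma> i * real Q) \<in> \<int>"
        by (intro Ints_diff Ints_sum) auto
      then show ?thesis by (simp only: p(1) al_def prod.case left_diff_distrib sum_distrib_right)
    qed
    have "complex_of_real ((\<Sum>t\<in>?T N. G (?\<nu> t)) - (\<Sum>u<Q. \<Sum>t\<in>?T N. H u (?\<nu> t)) / real Q)
      = (\<Sum>t\<in>?T N. \<Sum>p\<in>I. ex (al p * of_int (?\<nu> t)) * P p (?\<nu> t))
        - (\<Sum>u<Q. \<Sum>t\<in>?T N. \<Sum>p\<in>I. ex (al p * real u) * P p (?\<nu> t)) / of_nat Q"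
      by (simp only: of_real_diff of_real_divide of_real_sum G_def H_def expand of_real_of_nat_eq)
    also have "(\<Sum>u<Q. \<Sum>t\<in>?T N. \<Sum>p\<in>I. ex (al p * real u) * P p (?\<nu> t)) / of_nat Q
        = (\<Sum>t\<in>?T N. \<Sum>p\<in>I. b p * P p (?\<nu> t))"
      unfolding b_def sum_divide_distrib sum_distrib_right
      by (subst sum.swap, rule sum.cong[OF refl], subst sum.swap) simp
    also have "(\<Sum>t\<in>?T N. \<Sum>p\<in>I. ex (al p * of_int (?\<nu> t)) * P p (?\<nu> t)) - \<dots>
        = (\<Sum>p\<in>I. \<Sum>t\<in>?T N. (ex (al p * of_int (?\<nu> t)) - b p) * P p (?\<nu> t))"
      unfolding sum_subtractf[symmetric] left_diff_distrib[symmetric] by (rule sum.swap)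
    also have "norm \<dots> \<le> (\<Sum>p\<in>I. M ^ r * M ^ r * (2 / d)\<^sup>2)"
    proof (rule sum_norm_le)
      fix p assume p: "p \<in> I"
      have Mnn: "0 \<le> M ^ r * M ^ r * (2 / d)\<^sup>2"
        by (rule mult_nonneg_nonneg[OF zero_le_square zero_le_power2])
      show "norm (\<Sum>t\<in>?T N. (ex (al p * of_int (?\<nu> t)) - b p) * P p (?\<nu> t)) \<le> M ^ r * M ^ r * (2 / d)\<^sup>2"
      proof (cases "al p \<in> \<int>")
        case True
        then have "b p = 1" using Q by (simp add: b_def)
        then show ?thesis using True Mnn by simp
      next
        case False
        then have b0: "b p = 0" using sum_ex_roots[OF alQ[OF p]] by (simp add: b_def)
        obtain \<tau> \<sigma> where p': "p = (\<tau>, \<sigma>)" "\<tau> \<in> {..<r} \<rightarrow>\<^sub>E \<Theta>" "\<sigma> \<in> {..<r} \<rightarrow>\<^sub>E \<Theta>"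
          using p by (auto simp: I_def)
        have "2 * real r * s + d \<le> \<bar>al p - of_int l\<bar>" for l
          using sep[of \<tau> \<sigma> l] False p' by (auto simp: al_def PiE_def)
        from bandlimited_cesaro_bounded[OF PB[OF p] d this, of N]
        show ?thesis by (simp add: b0 case_prod_unfold)
      qed
    qed
    finally show ?thesis by (simp only: norm_of_real K_def sum_constant)
  qed
  define E where "E = (\<Sum>u<Q. D u) / real Q"
  have Gnn: "G n \<ge> 0" for n by (simp add: G_def)
  \<comment> \<open>For fixed \<open>k\<close> the differences \<open>j - k\<close> are distinct, so
    the hypothesis bounds the sum over \<open>j\<close> by \<open>D u\<close>; there are
    \<open>N\<close> values of \<open>k\<close>.\<close>
  have upper: "(\<Sum>t\<in>?T N. G (?\<nu> t)) \<le> real N * E + K" for N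
  proof -
    have "(\<Sum>t\<in>?T N. H u (?\<nu> t)) \<le> real N * D u" if "u < Q" for u
    proof -
      have "(\<Sum>t\<in>?T N. H u (?\<nu> t)) = (\<Sum>k<N. \<Sum>j<N. H u (int j - int k))"
        by (subst sum.swap) (simp add: sum.cartesian_product case_prod_unfold)
      also have "\<dots> \<le> (\<Sum>k<N. D u)"
      proof (rule sum_mono)
        fix k
        have "(\<Sum>j<N. H u (int j - int k)) = (\<Sum>n\<in>(\<lambda>j. int j - int k) ` {..<N}. H u n)"
          by (subst sum.reindex) (auto simp: inj_on_def)
        also have "\<dots> \<le> D u" unfolding H_def by (rule bound[OF that]) simp
        finally show "(\<Sum>j<N. H u (int j - int k)) \<le> D u" .
      qed
      finally show ?thesis by simp
    qed
    then have "(\<Sum>u<Q. \<Sum>t\<in>?T N. H u (?\<nu> t)) \<le> (\<Sum>u<Q. real N * D u)" by (intro sum_mono) auto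
    then have "(\<Sum>u<Q. \<Sum>t\<in>?T N. H u (?\<nu> t)) / real Q \<le> real N * E"
      using Q by (simp add: E_def divide_right_mono sum_distrib_left[symmetric])
    then show ?thesis using cesaro[of N] by linarith
  qed
  define S where "S = (\<Sum>n\<in>A. G n)"
  obtain m where m: "A \<subseteq> {- int m..int m}" using subset_int_interval[OF A] .
  \<comment> \<open>For \<open>k\<close> between \<open>m\<close> and \<open>m + N\<close> every
    \<open>n\<close> in \<open>A\<close> occurs as some \<open>j - k\<close> with
    \<open>j < N + 2 * m\<close>. Lengthening the window by \<open>2 * m\<close> makes up for the
    extent of \<open>A\<close> on both sides.\<close>
  have lower: "real N * S \<le> (\<Sum>t\<in>?T (N + 2 * m). G (?\<nu> t))" for N
  proof -
    have "real N * S = (\<Sum>k\<in>{m..<m + N}. S)" by simp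
    also have "\<dots> \<le> (\<Sum>k\<in>{m..<m + N}. \<Sum>j<N + 2 * m. G (int j - int k))"
    proof (rule sum_mono)
      fix k assume k: "k \<in> {m..<m + N}"
      have "S \<le> (\<Sum>n\<in>(\<lambda>j. int j - int k) ` {..<N + 2 * m}. G n)"
        unfolding S_def
      proof (rule sum_mono2)
        show "A \<subseteq> (\<lambda>j. int j - int k) ` {..<N + 2 * m}"
        proof
          fix a assume "a \<in> A"
          then have "- int m \<le> a" "a \<le> int m" using m by auto
          then have "a = int (nat (a + int k)) - int k" "nat (a + int k) < N + 2 * m" using k by auto
          then show "a \<in> (\<lambda>j. int j - int k) ` {..<N + 2 * m}" by blast
        qed
      qed (use Gnn in auto)
      also have "\<dots> = (\<Sum>j<N + 2 * m. G (int j - int k))"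
        by (subst sum.reindex) (auto simp: inj_on_def)
      finally show "S \<le> (\<Sum>j<N + 2 * m. G (int j - int k))" .
    qed
    also have "\<dots> \<le> (\<Sum>k<N + 2 * m. \<Sum>j<N + 2 * m. G (int j - int k))"
      by (rule sum_mono2) (auto intro!: sum_nonneg Gnn)
    also have "\<dots> = (\<Sum>t\<in>?T (N + 2 * m). G (?\<nu> t))"
      by (subst sum.swap) (simp add: sum.cartesian_product case_prod_unfold)
    finally show ?thesis .
  qed
  \<comment> \<open>The lower bound grows like \<open>N * S\<close> and the upper bound like
    \<open>N * E\<close>; the terms \<open>2 * m * E\<close> and \<open>K\<close> do not grow with
    \<open>N\<close>.\<close>
  have "S \<le> E"
  proof (rule ccontr)
    assume "\<not> S \<le> E"
    then obtain N :: nat where N: "real N * (S - E) > 2 * real m * E + K"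
      using reals_Archimedean3[of "S - E"] by (auto simp: mult.commute)
    have "real N * S \<le> real (N + 2 * m) * E + K" using lower[of N] upper[of "N + 2 * m"] by linarith
    with N show False by (simp add: algebra_simps)
  qed
  then show ?thesis by (simp add: S_def E_def G_def)
qed

section \<open>Rosenthal's inequality\<close>

lemma sum_mod_coprime:
  fixes g h :: "nat \<Rightarrow> 'a :: comm_semiring_0"
  assumes "coprime m n" "m > 0" "n > 0"
  shows "(\<Sum>u<m * n. g (u mod m) * h (u mod n)) = (\<Sum>u<m. g u) * (\<Sum>u<n. h u)"
proof -
  have inj: "inj_on (\<lambda>u. (u mod m, u mod n)) {..<m * n}"
  proof (rule inj_onI)
    fix u v assume uv: "u \<in> {..<m * n}" "v \<in> {..<m * n}" "(u mod m, u mod n) = (v mod m, v mod n)"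
    then have "[u = v] (mod m)" "[u = v] (mod n)" by (simp_all add: cong_def)
    then have "[u = v] (mod m * n)" using assms(1) by (rule coprime_cong_mult_nat)
    then show "u = v" using uv(1,2) by (auto simp: cong_def)
  qed
  have "(\<lambda>u. (u mod m, u mod n)) ` {..<m * n} = {..<m} \<times> {..<n}"
    by (rule card_seteq) (use assms in \<open>auto simp: card_image[OF inj] card_cartesian_product\<close>)
  then have "bij_betw (\<lambda>u. (u mod m, u mod n)) {..<m * n} ({..<m} \<times> {..<n})"
    using inj by (simp add: bij_betw_def)
  then have "(\<Sum>u<m * n. (\<lambda>(a, b). g a * h b) (u mod m, u mod n)) = (\<Sum>(a, b)\<in>{..<m} \<times> {..<n}. g a * h b)"
    by (rule sum.reindex_bij_betw)
  then show ?thesis by (simp add: sum_product sum.cartesian_product)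
qed

definition avg :: "nat \<Rightarrow> (nat \<Rightarrow> real) \<Rightarrow> real" where
  "avg n g = (\<Sum>u<n. g u) / real n"

lemma avg_nonneg: "(\<And>u. g u \<ge> 0) \<Longrightarrow> avg n g \<ge> 0"
  by (simp add: avg_def sum_nonneg)

lemma avg_mono: "(\<And>u. u < n \<Longrightarrow> g u \<le> h u) \<Longrightarrow> avg n g \<le> avg n h"
  unfolding avg_def by (intro divide_right_mono sum_mono) auto

lemma avg_add: "avg n (\<lambda>u. g u + h u) = avg n g + avg n h"
  by (simp add: avg_def sum.distrib add_divide_distrib)

lemma avg_cmult: "avg n (\<lambda>u. c * g u) = c * avg n g"
  by (simp add: avg_def sum_distrib_left)

lemma avg_const: "n > 0 \<Longrightarrow> avg n (\<lambda>_. c) = c"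
  by (simp add: avg_def)

lemma avg_mod_coprime:
  assumes "coprime m n" "m > 0" "n > 0"
  shows "avg (m * n) (\<lambda>u. g (u mod m) * h (u mod n)) = avg m g * avg n h"
  using sum_mod_coprime[OF assms, of g h] by (simp add: avg_def)

text \<open>To be read with \<open>A\<close> and \<open>B\<close> the squared moduli of
  \<open>s\<close> and \<open>x\<close> and \<open>L\<close> twice the real part of
  \<open>cnj s * x\<close>, so that the condition on \<open>L\<close> is Cauchy-Schwarz. The term
  linear in \<open>L\<close> is kept exactly because it will average to zero; everything of higher
  order is absorbed into the two extreme monomials.\<close>

lemma power_perturb_le_real:
  "\<exists>C\<ge>0. \<forall>A B L :: real. 0 \<le> A \<longrightarrow> 0 \<le> B \<longrightarrow> L\<^sup>2 \<le> 4 * A * B \<longrightarrow>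
     (A + L + B) ^ Suc r \<le> A ^ Suc r + real (Suc r) * A ^ r * L + C * (A ^ r * B + B ^ Suc r)"
proof (induction r)
  case 0
  show ?case by (intro exI[of _ 1]) auto
next
  case (Suc r)
  then obtain C where C: "C \<ge> 0" and le: "\<And>A B L :: real. 0 \<le> A \<Longrightarrow> 0 \<le> B \<Longrightarrow> L\<^sup>2 \<le> 4 * A * B \<Longrightarrow>
     (A + L + B) ^ Suc r \<le> A ^ Suc r + real (Suc r) * A ^ r * L + C * (A ^ r * B + B ^ Suc r)"
    by blast
  show ?case
  \<comment> \<open>The constant collects 4 from \<open>t1\<close> and 2 from \<open>t2\<close>,
    each with factor \<open>Suc r\<close>, then 1 from \<open>U1\<close> and 6 from
    \<open>t3\<close> with the inherited factor \<open>C\<close>.\<close>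
  proof (intro exI[of _ "6 * real (Suc r) + 1 + 6 * C"] conjI allI impI)
    fix A B L :: real
    assume A: "0 \<le> A" and B: "0 \<le> B" and L: "L\<^sup>2 \<le> 4 * A * B"
    define U where "U = A ^ Suc r * B + B ^ Suc (Suc r)"
    have "L\<^sup>2 \<le> (A + B)\<^sup>2"
      using L zero_le_power2[of "A - B"] by (simp add: power2_eq_square algebra_simps)
    then have Lab: "\<bar>L\<bar> \<le> A + B" using A B by (simp add: abs_le_square_iff[symmetric])
    have m1: "A ^ r * B\<^sup>2 \<le> U"
    proof (cases "B \<le> A")
      case True
      then have "A ^ r * B * B \<le> A ^ r * B * A" using A B by (intro mult_left_mono) auto
      then show ?thesis using A B unfolding U_def by (simp add: power2_eq_square mult_ac add_increasing2)
    next
      case False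
      then have "A ^ r * B\<^sup>2 \<le> B ^ r * B\<^sup>2" using A B by (intro mult_right_mono power_mono) auto
      then show ?thesis using A B unfolding U_def by (simp add: power2_eq_square mult_ac add_increasing)
    qed
    have m2: "A * B ^ Suc r \<le> U"
    proof (cases "B \<le> A")
      case True
      then have "A * B * B ^ r \<le> A * B * A ^ r" using A B by (intro mult_left_mono power_mono) auto
      then show ?thesis using A B unfolding U_def by (simp add: mult_ac add_increasing2)
    next
      case False
      then have "A * B ^ Suc r \<le> B * B ^ Suc r" using A B by (intro mult_right_mono) auto
      then show ?thesis using A B unfolding U_def by (simp add: add_increasing)
    qed
    have U1: "A ^ Suc r * B \<le> U" using B by (simp add: U_def)
    have t1: "A ^ r * L\<^sup>2 \<le> 4 * U"
    proof -
      have "A ^ r * L\<^sup>2 \<le> A ^ r * (4 * A * B)" using A L by (intro mult_left_mono) auto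
      then show ?thesis using U1 by (simp add: mult_ac)
    qed
    have t2: "A ^ r * L * B \<le> 2 * U"
    proof -
      have "A ^ r * B * L \<le> A ^ r * B * (A + B)" using A B Lab by (intro mult_left_mono) auto
      also have "\<dots> = A ^ Suc r * B + A ^ r * B\<^sup>2" by (simp add: power2_eq_square algebra_simps)
      finally show ?thesis using U1 m1 by (simp add: mult_ac)
    qed
    have t3: "(A + L + B) * (A ^ r * B + B ^ Suc r) \<le> 6 * U"
    proof -
      have "(A + L + B) * (A ^ r * B + B ^ Suc r) \<le> (2 * (A + B)) * (A ^ r * B + B ^ Suc r)"
        using A B Lab by (intro mult_right_mono) auto
      also have "\<dots> = 2 * (U + A ^ r * B\<^sup>2 + A * B ^ Suc r)"
        by (simp add: U_def power2_eq_square algebra_simps)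
      also have "\<dots> \<le> 2 * (U + U + U)" by (intro mult_left_mono add_mono m1 m2) auto
      finally show ?thesis by simp
    qed
    have nn: "A + L + B \<ge> 0" using Lab by linarith
    have "(A + L + B) ^ Suc (Suc r) \<le> (A + L + B) * (A ^ Suc r + real (Suc r) * A ^ r * L + C * (A ^ r * B + B ^ Suc r))"
      unfolding power_Suc[of _ "Suc r"] by (intro mult_left_mono le A B L nn)
    also have "\<dots> = A ^ Suc (Suc r) + real (Suc (Suc r)) * A ^ Suc r * L
        + (real (Suc r) * (A ^ r * L\<^sup>2) + A ^ Suc r * B + real (Suc r) * (A ^ r * L * B))
        + C * ((A + L + B) * (A ^ r * B + B ^ Suc r))"
      by (simp add: power2_eq_square algebra_simps)
    also have "\<dots> \<le> A ^ Suc (Suc r) + real (Suc (Suc r)) * A ^ Suc r * L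
        + (real (Suc r) * (4 * U) + U + real (Suc r) * (2 * U)) + C * (6 * U)"
      by (intro add_mono order_refl mult_left_mono t1 t2 t3 U1 C) auto
    finally show "(A + L + B) ^ Suc (Suc r) \<le> A ^ Suc (Suc r) + real (Suc (Suc r)) * A ^ Suc r * L
        + (6 * real (Suc r) + 1 + 6 * C) * (A ^ Suc r * B + B ^ Suc (Suc r))"
      unfolding U_def[symmetric] by (simp add: algebra_simps)
  qed (use C in auto)
qed

lemma norm_add_power_le:
  "\<exists>C\<ge>0. \<forall>s x :: complex. norm (s + x) ^ (2 * Suc r) \<le>
     norm s ^ (2 * Suc r) + 2 * real (Suc r) * Re (norm s ^ (2 * r) * cnj s * x)
       + C * (norm s ^ (2 * r) * norm x ^ 2 + norm x ^ (2 * Suc r))"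
proof -
  obtain C :: real where C: "C \<ge> 0" and le: "\<And>A B L :: real. 0 \<le> A \<Longrightarrow> 0 \<le> B \<Longrightarrow> L\<^sup>2 \<le> 4 * A * B \<Longrightarrow>
     (A + L + B) ^ Suc r \<le> A ^ Suc r + real (Suc r) * A ^ r * L + C * (A ^ r * B + B ^ Suc r)"
    using power_perturb_le_real[of r] by blast
  show ?thesis
  proof (intro exI[of _ C] conjI C allI)
    fix s x :: complex
    define L where "L = 2 * Re (cnj s * x)"
    have "(Re (cnj s * x))\<^sup>2 \<le> (norm (cnj s * x))\<^sup>2"
      using abs_Re_le_cmod by (metis abs_le_square_iff abs_norm_cancel)
    moreover have "L\<^sup>2 = 4 * (Re (cnj s * x))\<^sup>2"
      unfolding L_def power_mult_distrib by simp
    ultimately have L: "L\<^sup>2 \<le> 4 * (norm s)\<^sup>2 * (norm x)\<^sup>2"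
      by (simp add: norm_mult power_mult_distrib)
    have eq: "(norm (s + x))\<^sup>2 = (norm s)\<^sup>2 + L + (norm x)\<^sup>2"
      unfolding cmod_power2 L_def by (simp add: power2_eq_square algebra_simps)
    have p: "a ^ (2 * k) = (a\<^sup>2) ^ k" for a :: real and k
      by (rule power_mult)
    have "norm (s + x) ^ (2 * Suc r) = ((norm s)\<^sup>2 + L + (norm x)\<^sup>2) ^ Suc r"
      unfolding eq[symmetric] by (rule power_mult)
    also have "\<dots> \<le> ((norm s)\<^sup>2) ^ Suc r + real (Suc r) * ((norm s)\<^sup>2) ^ r * L
        + C * (((norm s)\<^sup>2) ^ r * (norm x)\<^sup>2 + ((norm x)\<^sup>2) ^ Suc r)"
      by (intro le L) auto
    finally have 1: "norm (s + x) ^ (2 * Suc r) \<le> ((norm s)\<^sup>2) ^ Suc r + real (Suc r) * ((norm s)\<^sup>2) ^ r * L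
        + C * (((norm s)\<^sup>2) ^ r * (norm x)\<^sup>2 + ((norm x)\<^sup>2) ^ Suc r)" .
    have "((norm s)\<^sup>2) ^ r * L = 2 * Re (norm s ^ (2 * r) * cnj s * x)"
    proof -
      have "Re (norm s ^ (2 * r) * cnj s * x) = norm s ^ (2 * r) * Re (cnj s * x)"
      proof -
        have "norm s ^ (2 * r) * cnj s * x = complex_of_real (norm s ^ (2 * r)) * (cnj s * x)"
          by (simp only: of_real_power mult.assoc)
        moreover have "Re (complex_of_real a * z) = a * Re z" for a z by simp
        ultimately show ?thesis by (simp only:)
      qed
      then show ?thesis by (simp add: L_def power_mult)
    qed
    then have 2: "real (Suc r) * ((norm s)\<^sup>2) ^ r * L = 2 * real (Suc r) * Re (norm s ^ (2 * r) * cnj s * x)"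
      by (metis mult.assoc mult.left_commute)
    show "norm (s + x) ^ (2 * Suc r) \<le>
     norm s ^ (2 * Suc r) + 2 * real (Suc r) * Re (norm s ^ (2 * r) * cnj s * x)
       + C * (norm s ^ (2 * r) * norm x ^ 2 + norm x ^ (2 * Suc r))"
      using 1 unfolding 2 p[of "norm s"] p[of "norm x"] .
  qed
qed

section \<open>Moments of sums of independent blocks\<close>

text \<open>Functions periodic modulo pairwise coprime \<open>q\<close> are independent on \<open>\<int>/\<Prod>Z\<close>.\<close>

definition indep_zero_mean :: "nat set \<Rightarrow> (nat \<Rightarrow> nat \<Rightarrow> complex) \<Rightarrow> bool" where
  "indep_zero_mean Z X \<longleftrightarrow> finite Z \<and> pairwise coprime Z \<and>
     (\<forall>q\<in>Z. q > 0 \<and> (\<forall>u. X q u = X q (u mod q)) \<and> (\<Sum>u<q. X q u) = 0)"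

lemma indep_zero_mean_subset: "indep_zero_mean Z X \<Longrightarrow> Z' \<subseteq> Z \<Longrightarrow> indep_zero_mean Z' X"
  unfolding indep_zero_mean_def pairwise_def by (blast intro: finite_subset)

lemma sum_periodic_mod_prod:
  assumes "indep_zero_mean Z X"
  shows "(\<Sum>q\<in>Z. X q u) = (\<Sum>q\<in>Z. X q (u mod \<Prod>Z))"
proof (rule sum.cong[OF refl])
  fix q assume q: "q \<in> Z"
  with assms have "q dvd \<Prod>Z" by (auto simp: indep_zero_mean_def intro: dvd_prodI)
  then have "u mod \<Prod>Z mod q = u mod q" by (simp add: mod_mod_cancel)
  then show "X q u = X q (u mod \<Prod>Z)"
    using assms q unfolding indep_zero_mean_def by metis
qed

text \<open>The moduli are added one at a time. With \<open>s\<close> the partial sum and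
  \<open>x\<close> the new block, the linear term averages to zero and the mixed term splits into a
  product of averages by independence. The bound \<open>K\<close> on the lower moment is asked for
  all subsets because the partial sums run through subsets of \<open>Z\<close>.\<close>

lemma avg_moment_step:
  "\<exists>C\<ge>0. \<forall>Z X K. indep_zero_mean Z X \<longrightarrow>
     (\<forall>Z'\<subseteq>Z. avg (\<Prod>Z') (\<lambda>u. norm (\<Sum>q\<in>Z'. X q u) ^ (2 * r)) \<le> K) \<longrightarrow>
     avg (\<Prod>Z) (\<lambda>u. norm (\<Sum>q\<in>Z. X q u) ^ (2 * Suc r))
       \<le> C * (\<Sum>q\<in>Z. K * avg q (\<lambda>u. norm (X q u) ^ 2) + avg q (\<lambda>u. norm (X q u) ^ (2 * Suc r)))"
proof -
  obtain C where C: "C \<ge> 0" and le: "\<And>s x :: complex. norm (s + x) ^ (2 * Suc r) \<le>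
     norm s ^ (2 * Suc r) + 2 * real (Suc r) * Re (norm s ^ (2 * r) * cnj s * x)
       + C * (norm s ^ (2 * r) * norm x ^ 2 + norm x ^ (2 * Suc r))"
    using norm_add_power_le[of r] by blast
  show ?thesis
  proof (intro exI[of _ C] conjI C allI impI)
    fix Z X K
    assume ind: "indep_zero_mean Z X"
      and K: "\<forall>Z'\<subseteq>Z. avg (\<Prod>Z') (\<lambda>u. norm (\<Sum>q\<in>Z'. X q u) ^ (2 * r)) \<le> K"
    then have "finite Z" by (simp add: indep_zero_mean_def)
    then show "avg (\<Prod>Z) (\<lambda>u. norm (\<Sum>q\<in>Z. X q u) ^ (2 * Suc r))
       \<le> C * (\<Sum>q\<in>Z. K * avg q (\<lambda>u. norm (X q u) ^ 2) + avg q (\<lambda>u. norm (X q u) ^ (2 * Suc r)))"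
      using ind K
    proof (induction Z rule: finite_induct)
      case empty
      show ?case by (simp add: avg_def)
    next
      case (insert q Z)
      have indZ: "indep_zero_mean Z X"
        using insert.prems(1) by (rule indep_zero_mean_subset) auto
      have q: "q > 0" "\<And>u. X q u = X q (u mod q)" "(\<Sum>u<q. X q u) = 0"
        using insert.prems(1) unfolding indep_zero_mean_def by blast+
      define P where "P = \<Prod>Z"
      define S where "S u = (\<Sum>q\<in>Z. X q u)" for u
      have P: "P > 0" using indZ unfolding P_def indep_zero_mean_def by (intro prod_pos) auto
      have cop: "coprime q P"
        unfolding P_def
      proof (rule prod_coprime_right)
        fix p assume "p \<in> Z"
        moreover from this have "q \<noteq> p" using insert.hyps(2) by auto
        ultimately show "coprime q p"
          using insert.prems(1) by (auto simp: indep_zero_mean_def pairwise_insert)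
      qed
      have S: "S u = S (u mod P)" for u
        unfolding S_def P_def by (rule sum_periodic_mod_prod[OF indZ])
      have split: "avg (q * P) (\<lambda>u. g (X q u) * h (S u)) = avg q (\<lambda>u. g (X q u)) * avg P (\<lambda>u. h (S u))" for g h
      proof -
        have "avg (q * P) (\<lambda>u. g (X q u) * h (S u)) = avg (q * P) (\<lambda>u. g (X q (u mod q)) * h (S (u mod P)))"
          by (simp only: q(2)[symmetric] S[symmetric])
        also have "\<dots> = avg q (\<lambda>u. g (X q u)) * avg P (\<lambda>u. h (S u))"
          by (rule avg_mod_coprime[OF cop q(1) P])
        finally show ?thesis .
      qed
      \<comment> \<open>Independence turns this average into a product with factor the average of
        \<open>X q\<close>, which is zero.\<close>
      have cross: "avg (q * P) (\<lambda>u. Re (norm (S u) ^ (2 * r) * cnj (S u) * X q u)) = 0"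
      proof -
        have "(\<Sum>u<q * P. X q (u mod q) * (norm (S (u mod P)) ^ (2 * r) * cnj (S (u mod P)))) = 0"
          using sum_mod_coprime[OF cop q(1) P, of "X q" "\<lambda>u. norm (S u) ^ (2 * r) * cnj (S u)"] q(3) by simp
        then have "(\<Sum>u<q * P. norm (S u) ^ (2 * r) * cnj (S u) * X q u) = 0"
          by (simp only: q(2)[symmetric] S[symmetric] mult_ac)
        then have "Re (\<Sum>u<q * P. norm (S u) ^ (2 * r) * cnj (S u) * X q u) = 0" by simp
        then show ?thesis unfolding avg_def Re_sum by simp
      qed
      have one: "avg q (\<lambda>_. 1) = 1" "avg P (\<lambda>_. 1) = 1" using q P by (simp_all add: avg_const)
      have "avg (\<Prod>(insert q Z)) (\<lambda>u. norm (\<Sum>q\<in>insert q Z. X q u) ^ (2 * Suc r))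
          = avg (q * P) (\<lambda>u. norm (S u + X q u) ^ (2 * Suc r))"
        using insert.hyps by (simp add: P_def S_def add.commute)
      also have "\<dots> \<le> avg (q * P) (\<lambda>u. norm (S u) ^ (2 * Suc r)
          + 2 * real (Suc r) * Re (norm (S u) ^ (2 * r) * cnj (S u) * X q u)
          + C * (norm (S u) ^ (2 * r) * norm (X q u) ^ 2 + norm (X q u) ^ (2 * Suc r)))"
        by (intro avg_mono le)
      also have "\<dots> = avg (q * P) (\<lambda>u. norm (S u) ^ (2 * Suc r))
          + C * (avg (q * P) (\<lambda>u. norm (S u) ^ (2 * r) * norm (X q u) ^ 2) + avg (q * P) (\<lambda>u. norm (X q u) ^ (2 * Suc r)))"
        unfolding avg_add avg_cmult cross by simp
      also have "avg (q * P) (\<lambda>u. norm (S u) ^ (2 * Suc r)) = avg P (\<lambda>u. norm (S u) ^ (2 * Suc r))"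
        using split[of "\<lambda>_. 1" "\<lambda>s. norm s ^ (2 * Suc r)"] one by (simp only: mult_1)
      also have "avg (q * P) (\<lambda>u. norm (S u) ^ (2 * r) * norm (X q u) ^ 2)
          = avg q (\<lambda>u. norm (X q u) ^ 2) * avg P (\<lambda>u. norm (S u) ^ (2 * r))"
        using split[of "\<lambda>x. norm x ^ 2" "\<lambda>s. norm s ^ (2 * r)"] by (simp only: mult.commute)
      also have "avg (q * P) (\<lambda>u. norm (X q u) ^ (2 * Suc r)) = avg q (\<lambda>u. norm (X q u) ^ (2 * Suc r))"
        using split[of "\<lambda>x. norm x ^ (2 * Suc r)" "\<lambda>_. 1"] one by (simp only: mult_1_right)
      also have "avg P (\<lambda>u. norm (S u) ^ (2 * Suc r)) + C * (avg q (\<lambda>u. norm (X q u) ^ 2) * avg P (\<lambda>u. norm (S u) ^ (2 * r))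
           + avg q (\<lambda>u. norm (X q u) ^ (2 * Suc r)))
         \<le> C * (\<Sum>q\<in>Z. K * avg q (\<lambda>u. norm (X q u) ^ 2) + avg q (\<lambda>u. norm (X q u) ^ (2 * Suc r)))
           + C * (avg q (\<lambda>u. norm (X q u) ^ 2) * K + avg q (\<lambda>u. norm (X q u) ^ (2 * Suc r)))"
      proof (intro add_mono mult_left_mono C order_refl)
        show "avg P (\<lambda>u. norm (S u) ^ (2 * Suc r))
          \<le> C * (\<Sum>q\<in>Z. K * avg q (\<lambda>u. norm (X q u) ^ 2) + avg q (\<lambda>u. norm (X q u) ^ (2 * Suc r)))"
          unfolding P_def S_def by (rule insert.IH[OF indZ]) (use insert.prems(2) in blast)
        show "avg P (\<lambda>u. norm (S u) ^ (2 * r)) \<le> K"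
          unfolding P_def S_def using insert.prems(2) by blast
        show "0 \<le> avg q (\<lambda>u. norm (X q u) ^ 2)" by (rule avg_nonneg) simp
      qed
      finally show ?case using insert.hyps by (simp add: algebra_simps)
    qed
  qed
qed

text \<open>Induction on \<open>r\<close>: the inequality for \<open>r\<close>, monotone in the set
  of moduli, provides the bound \<open>K\<close> that \<open>avg_moment_step\<close> requires. The
  one product this creates, the variance times the sum of the \<open>2r\<close>-th moments, is
  interpolated between the two terms of the next inequality.\<close>

lemma rosenthal_inequality:
  assumes "r \<ge> 1"
  shows "\<exists>C\<ge>0. \<forall>Z X. indep_zero_mean Z X \<longrightarrow>
     avg (\<Prod>Z) (\<lambda>u. norm (\<Sum>q\<in>Z. X q u) ^ (2 * r))
       \<le> C * ((\<Sum>q\<in>Z. avg q (\<lambda>u. norm (X q u) ^ 2)) ^ r + (\<Sum>q\<in>Z. avg q (\<lambda>u. norm (X q u) ^ (2 * r))))"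
  using assms
proof (induction r rule: dec_induct)
  case base
  obtain C where C: "C \<ge> 0" and step: "\<And>Z X K. indep_zero_mean Z X \<Longrightarrow>
     (\<forall>Z'\<subseteq>Z. avg (\<Prod>Z') (\<lambda>u. norm (\<Sum>q\<in>Z'. X q u) ^ (2 * 0)) \<le> K) \<Longrightarrow>
     avg (\<Prod>Z) (\<lambda>u. norm (\<Sum>q\<in>Z. X q u) ^ (2 * Suc 0))
       \<le> C * (\<Sum>q\<in>Z. K * avg q (\<lambda>u. norm (X q u) ^ 2) + avg q (\<lambda>u. norm (X q u) ^ (2 * Suc 0)))"
    using avg_moment_step[of 0] by blast
  show ?case
  proof (intro exI[of _ C] conjI C allI impI)
    fix Z X assume ind: "indep_zero_mean Z X"
    have "avg (\<Prod>Z') (\<lambda>u. norm (\<Sum>q\<in>Z'. X q u) ^ (2 * 0)) \<le> 1" if "Z' \<subseteq> Z" for Z'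
      by (simp add: avg_def)
    from step[OF ind, of 1] this
    show "avg (\<Prod>Z) (\<lambda>u. norm (\<Sum>q\<in>Z. X q u) ^ (2 * 1))
       \<le> C * ((\<Sum>q\<in>Z. avg q (\<lambda>u. norm (X q u) ^ 2)) ^ 1 + (\<Sum>q\<in>Z. avg q (\<lambda>u. norm (X q u) ^ (2 * 1))))"
      by (simp add: sum_distrib_left)
  qed
next
  case (step r)
  obtain C where C: "C \<ge> 0" and IH: "\<And>Z X. indep_zero_mean Z X \<Longrightarrow>
     avg (\<Prod>Z) (\<lambda>u. norm (\<Sum>q\<in>Z. X q u) ^ (2 * r))
       \<le> C * ((\<Sum>q\<in>Z. avg q (\<lambda>u. norm (X q u) ^ 2)) ^ r + (\<Sum>q\<in>Z. avg q (\<lambda>u. norm (X q u) ^ (2 * r))))"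
    using step.IH by blast
  obtain C1 where C1: "C1 \<ge> 0" and moment: "\<And>Z X K. indep_zero_mean Z X \<Longrightarrow>
     (\<forall>Z'\<subseteq>Z. avg (\<Prod>Z') (\<lambda>u. norm (\<Sum>q\<in>Z'. X q u) ^ (2 * r)) \<le> K) \<Longrightarrow>
     avg (\<Prod>Z) (\<lambda>u. norm (\<Sum>q\<in>Z. X q u) ^ (2 * Suc r))
       \<le> C1 * (\<Sum>q\<in>Z. K * avg q (\<lambda>u. norm (X q u) ^ 2) + avg q (\<lambda>u. norm (X q u) ^ (2 * Suc r)))"
    using avg_moment_step[of r] by blast
  show ?case
  \<comment> \<open>The power \<open>v Z ^ Suc r\<close> occurs twice with factor \<open>C\<close>,
    once directly and once through \<open>key\<close>; the extra 1 pays for the top moments of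
    \<open>avg_moment_step\<close>.\<close>
  proof (intro exI[of _ "C1 * (2 * C + 1)"] conjI allI impI)
    fix Z X assume ind: "indep_zero_mean Z X"
    then have fin: "finite Z" by (simp add: indep_zero_mean_def)
    define v where "v Z' = (\<Sum>q\<in>Z'. avg q (\<lambda>u. norm (X q u) ^ 2))" for Z'
    define M where "M k Z' = (\<Sum>q\<in>Z'. avg q (\<lambda>u. norm (X q u) ^ (2 * k)))" for k Z'
    have nn: "v Z' \<ge> 0" "M k Z' \<ge> 0" for k Z'
      by (auto simp: v_def M_def intro!: sum_nonneg avg_nonneg)
    have "avg (\<Prod>Z') (\<lambda>u. norm (\<Sum>q\<in>Z'. X q u) ^ (2 * r)) \<le> C * (v Z ^ r + M r Z)" if "Z' \<subseteq> Z" for Z'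
    proof -
      have "avg (\<Prod>Z') (\<lambda>u. norm (\<Sum>q\<in>Z'. X q u) ^ (2 * r)) \<le> C * (v Z' ^ r + M r Z')"
        unfolding v_def M_def by (rule IH[OF indep_zero_mean_subset[OF ind that]])
      also have "\<dots> \<le> C * (v Z ^ r + M r Z)"
      proof (intro mult_left_mono add_mono power_mono C nn)
        show "v Z' \<le> v Z" "M r Z' \<le> M r Z"
          unfolding v_def M_def using fin that by (auto intro!: sum_mono2 avg_nonneg)
      qed
      finally show ?thesis .
    qed
    then have "\<forall>Z'\<subseteq>Z. avg (\<Prod>Z') (\<lambda>u. norm (\<Sum>q\<in>Z'. X q u) ^ (2 * r)) \<le> C * (v Z ^ r + M r Z)"
      by blast
    from moment[OF ind this]
    have 1: "avg (\<Prod>Z) (\<lambda>u. norm (\<Sum>q\<in>Z. X q u) ^ (2 * Suc r))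
      \<le> C1 * (C * (v Z ^ r + M r Z) * v Z + M (Suc r) Z)"
      by (simp only: sum.distrib sum_distrib_left[symmetric] v_def[symmetric] M_def[symmetric])
    \<comment> \<open>Pointwise comparison: where the squared block is below the total variance one
      lowers its power to 1, elsewhere the variance factor is replaced by the block.\<close>
    have key: "v Z * M r Z \<le> v Z ^ Suc r + M (Suc r) Z"
    proof -
      let ?s = "v Z"
      have pw: "?s * norm (X q u) ^ (2 * r) \<le> ?s ^ r * norm (X q u) ^ 2 + norm (X q u) ^ (2 * Suc r)" for q u
      proof -
        define t where "t = (norm (X q u))\<^sup>2"
        have t: "t \<ge> 0" by (simp add: t_def)
        obtain k where k: "r = Suc k" using step.hyps by (metis Suc_le_D One_nat_def)
        have "?s * t ^ r \<le> ?s ^ r * t + t ^ Suc r"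
        proof (cases "t \<le> ?s")
          case True
          then have "(?s * t) * t ^ k \<le> (?s * t) * ?s ^ k" using t nn by (intro mult_left_mono power_mono) auto
          moreover have "0 \<le> t ^ Suc r" using t by simp
          ultimately show ?thesis unfolding k by (simp add: mult_ac)
        next
          case False
          then have "?s * t ^ r \<le> t * t ^ r" using t by (intro mult_right_mono) auto
          moreover have "0 \<le> ?s ^ r * t" using t nn by simp
          ultimately show ?thesis by simp
        qed
        then show ?thesis by (simp only: t_def power_mult)
      qed
      have "?s * M r Z = (\<Sum>q\<in>Z. avg q (\<lambda>u. ?s * norm (X q u) ^ (2 * r)))"
        by (simp only: M_def sum_distrib_left avg_cmult)
      also have "\<dots> \<le> (\<Sum>q\<in>Z. avg q (\<lambda>u. ?s ^ r * norm (X q u) ^ 2 + norm (X q u) ^ (2 * Suc r)))"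
        by (intro sum_mono avg_mono pw)
      also have "\<dots> = ?s ^ r * v Z + M (Suc r) Z"
        by (simp only: avg_add avg_cmult sum.distrib sum_distrib_left[symmetric] v_def M_def)
      finally show ?thesis by (simp add: mult.commute)
    qed
    have "C * (v Z ^ r + M r Z) * v Z = C * (v Z ^ Suc r + v Z * M r Z)"
      by (simp add: algebra_simps)
    also have "\<dots> \<le> C * (v Z ^ Suc r + (v Z ^ Suc r + M (Suc r) Z))"
      by (intro mult_left_mono add_mono order_refl key C)
    finally have 2: "C1 * (C * (v Z ^ r + M r Z) * v Z + M (Suc r) Z)
       \<le> C1 * (C * (v Z ^ Suc r + (v Z ^ Suc r + M (Suc r) Z)) + M (Suc r) Z)"
      using C1 by (intro mult_left_mono add_mono order_refl)
    note order_trans[OF 1 2]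
    also have "\<dots> \<le> C1 * ((2 * C + 1) * (v Z ^ Suc r + M (Suc r) Z))"
      using C C1 nn by (intro mult_left_mono) (auto simp: algebra_simps)
    finally show "avg (\<Prod>Z) (\<lambda>u. norm (\<Sum>q\<in>Z. X q u) ^ (2 * Suc r))
       \<le> C1 * (2 * C + 1) * ((\<Sum>q\<in>Z. avg q (\<lambda>u. norm (X q u) ^ 2)) ^ Suc r + (\<Sum>q\<in>Z. avg q (\<lambda>u. norm (X q u) ^ (2 * Suc r))))"
      by (simp add: v_def M_def)
  qed (use C C1 in auto)
qed

section \<open>Transference from the line to the integers\<close>

lemma powr_eq_power_2r:
  fixes x :: real
  assumes "r \<ge> 1" "x \<ge> 0"
  shows "x powr (2 * real r) = x ^ (2 * r)"
  using powr_realpow'[of x "2 * r"] assms by simp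

lemma Lp_iff_power:
  assumes "r \<ge> 1"
  shows "f \<in> Lp (2 * real r) M \<longleftrightarrow> f \<in> borel_measurable M \<and> integrable M (\<lambda>x. norm (f x) ^ (2 * r))"
  unfolding Lp_def using assms by (simp add: powr_eq_power_2r)

lemma Lp_norm_nonneg: "Lp_norm p M f \<ge> 0"
  by (simp add: Lp_norm_def)

lemma Lp_norm_power:
  assumes "r \<ge> 1"
  shows "Lp_norm (2 * real r) M f ^ (2 * r) = (\<integral>x. norm (f x) ^ (2 * r) \<partial>M)"
proof -
  have nn: "(\<integral>x. norm (f x) ^ (2 * r) \<partial>M) \<ge> 0" by simp
  have "Lp_norm (2 * real r) M f ^ (2 * r) = ((\<integral>x. norm (f x) ^ (2 * r) \<partial>M) powr (1 / (2 * real r))) powr (2 * real r)"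
    using assms by (simp add: Lp_norm_def powr_eq_power_2r)
  also have "\<dots> = (\<integral>x. norm (f x) ^ (2 * r) \<partial>M)"
    using assms nn by (simp add: powr_powr)
  finally show ?thesis .
qed

text \<open>The multiplier is merely Lebesgue measurable while the spatial side is Borel, so Fubini
  is applied on the mixed product of \<open>lborel\<close> and \<open>lebesgue\<close>.\<close>

lemma sigma_finite_lebesgue: "sigma_finite_measure (lebesgue :: real measure)"
proof
  obtain A :: "real set set" where A: "countable A" "A \<subseteq> sets lborel" "\<Union>A = space lborel" "\<forall>a\<in>A. emeasure lborel a \<noteq> \<infinity>"
    using lborel.sigma_finite_countable by blast
  show "\<exists>A::real set set. countable A \<and> A \<subseteq> sets lebesgue \<and> \<Union>A = space lebesgue \<and> (\<forall>a\<in>A. emeasure lebesgue a \<noteq> \<infinity>)"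
    by (rule exI[of _ A]) (use A in \<open>auto simp: emeasure_completion\<close>)
qed

interpretation lborel_lebesgue: pair_sigma_finite "lborel :: real measure" "lebesgue :: real measure"
  by (intro pair_sigma_finite.intro lborel.sigma_finite_measure_axioms sigma_finite_lebesgue)

text \<open>The convolution kernel of the multiplier operator. It is bounded, but in general not
  absolutely integrable: an indicator as \<open>m\<close> gives a sinc.\<close>

definition mult_kernel :: "(real \<Rightarrow> complex) \<Rightarrow> real \<Rightarrow> complex" where
  "mult_kernel m x = (\<integral>\<xi>. m \<xi> * ex (x * \<xi>) \<partial>lebesgue)"

lemma borel_measurable_ex_mult_lebesgue [measurable]:
  "(\<lambda>\<xi>. ex (x * \<xi>)) \<in> borel_measurable lebesgue" "(\<lambda>\<xi>. ex (\<xi> * x)) \<in> borel_measurable lebesgue"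
  by (rule measurable_completion, simp)+

lemma integrable_bounded_support:
  fixes m :: "real \<Rightarrow> complex"
  assumes [measurable]: "m \<in> borel_measurable lebesgue" and "bounded (range m)"
    and "\<And>x. x \<notin> {-1/2<..1/2} \<Longrightarrow> m x = 0"
  shows "integrable lebesgue m"
proof -
  obtain b where b: "\<And>x. norm (m x) \<le> b" using assms(2) by (auto simp: bounded_iff)
  have "integrable lebesgue (indicator {-1/2<..1/2::real} :: real \<Rightarrow> real)"
    by (rule integrable_real_indicator) (auto simp: emeasure_completion)
  then have i: "integrable lebesgue (\<lambda>x. b * indicator {-1/2<..1/2::real} x)" by simp
  show ?thesis
  proof (rule Bochner_Integration.integrable_bound[OF i])
    show "AE x in lebesgue. norm (m x) \<le> norm (b * indicator {-1/2<..1/2} x)"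
      using b assms(3) by (intro AE_I2) (auto simp: indicator_def intro: order_trans[OF _ abs_ge_self])
  qed simp
qed

context
  fixes m :: "real \<Rightarrow> complex"
  assumes m_int: "integrable lebesgue m"
    and m_supp: "\<And>x. x \<notin> {-1/2<..1/2} \<Longrightarrow> m x = 0"
begin

lemma m_meas [measurable]: "m \<in> borel_measurable lebesgue"
  using m_int by simp

lemma integrable_m_ex: "integrable lebesgue (\<lambda>\<xi>. m \<xi> * ex (x * \<xi>))"
  by (rule Bochner_Integration.integrable_bound[OF m_int]) (auto simp: norm_mult)

lemma pair_meas_ex [measurable]:
  "(\<lambda>p. ex (fst p * snd p)) \<in> borel_measurable (lborel \<Otimes>\<^sub>M lebesgue)"
proof -
  have [measurable]: "(\<lambda>x::real. x) \<in> borel_measurable lebesgue"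
    by (rule measurable_completion) simp
  have "(\<lambda>p. snd p) \<in> borel_measurable (lborel \<Otimes>\<^sub>M (lebesgue :: real measure))"
    using measurable_compose[OF measurable_snd \<open>(\<lambda>x::real. x) \<in> borel_measurable lebesgue\<close>] by simp
  then have "(\<lambda>p. fst p * snd p) \<in> borel_measurable (lborel \<Otimes>\<^sub>M (lebesgue :: real measure))"
    by (intro borel_measurable_times) simp_all
  then show ?thesis by (rule measurable_compose) simp
qed

lemma mult_kernel_meas [measurable]: "mult_kernel m \<in> borel_measurable borel"
proof -
  have "(\<lambda>x. \<integral>\<xi>. m \<xi> * ex (x * \<xi>) \<partial>lebesgue) \<in> borel_measurable lborel"
  proof (rule lborel_lebesgue.M2.borel_measurable_lebesgue_integral)
    have "(\<lambda>p. m (snd p) * ex (fst p * snd p)) \<in> borel_measurable (lborel \<Otimes>\<^sub>M lebesgue)"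
      by measurable
    then show "(\<lambda>(x, \<xi>). m \<xi> * ex (x * \<xi>)) \<in> borel_measurable (lborel \<Otimes>\<^sub>M lebesgue)"
      by (simp add: case_prod_unfold)
  qed
  then show ?thesis by (simp add: mult_kernel_def[abs_def])
qed

lemma norm_mult_kernel_le: "norm (mult_kernel m x) \<le> (\<integral>\<xi>. norm (m \<xi>) \<partial>lebesgue)"
  unfolding mult_kernel_def
  using integral_norm_bound[of lebesgue "\<lambda>\<xi>. m \<xi> * ex (x * \<xi>)"] by (simp add: norm_mult)

lemma integrable_vker_mult_kernel: "integrable lborel (\<lambda>y. vker (z - y) * mult_kernel m (y - c))"
proof -
  let ?b = "\<integral>\<xi>. norm (m \<xi>) \<partial>lebesgue"
  have "integrable lborel (\<lambda>y. vker (z - y))"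
    using lborel_integrable_real_affine[OF integrable_vker, of "-1" z] by simp
  then have "integrable lborel (\<lambda>y. ?b * \<bar>vker (z - y)\<bar>)" by simp
  then show ?thesis
  proof (rule Bochner_Integration.integrable_bound)
    show "AE y in lborel. norm (vker (z - y) * mult_kernel m (y - c)) \<le> norm (?b * \<bar>vker (z - y)\<bar>)"
    proof (rule AE_I2)
      fix y
      have "\<bar>vker (z - y)\<bar> * norm (mult_kernel m (y - c)) \<le> \<bar>vker (z - y)\<bar> * ?b"
        by (intro mult_left_mono norm_mult_kernel_le) auto
      also have "\<dots> \<le> norm (?b * \<bar>vker (z - y)\<bar>)" by (simp add: mult.commute)
      finally show "norm (vker (z - y) * mult_kernel m (y - c)) \<le> norm (?b * \<bar>vker (z - y)\<bar>)"
        by (simp add: norm_mult)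
    qed
  qed measurable
qed

text \<open>The transform of \<open>vker\<close> is 1 on the support of \<open>m\<close>, so
  convolution with \<open>vker\<close> fixes the kernel. This replaces decay of the kernel: point
  values become averages against the integrable \<open>vker\<close>, which is what permits
  sampling.\<close>

lemma mult_kernel_reproduce:
  "mult_kernel m (z - c) = (\<integral>y. vker (z - y) * mult_kernel m (y - c) \<partial>lborel)"
proof -
  define f where "f = (\<lambda>y \<xi>. vker (z - y) * (m \<xi> * ex ((y - c) * \<xi>)))"
  have V: "(\<integral>y. vker (z - y) * ex (y * \<xi>) \<partial>lborel) = ex (z * \<xi>)" if "\<bar>\<xi>\<bar> \<le> 1/2" for \<xi>
  proof -
    have "(\<integral>y. vker (z - y) * ex (y * \<xi>) \<partial>lborel) = (\<integral>y. vker y * ex ((z - y) * \<xi>) \<partial>lborel)"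
      using lborel_integral_real_affine[of "-1" "\<lambda>y. vker (z - y) * ex (y * \<xi>)" z] by simp
    also have "\<dots> = (\<integral>y. ex (z * \<xi>) * (vker y * cis (2 * pi * y * (- \<xi>))) \<partial>lborel)"
      by (intro Bochner_Integration.integral_cong refl) (simp add: left_diff_distrib ex_diff, simp add: ex_def algebra_simps)
    also have "\<dots> = ex (z * \<xi>)"
      using fourier_vker[of "- \<xi>"] that by (subst integral_mult_right_zero) simp
    finally show ?thesis .
  qed
  have vint: "integrable lborel (\<lambda>y. vker (z - y))"
    using lborel_integrable_real_affine[OF integrable_vker, of "-1" z] by simp
  have meas: "case_prod f \<in> borel_measurable (lborel \<Otimes>\<^sub>M lebesgue)"
  proof -
    have [measurable]: "(\<lambda>p. ex (- c * snd p)) \<in> borel_measurable (lborel \<Otimes>\<^sub>M lebesgue)"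
      using measurable_compose[OF measurable_snd borel_measurable_ex_mult_lebesgue(1)[of "- c"]] by simp
    have "(\<lambda>p. complex_of_real (vker (z - fst p))) \<in> borel_measurable (lborel \<Otimes>\<^sub>M (lebesgue :: real measure))"
      by (rule measurable_compose[OF measurable_fst]) simp
    then have "(\<lambda>p. vker (z - fst p) * (m (snd p) * (ex (fst p * snd p) * ex (- c * snd p)))) \<in> borel_measurable (lborel \<Otimes>\<^sub>M lebesgue)"
      by measurable
    then show ?thesis by (simp add: f_def case_prod_unfold left_diff_distrib ex_diff)
  qed
  have int: "integrable (lborel \<Otimes>\<^sub>M lebesgue) (case_prod f)"
  proof (rule lborel_lebesgue.Fubini_integrable[OF meas])
    have "(\<lambda>y. \<integral>\<xi>. norm (case_prod f (y, \<xi>)) \<partial>lebesgue) = (\<lambda>y. \<bar>vker (z - y)\<bar> * (\<integral>\<xi>. norm (m \<xi>) \<partial>lebesgue))"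
      by (simp add: f_def norm_mult)
    then show "integrable lborel (\<lambda>y. \<integral>\<xi>. norm (case_prod f (y, \<xi>)) \<partial>lebesgue)"
      using vint by simp
    show "AE y in lborel. integrable lebesgue (\<lambda>\<xi>. case_prod f (y, \<xi>))"
      unfolding f_def prod.case using integrable_m_ex by (intro AE_I2 integrable_mult_right) auto
  qed
  have "(\<integral>y. vker (z - y) * mult_kernel m (y - c) \<partial>lborel) = (\<integral>y. (\<integral>\<xi>. f y \<xi> \<partial>lebesgue) \<partial>lborel)"
    by (simp add: mult_kernel_def f_def)
  also have "\<dots> = (\<integral>\<xi>. (\<integral>y. f y \<xi> \<partial>lborel) \<partial>lebesgue)"
    using lborel_lebesgue.Fubini_integral[OF int] by simp
  also have "\<dots> = (\<integral>\<xi>. m \<xi> * ex ((z - c) * \<xi>) \<partial>lebesgue)"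
  proof (intro Bochner_Integration.integral_cong refl)
    fix \<xi>
    have "(\<integral>y. f y \<xi> \<partial>lborel) = (\<integral>y. (m \<xi> * ex (- (c * \<xi>))) * (vker (z - y) * ex (y * \<xi>)) \<partial>lborel)"
      unfolding f_def left_diff_distrib ex_diff by (intro Bochner_Integration.integral_cong refl) (simp add: mult_ac)
    also have "\<dots> = (m \<xi> * ex (- (c * \<xi>))) * (\<integral>y. vker (z - y) * ex (y * \<xi>) \<partial>lborel)"
      by (rule integral_mult_right_zero)
    also have "\<dots> = m \<xi> * ex ((z - c) * \<xi>)"
    proof (cases "\<bar>\<xi>\<bar> \<le> 1/2")
      case True
      then show ?thesis unfolding V[OF True] left_diff_distrib ex_diff by (simp add: mult_ac)
    next
      case False
      then have "m \<xi> = 0" by (intro m_supp) auto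
      then show ?thesis by simp
    qed
    finally show "(\<integral>y. f y \<xi> \<partial>lborel) = m \<xi> * ex ((z - c) * \<xi>)" .
  qed
  finally show ?thesis by (simp add: mult_kernel_def)
qed

end

lemma integrable_decay_shift: "integrable lborel (\<lambda>y. decay (z - y))" "integrable lborel (\<lambda>y. decay (y - z))"
  and integral_decay_shift: "(LBINT y. decay (z - y)) = pi" "(LBINT y. decay (y - z)) = pi"
proof -
  show 1: "integrable lborel (\<lambda>y. decay (y - z))"
    using lborel_integrable_real_affine[OF integrable_decay, of 1 "- z"] by simp
  show 2: "(LBINT y. decay (y - z)) = pi"
    using lborel_integral_real_affine[of 1 decay "- z"] integral_decay by simp
  have eq: "decay (z - y) = decay (y - z)" for y
    using decay_minus[of "y - z"] by simp
  show "integrable lborel (\<lambda>y. decay (z - y))" "(LBINT y. decay (z - y)) = pi"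
    unfolding eq using 1 2 by auto
qed

lemma borel_measurable_decay [measurable]: "decay \<in> borel_measurable borel"
  by (simp add: decay_def[abs_def])

lemma integrable_vker_shift: "integrable lborel (\<lambda>y. vker (y - z))"
  using lborel_integrable_real_affine[OF integrable_vker, of 1 "- z"] by simp

lemma integrable_power_bounded:
  fixes F :: "real \<Rightarrow> complex"
  assumes F: "integrable lborel F" and b: "\<And>y. norm (F y) \<le> b" and p: "p \<ge> 1"
  shows "integrable lborel (\<lambda>y. norm (F y) ^ p)"
proof -
  obtain k where k: "p = Suc k" using p by (metis Suc_le_D One_nat_def)
  have i: "integrable lborel (\<lambda>y. b ^ k * norm (F y))" using F by simp
  show ?thesis
  proof (rule Bochner_Integration.integrable_bound[OF i])
    have [measurable]: "F \<in> borel_measurable borel" using F by simp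
    show "(\<lambda>y. norm (F y) ^ p) \<in> borel_measurable lborel" by measurable
    show "AE y in lborel. norm (norm (F y) ^ p) \<le> norm (b ^ k * norm (F y))"
    proof (rule AE_I2)
      fix y
      have "norm (F y) ^ k * norm (F y) \<le> b ^ k * norm (F y)"
        using b by (intro mult_right_mono power_mono) auto
      also have "\<dots> \<le> norm (b ^ k * norm (F y))"
        unfolding real_norm_def by (rule abs_ge_self)
      finally show "norm (norm (F y) ^ p) \<le> norm (b ^ k * norm (F y))"
        by (simp add: k power_Suc2 del: power_Suc)
    qed
  qed
qed

lemma integral_lebesgue_eq_lborel:
  fixes f :: "real \<Rightarrow> 'b :: {banach, second_countable_topology}"
  assumes "f \<in> borel_measurable borel"
  shows "(\<integral>x. f x \<partial>lebesgue) = (\<integral>x. f x \<partial>lborel)" "integrable lebesgue f \<longleftrightarrow> integrable lborel f"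
  using assms by (auto simp: integral_completion integrable_completion)

text \<open>Jensen's inequality against the measure \<open>4 * decay (z - y) dy\<close>, whose mass
  is \<open>4 * pi\<close>.\<close>

lemma decay_convolution_power_le:
  fixes G :: "real \<Rightarrow> complex"
  assumes [measurable]: "G \<in> borel_measurable borel"
    and Gp: "integrable lborel (\<lambda>y. norm (G y) ^ p)" and p: "p \<ge> 1"
    and rep: "norm c \<le> (LBINT y. 4 * decay (z - y) * norm (G y))"
  shows "norm c ^ p \<le> (1 + 4 * pi) ^ p * (LBINT y. 4 * decay (z - y) * norm (G y) ^ p)"
    and "integrable lborel (\<lambda>y. 4 * decay (z - y) * norm (G y) ^ p)"
proof -
  show i: "integrable lborel (\<lambda>y. 4 * decay (z - y) * norm (G y) ^ p)"
  proof (rule Bochner_Integration.integrable_bound)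
    show "integrable lborel (\<lambda>y. 4 * norm (G y) ^ p)" using Gp by simp
    show "AE y in lborel. norm (4 * decay (z - y) * norm (G y) ^ p) \<le> norm (4 * norm (G y) ^ p)"
      by (intro AE_I2) (auto simp: abs_mult intro!: mult_left_le_one_le decay_le_1)
  qed measurable
  show "norm c ^ p \<le> (1 + 4 * pi) ^ p * (LBINT y. 4 * decay (z - y) * norm (G y) ^ p)"
  proof (rule power_le_of_young[OF p])
    fix l :: real assume l: "l > 0"
    have i2: "integrable lborel (\<lambda>y. 4 * decay (z - y) * norm (G y) ^ p / l ^ (p - 1) + 4 * decay (z - y) * l)"
      using i integrable_decay_shift(1)[of z] by (intro Bochner_Integration.integrable_add) auto
    have le: "4 * decay (z - y) * norm (G y) \<le> 4 * decay (z - y) * norm (G y) ^ p / l ^ (p - 1) + 4 * decay (z - y) * l" for y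
    proof -
      have "4 * decay (z - y) * norm (G y) \<le> 4 * decay (z - y) * (norm (G y) ^ p / l ^ (p - 1) + l)"
        using l p by (intro mult_left_mono le_power_div_plus) auto
      then show ?thesis by (simp add: distrib_left)
    qed
    note rep
    also have "(LBINT y. 4 * decay (z - y) * norm (G y)) \<le> (LBINT y. 4 * decay (z - y) * norm (G y) ^ p / l ^ (p - 1) + 4 * decay (z - y) * l)"
    proof (rule integral_mono[OF _ i2 le])
      show "integrable lborel (\<lambda>y. 4 * decay (z - y) * norm (G y))"
        by (rule Bochner_Integration.integrable_bound[OF i2])
           (use order_trans[OF le abs_ge_self] in \<open>auto intro!: AE_I2\<close>)
    qed
    also have "\<dots> = (LBINT y. 4 * decay (z - y) * norm (G y) ^ p) / l ^ (p - 1) + 4 * pi * l"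
      using i integrable_decay_shift(1)[of z] integral_decay_shift(1)[of z]
      by (subst Bochner_Integration.integral_add) auto
    finally show "norm c \<le> (LBINT y. 4 * decay (z - y) * norm (G y) ^ p) / l ^ (p - 1) + 4 * pi * l" .
  qed auto
qed

lemma integrable_vker_sum:
  "integrable lborel (\<lambda>y. \<Sum>j\<in>J. a j * complex_of_real (\<epsilon> * vker (y - \<epsilon> * of_int j)))"
  using integrable_vker_shift
  by (intro Bochner_Integration.integrable_sum integrable_mult_right) auto

lemma integrable_vker_sum_power:
  assumes \<epsilon>: "\<epsilon> > 0" and p: "p \<ge> 1"
  shows "integrable lborel (\<lambda>y. norm (\<Sum>j\<in>J. a j * complex_of_real (\<epsilon> * vker (y - \<epsilon> * of_int j))) ^ p)"
proof (rule integrable_power_bounded[OF integrable_vker_sum _ p])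
  fix y
  show "norm (\<Sum>j\<in>J. a j * complex_of_real (\<epsilon> * vker (y - \<epsilon> * of_int j))) \<le> (\<Sum>j\<in>J. norm (a j) * (\<epsilon> * 4))"
  proof (rule sum_norm_le)
    fix j
    have "\<bar>vker (y - \<epsilon> * of_int j)\<bar> \<le> 4"
      using abs_vker_le[of "y - \<epsilon> * of_int j"] decay_le_1[of "y - \<epsilon> * of_int j"] by linarith
    then show "norm (a j * complex_of_real (\<epsilon> * vker (y - \<epsilon> * of_int j))) \<le> norm (a j) * (\<epsilon> * 4)"
      using \<epsilon> by (auto simp: norm_mult abs_mult intro!: mult_left_mono)
  qed
qed

text \<open>A sampling argument. The combination \<open>F\<close> of shifts of \<open>vker\<close>
  to the points \<open>\<epsilon> * j\<close> has, on the support of \<open>m\<close>, the transform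
  of a combination of point masses there. The operator therefore maps \<open>F\<close> to the
  function \<open>G\<close> whose samples at \<open>\<epsilon> * n\<close> stand on the left. The
  multiplier norm compares the integrals of \<open>G\<close> and \<open>F\<close>, and the
  reproducing property bounds the samples of \<open>G\<close> by its integral at the price
  \<open>1 / \<epsilon>\<close>, the density of the sample points.\<close>

lemma transference:
  assumes r: "r \<ge> 1" and mult: "Lp_multiplier (2 * real r) m B"
    and supp: "\<And>x. x \<notin> {-1/2<..1/2} \<Longrightarrow> m x = 0"
  shows "\<exists>C\<ge>0. \<forall>\<epsilon> (J :: int set) a A. 0 < \<epsilon> \<longrightarrow> \<epsilon> \<le> 1 \<longrightarrow> finite J \<longrightarrow> finite A \<longrightarrow>
     (\<Sum>n\<in>A. norm (\<Sum>j\<in>J. a j * (of_real \<epsilon> * mult_kernel m (\<epsilon> * of_int (n - j)))) ^ (2 * r))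
       \<le> C / \<epsilon> * (LBINT y. norm (\<Sum>j\<in>J. a j * of_real (\<epsilon> * vker (y - \<epsilon> * of_int j))) ^ (2 * r))"
proof -
  from mult obtain S where S: "bounded_Lp_extension (2 * real r) lebesgue
            {f \<in> Lp 1 lebesgue. integrable lebesgue (\<lambda>\<xi>. m \<xi> * fourier_R f \<xi>)}
            (\<lambda>f. inv_fourier_R (\<lambda>\<xi>. m \<xi> * fourier_R f \<xi>)) S B"
    and m: "m \<in> borel_measurable lebesgue" "bounded (range m)"
    unfolding Lp_multiplier_def by blast
  have m_int: "integrable lebesgue m" by (rule integrable_bounded_support[OF m supp])
  note kmeas [measurable] = mult_kernel_meas[OF m_int supp]
  define p where "p = 2 * r"
  have p: "p \<ge> 1" using r by (simp add: p_def)
  \<comment> \<open>The first factor is Jensen with mass \<open>4 * pi\<close>, the second the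
    lattice sum of \<open>4 * decay\<close>, the third the operator bound. \<open>B\<close> is not
    assumed nonnegative, hence its absolute value.\<close>
  define C where "C = (1 + 4 * pi) ^ p * (4 * (3 * pi)) * \<bar>B\<bar> ^ p"
  show ?thesis
  proof (intro exI[of _ C] conjI allI impI)
    fix \<epsilon> :: real and J A :: "int set" and a
    assume \<epsilon>: "0 < \<epsilon>" "\<epsilon> \<le> 1" and J: "finite J" and A: "finite A"
    define F where "F y = (\<Sum>j\<in>J. a j * complex_of_real (\<epsilon> * vker (y - \<epsilon> * of_int j)))" for y
    define G where "G y = (\<Sum>j\<in>J. a j * (of_real \<epsilon> * mult_kernel m (y - \<epsilon> * of_int j)))" for y
    have [measurable]: "F \<in> borel_measurable borel" "G \<in> borel_measurable borel"
      unfolding F_def[abs_def] G_def[abs_def] by measurable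
    have Fint: "integrable lborel F" and Fp: "integrable lborel (\<lambda>y. norm (F y) ^ p)"
      unfolding F_def using integrable_vker_sum integrable_vker_sum_power[OF \<epsilon>(1) p] by auto
    have F_Lp: "F \<in> Lp (2 * real r) lebesgue"
      unfolding Lp_iff_power[OF r] p_def[symmetric]
      using Fp by (auto simp: integral_lebesgue_eq_lborel intro: measurable_completion)
    have F_L1: "F \<in> Lp 1 lebesgue"
      unfolding Lp_def using Fint by (auto simp: integral_lebesgue_eq_lborel intro: measurable_completion)
    \<comment> \<open>Only frequencies where \<open>m\<close> can be nonzero matter, and there the
      transform of \<open>vker\<close> is 1.\<close>
    have mF: "m \<xi> * fourier_R F \<xi> = (\<Sum>j\<in>J. a j * of_real \<epsilon> * (m \<xi> * ex (- (\<epsilon> * of_int j * \<xi>))))" for \<xi>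
    proof (cases "\<bar>\<xi>\<bar> \<le> 1/2")
      case False
      then have "m \<xi> = 0" by (intro supp) auto
      then show ?thesis by simp
    next
      case True
      have vi: "integrable lborel (\<lambda>x. complex_of_real (vker (x - c)) * ex (- (x * \<xi>)))" for c
        by (rule Bochner_Integration.integrable_bound[OF integrable_vker_shift[of c]])
           (auto simp: norm_mult)
      have v: "(\<integral>x. complex_of_real (vker (x - c)) * ex (- (x * \<xi>)) \<partial>lborel) = ex (- (c * \<xi>))" for c
      proof -
        have "(\<integral>x. complex_of_real (vker (x - c)) * ex (- (x * \<xi>)) \<partial>lborel)
          = (\<integral>x. complex_of_real (vker x) * ex (- ((c + x) * \<xi>)) \<partial>lborel)"
          using lborel_integral_real_affine[of 1 "\<lambda>x. complex_of_real (vker (x - c)) * ex (- (x * \<xi>))" c] by simp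
        also have "\<dots> = (\<integral>x. ex (- (c * \<xi>)) * (complex_of_real (vker x) * cis (2 * pi * x * (- \<xi>))) \<partial>lborel)"
          by (intro Bochner_Integration.integral_cong refl)
             (simp add: distrib_right ex_diff, simp add: ex_def algebra_simps)
        also have "\<dots> = ex (- (c * \<xi>))"
          using fourier_vker[of "- \<xi>"] True by (subst integral_mult_right_zero) simp
        finally show ?thesis .
      qed
      have "fourier_R F \<xi> = (\<integral>x. F x * ex (- (x * \<xi>)) \<partial>lebesgue)"
        by (simp add: fourier_R_def ex_def mult.assoc)
      also have "\<dots> = (\<integral>x. F x * ex (- (x * \<xi>)) \<partial>lborel)"
        by (rule integral_lebesgue_eq_lborel) simp
      also have "\<dots> = (\<integral>x. (\<Sum>j\<in>J. a j * of_real \<epsilon> * (complex_of_real (vker (x - \<epsilon> * of_int j)) * ex (- (x * \<xi>)))) \<partial>lborel)"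
        unfolding F_def sum_distrib_right
        by (intro Bochner_Integration.integral_cong sum.cong refl) simp
      also have "\<dots> = (\<Sum>j\<in>J. a j * of_real \<epsilon> * ex (- (\<epsilon> * of_int j * \<xi>)))"
        using vi v by (subst Bochner_Integration.integral_sum) auto
      finally show ?thesis by (simp add: sum_distrib_left mult_ac)
    qed
    have mFint: "integrable lebesgue (\<lambda>\<xi>. m \<xi> * fourier_R F \<xi>)"
      unfolding mF using integrable_m_ex[OF m_int supp, of "- (\<epsilon> * of_int _)"]
      by (intro Bochner_Integration.integrable_sum integrable_mult_right) auto
    have inv: "inv_fourier_R (\<lambda>\<xi>. m \<xi> * fourier_R F \<xi>) y = G y" for y
    proof -
      have "inv_fourier_R (\<lambda>\<xi>. m \<xi> * fourier_R F \<xi>) y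
        = (\<integral>\<xi>. (\<Sum>j\<in>J. a j * of_real \<epsilon> * (m \<xi> * ex ((y - \<epsilon> * of_int j) * \<xi>))) \<partial>lebesgue)"
      proof -
        have cis_ex: "cis (2 * pi * y * \<xi>) = ex (y * \<xi>)" for \<xi>
          by (simp add: ex_def mult.assoc)
        show ?thesis
          unfolding inv_fourier_R_def mF cis_ex sum_distrib_right left_diff_distrib ex_diff
          by (intro Bochner_Integration.integral_cong sum.cong refl) (simp only: mult_ac)
      qed
      also have "\<dots> = G y"
        unfolding G_def mult_kernel_def
        using integrable_m_ex[OF m_int supp, of "y - \<epsilon> * of_int _"]
        by (subst Bochner_Integration.integral_sum) (auto simp: mult.assoc)
      finally show ?thesis .
    qed
    have SF: "S F \<in> Lp (2 * real r) lebesgue" "Lp_norm (2 * real r) lebesgue (S F) \<le> B * Lp_norm (2 * real r) lebesgue F"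
      "AE y in lebesgue. S F y = inv_fourier_R (\<lambda>\<xi>. m \<xi> * fourier_R F \<xi>) y"
      using S F_Lp F_L1 mFint unfolding bounded_Lp_extension_def by blast+
    have SFm: "S F \<in> borel_measurable lebesgue" "integrable lebesgue (\<lambda>y. norm (S F y) ^ p)"
      using SF(1) unfolding Lp_iff_power[OF r] p_def by auto
    have Gm: "(\<lambda>y. norm (G y) ^ p) \<in> borel_measurable lebesgue"
      by (rule measurable_completion) measurable
    \<comment> \<open>\<open>S F\<close> is determined only almost everywhere, so its point values
      mean nothing. Only its integral is carried over to \<open>G\<close>, the representative that
      is sampled.\<close>
    have AEp: "AE y in lebesgue. norm (S F y) ^ p = norm (G y) ^ p"
      using SF(3) unfolding inv by eventually_elim simp
    have Gp: "integrable lborel (\<lambda>y. norm (G y) ^ p)"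
      using SFm integrable_cong_AE[OF _ Gm AEp] by (simp add: integral_lebesgue_eq_lborel)
    have GF: "(LBINT y. norm (G y) ^ p) \<le> \<bar>B\<bar> ^ p * (LBINT y. norm (F y) ^ p)"
    proof -
      have "Lp_norm (2 * real r) lebesgue (S F) \<le> \<bar>B\<bar> * Lp_norm (2 * real r) lebesgue F"
        using SF(2) Lp_norm_nonneg by (smt (verit) mult_right_mono)
      then have "Lp_norm (2 * real r) lebesgue (S F) ^ p \<le> (\<bar>B\<bar> * Lp_norm (2 * real r) lebesgue F) ^ p"
        by (intro power_mono Lp_norm_nonneg)
      then have "(\<integral>y. norm (S F y) ^ p \<partial>lebesgue) \<le> \<bar>B\<bar> ^ p * (\<integral>y. norm (F y) ^ p \<partial>lebesgue)"
        unfolding power_mult_distrib p_def Lp_norm_power[OF r] .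
      moreover have "(\<integral>y. norm (S F y) ^ p \<partial>lebesgue) = (\<integral>y. norm (G y) ^ p \<partial>lebesgue)"
        using SFm by (intro integral_cong_AE Gm AEp) auto
      ultimately show ?thesis by (simp add: integral_lebesgue_eq_lborel)
    qed
    \<comment> \<open>\<open>G\<close> inherits the reproducing formula from
      \<open>mult_kernel\<close>, and \<open>vker\<close> is dominated by
      \<open>4 * decay\<close>.\<close>
    have rep: "norm (G z) \<le> (LBINT y. 4 * decay (z - y) * norm (G y))" for z
    proof -
      have i: "integrable lborel (\<lambda>y. vker (z - y) * G y)"
      proof -
        have "integrable lborel (\<lambda>y. \<Sum>j\<in>J. a j * of_real \<epsilon> * (vker (z - y) * mult_kernel m (y - \<epsilon> * of_int j)))"
          using integrable_vker_mult_kernel[OF m_int supp]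
          by (intro Bochner_Integration.integrable_sum integrable_mult_right) auto
        then show ?thesis by (simp add: G_def sum_distrib_left mult_ac)
      qed
      have "G z = (\<Sum>j\<in>J. a j * of_real \<epsilon> * (\<integral>y. vker (z - y) * mult_kernel m (y - \<epsilon> * of_int j) \<partial>lborel))"
        unfolding G_def
      proof (intro sum.cong refl)
        fix j
        show "a j * (of_real \<epsilon> * mult_kernel m (z - \<epsilon> * of_int j))
          = a j * of_real \<epsilon> * (\<integral>y. vker (z - y) * mult_kernel m (y - \<epsilon> * of_int j) \<partial>lborel)"
          using mult_kernel_reproduce[OF m_int supp, of z "\<epsilon> * of_int j"] by (metis mult.assoc)
      qed
      also have "\<dots> = (\<integral>y. (\<Sum>j\<in>J. a j * of_real \<epsilon> * (vker (z - y) * mult_kernel m (y - \<epsilon> * of_int j))) \<partial>lborel)"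
        using integrable_vker_mult_kernel[OF m_int supp] by (subst Bochner_Integration.integral_sum) auto
      also have "\<dots> = (\<integral>y. vker (z - y) * G y \<partial>lborel)"
        by (simp add: G_def sum_distrib_left mult_ac)
      finally have "norm (G z) \<le> (LBINT y. norm (vker (z - y) * G y))"
        using integral_norm_bound by simp
      also have "\<dots> \<le> (LBINT y. 4 * decay (z - y) * norm (G y))"
      proof (rule integral_mono)
        show "integrable lborel (\<lambda>y. norm (vker (z - y) * G y))" using i by simp
        show "norm (vker (z - y) * G y) \<le> 4 * decay (z - y) * norm (G y)" for y
          using abs_vker_le by (auto simp: norm_mult intro!: mult_right_mono)
        have Gb: "norm (G y) \<le> (\<Sum>j\<in>J. norm (a j * of_real \<epsilon>) * (\<integral>\<xi>. norm (m \<xi>) \<partial>lebesgue))" for y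
          unfolding G_def
        proof (rule sum_norm_le)
          fix j
          show "norm (a j * (of_real \<epsilon> * mult_kernel m (y - \<epsilon> * of_int j))) \<le> norm (a j * of_real \<epsilon>) * (\<integral>\<xi>. norm (m \<xi>) \<partial>lebesgue)"
            unfolding mult.assoc[symmetric] norm_mult[of "a j * of_real \<epsilon>"]
            by (intro mult_left_mono norm_mult_kernel_le[OF m_int supp]) auto
        qed
        define b where "b = (\<Sum>j\<in>J. norm (a j * of_real \<epsilon>) * (\<integral>\<xi>. norm (m \<xi>) \<partial>lebesgue))"
        have "integrable lborel (\<lambda>y. 4 * decay (z - y) * b)" using integrable_decay_shift(1)[of z] by simp
        then show "integrable lborel (\<lambda>y. 4 * decay (z - y) * norm (G y))"
        proof (rule Bochner_Integration.integrable_bound)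
          show "AE y in lborel. norm (4 * decay (z - y) * norm (G y)) \<le> norm (4 * decay (z - y) * b)"
            using Gb by (intro AE_I2) (auto simp: abs_mult b_def[symmetric] intro!: mult_left_mono order_trans[OF _ abs_ge_self])
        qed measurable
      qed
      finally show ?thesis .
    qed
    note dc = decay_convolution_power_le[OF _ Gp p rep]
    have "(\<Sum>n\<in>A. norm (\<Sum>j\<in>J. a j * (of_real \<epsilon> * mult_kernel m (\<epsilon> * of_int (n - j)))) ^ (2 * r))
        = (\<Sum>n\<in>A. norm (G (\<epsilon> * of_int n)) ^ p)"
      by (simp add: G_def p_def right_diff_distrib)
    also have "\<dots> \<le> (\<Sum>n\<in>A. (1 + 4 * pi) ^ p * (LBINT y. 4 * decay (\<epsilon> * of_int n - y) * norm (G y) ^ p))"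
      by (intro sum_mono dc(1)) simp
    also have "\<dots> = (1 + 4 * pi) ^ p * (LBINT y. (\<Sum>n\<in>A. 4 * decay (\<epsilon> * of_int n - y) * norm (G y) ^ p))"
      using dc(2) by (subst Bochner_Integration.integral_sum) (auto simp: sum_distrib_left)
    also have "\<dots> \<le> (1 + 4 * pi) ^ p * (LBINT y. 4 * (3 * pi / \<epsilon>) * norm (G y) ^ p)"
    proof (intro mult_left_mono integral_mono)
      show "integrable lborel (\<lambda>y. \<Sum>n\<in>A. 4 * decay (\<epsilon> * of_int n - y) * norm (G y) ^ p)"
        using dc(2) by (intro Bochner_Integration.integrable_sum) auto
      show "integrable lborel (\<lambda>y. 4 * (3 * pi / \<epsilon>) * norm (G y) ^ p)" using Gp by simp
      fix y
      have "(\<Sum>n\<in>A. decay (\<epsilon> * of_int n - y)) = (\<Sum>n\<in>A. decay (y - \<epsilon> * of_int n))"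
        by (intro sum.cong refl) (metis decay_minus minus_diff_eq)
      also have "\<dots> \<le> 3 * pi / \<epsilon>" by (rule sum_decay_le[OF \<epsilon> A])
      finally have "4 * (\<Sum>n\<in>A. decay (\<epsilon> * of_int n - y)) * norm (G y) ^ p \<le> 4 * (3 * pi / \<epsilon>) * norm (G y) ^ p"
        by (intro mult_right_mono mult_left_mono) auto
      then show "(\<Sum>n\<in>A. 4 * decay (\<epsilon> * of_int n - y) * norm (G y) ^ p) \<le> 4 * (3 * pi / \<epsilon>) * norm (G y) ^ p"
        by (simp add: sum_distrib_left sum_distrib_right)
    qed auto
    also have "\<dots> = (1 + 4 * pi) ^ p * (4 * (3 * pi)) / \<epsilon> * (LBINT y. norm (G y) ^ p)" by simp
    also have "\<dots> \<le> (1 + 4 * pi) ^ p * (4 * (3 * pi)) / \<epsilon> * (\<bar>B\<bar> ^ p * (LBINT y. norm (F y) ^ p))"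
      using \<epsilon> by (intro mult_left_mono GF) auto
    also have "\<dots> = C / \<epsilon> * (LBINT y. norm (F y) ^ p)" by (simp add: C_def)
    finally show "(\<Sum>n\<in>A. norm (\<Sum>j\<in>J. a j * (of_real \<epsilon> * mult_kernel m (\<epsilon> * of_int (n - j)))) ^ (2 * r))
       \<le> C / \<epsilon> * (LBINT y. norm (\<Sum>j\<in>J. a j * of_real (\<epsilon> * vker (y - \<epsilon> * of_int j))) ^ (2 * r))"
      by (simp only: F_def p_def)
  qed (simp add: C_def)
qed

section \<open>A weighted large sieve inequality\<close>

text \<open>Summation by parts: multiplication by \<open>1 - z\<close> leaves two boundary terms and
  the differences of the coefficients.\<close>

lemma abel_summation_norm_le:
  fixes z :: complex
  assumes "norm z = 1"
  shows "norm (1 - z) * norm (\<Sum>i<Suc n. of_real (c i) * z ^ i)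
    \<le> \<bar>c 0\<bar> + \<bar>c n\<bar> + (\<Sum>i<n. \<bar>c (Suc i) - c i\<bar>)"
proof -
  have eq: "(1 - z) * (\<Sum>i<Suc n. of_real (c i) * z ^ i)
    = of_real (c 0) - of_real (c n) * z ^ Suc n + (\<Sum>i<n. of_real (c (Suc i) - c i) * z ^ Suc i)"
  proof (induction n)
    case (Suc n)
    have "(1 - z) * (\<Sum>i<Suc (Suc n). of_real (c i) * z ^ i)
      = (1 - z) * (\<Sum>i<Suc n. of_real (c i) * z ^ i) + (1 - z) * (of_real (c (Suc n)) * z ^ Suc n)"
      by (simp only: sum.lessThan_Suc distrib_left)
    moreover define T where "T = (\<Sum>i<n. of_real (c (Suc i) - c i) * z ^ Suc i)"
    moreover have "(\<Sum>i<Suc n. of_real (c (Suc i) - c i) * z ^ Suc i) = T + of_real (c (Suc n) - c n) * z ^ Suc n"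
      unfolding T_def by (rule sum.lessThan_Suc)
    ultimately show ?case using Suc.IH by (simp only:) (simp add: algebra_simps)
  qed (simp add: algebra_simps)
  have "norm (1 - z) * norm (\<Sum>i<Suc n. of_real (c i) * z ^ i)
    = norm (of_real (c 0) - of_real (c n) * z ^ Suc n + (\<Sum>i<n. of_real (c (Suc i) - c i) * z ^ Suc i))"
    unfolding norm_mult[symmetric] eq ..
  also have "\<dots> \<le> (norm (complex_of_real (c 0)) + norm (of_real (c n) * z ^ Suc n)) + (\<Sum>i<n. norm (of_real (c (Suc i) - c i) * z ^ Suc i))"
    by (intro order_trans[OF norm_triangle_ineq] add_mono norm_triangle_ineq4 norm_sum)
  also have "\<dots> = \<bar>c 0\<bar> + \<bar>c n\<bar> + (\<Sum>i<n. \<bar>c (Suc i) - c i\<bar>)"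
    unfolding norm_mult norm_power assms norm_of_real by simp
  finally show ?thesis .
qed

text \<open>The factor \<open>\<epsilon>\<close> normalises the samples of \<open>decay\<close>, so
  that their sum is at most \<open>3 * pi\<close> whatever the spacing.\<close>

definition weight :: "real \<Rightarrow> real \<Rightarrow> int \<Rightarrow> real" where
  "weight \<epsilon> y j = \<epsilon> * decay (y - \<epsilon> * of_int j)"

lemma weight_nonneg: "\<epsilon> > 0 \<Longrightarrow> weight \<epsilon> y j \<ge> 0"
  by (simp add: weight_def)

lemma sum_weight_le:
  assumes "0 < \<epsilon>" "\<epsilon> \<le> 1" "finite J"
  shows "(\<Sum>j\<in>J. weight \<epsilon> y j) \<le> 3 * pi"
  using mult_left_mono[OF sum_decay_le[OF assms, of y], of \<epsilon>] assms
  by (simp add: weight_def sum_distrib_left[symmetric])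

text \<open>The weights vary slowly, so summation by parts gains \<open>\<epsilon> / d\<close>. The
  two boundary terms are at most \<open>\<epsilon>\<close> each, and by \<open>decay_diff\<close>
  the variation is at most \<open>\<epsilon>\<close> times two sums of weights, each at most
  \<open>3 * pi\<close>.\<close>

lemma norm_sum_weight_ex_le:
  assumes \<epsilon>: "0 < \<epsilon>" "\<epsilon> \<le> 1" and d: "d > 0" and sep: "\<And>l::int. d \<le> \<bar>\<alpha> - of_int l\<bar>"
  shows "norm (\<Sum>j\<in>{- int M..int M}. of_real (weight \<epsilon> y j) * ex (\<alpha> * of_int j)) \<le> (2 + 6 * pi) * \<epsilon> / d"
proof -
  define c where "c i = weight \<epsilon> y (int i - int M)" for i :: nat
  have im: "{- int M..int M} = (\<lambda>i. int i - int M) ` {..<Suc (2 * M)}"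
  proof (intro equalityI subsetI)
    fix j assume "j \<in> {- int M..int M}"
    then have "j = int (nat (j + int M)) - int M" "nat (j + int M) < Suc (2 * M)" by auto
    then show "j \<in> (\<lambda>i. int i - int M) ` {..<Suc (2 * M)}" by blast
  qed auto
  have "(\<Sum>j\<in>{- int M..int M}. of_real (weight \<epsilon> y j) * ex (\<alpha> * of_int j))
     = (\<Sum>i<Suc (2 * M). of_real (c i) * ex (\<alpha> * of_int (int i - int M)))"
    unfolding im by (subst sum.reindex) (auto simp: inj_on_def c_def)
  also have "\<dots> = ex (- (\<alpha> * of_nat M)) * (\<Sum>i<Suc (2 * M). of_real (c i) * ex \<alpha> ^ i)"
    unfolding sum_distrib_left ex_of_nat_mult[symmetric]
    by (intro sum.cong refl) (simp add: right_diff_distrib ex_diff mult_ac)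
  finally have eq: "norm (\<Sum>j\<in>{- int M..int M}. of_real (weight \<epsilon> y j) * ex (\<alpha> * of_int j))
     = norm (\<Sum>i<Suc (2 * M). of_real (c i) * ex \<alpha> ^ i)" by (simp add: norm_mult)
  have c1: "\<bar>c i\<bar> \<le> \<epsilon>" for i
    using \<epsilon> decay_le_1 by (simp add: c_def weight_def abs_mult mult_left_le)
  have sumc: "(\<Sum>i<2 * M. c (i + k)) \<le> 3 * pi" for k
  proof -
    have "(\<Sum>i<2 * M. c (i + k)) = (\<Sum>j\<in>(\<lambda>i. int (i + k) - int M) ` {..<2 * M}. weight \<epsilon> y j)"
      by (subst sum.reindex) (auto simp: inj_on_def c_def)
    also have "\<dots> \<le> 3 * pi" by (rule sum_weight_le[OF \<epsilon>]) simp
    finally show ?thesis .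
  qed
  have "\<bar>c (Suc i) - c i\<bar> \<le> \<epsilon> * (c (i + 1) + c (i + 0))" for i
  proof -
    let ?s = "y - \<epsilon> * of_int (int (Suc i) - int M)" and ?t = "y - \<epsilon> * of_int (int i - int M)"
    have "\<bar>?s - ?t\<bar> = \<epsilon>" using \<epsilon> by (simp add: algebra_simps)
    then have "\<bar>decay ?s - decay ?t\<bar> \<le> \<epsilon> * (decay ?s + decay ?t)" using decay_diff[of ?s ?t] by simp
    then have "\<epsilon> * \<bar>decay ?s - decay ?t\<bar> \<le> \<epsilon> * (\<epsilon> * (decay ?s + decay ?t))" using \<epsilon> by simp
    moreover have "\<bar>c (Suc i) - c i\<bar> = \<epsilon> * \<bar>decay ?s - decay ?t\<bar>"
      using \<epsilon> by (simp add: c_def weight_def right_diff_distrib[symmetric] abs_mult)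
    ultimately show ?thesis by (simp add: c_def weight_def distrib_left)
  qed
  then have "(\<Sum>i<2 * M. \<bar>c (Suc i) - c i\<bar>) \<le> (\<Sum>i<2 * M. \<epsilon> * (c (i + 1) + c (i + 0)))"
    by (intro sum_mono)
  also have "\<dots> = \<epsilon> * ((\<Sum>i<2 * M. c (i + 1)) + (\<Sum>i<2 * M. c (i + 0)))"
    by (simp only: sum_distrib_left[symmetric] sum.distrib)
  also have "\<dots> \<le> \<epsilon> * (3 * pi + 3 * pi)" using \<epsilon> by (intro mult_left_mono add_mono sumc) auto
  finally have var: "(\<Sum>i<2 * M. \<bar>c (Suc i) - c i\<bar>) \<le> 6 * pi * \<epsilon>" by (simp add: mult.commute)
  have "d * norm (\<Sum>i<Suc (2 * M). of_real (c i) * ex \<alpha> ^ i) \<le> norm (1 - ex \<alpha>) * norm (\<Sum>i<Suc (2 * M). of_real (c i) * ex \<alpha> ^ i)"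
    using norm_one_minus_ex_ge[OF sep] by (intro mult_right_mono) auto
  also have "\<dots> \<le> \<bar>c 0\<bar> + \<bar>c (2 * M)\<bar> + (\<Sum>i<2 * M. \<bar>c (Suc i) - c i\<bar>)"
    by (rule abel_summation_norm_le) simp
  also have "\<dots> \<le> \<epsilon> + \<epsilon> + 6 * pi * \<epsilon>" by (intro add_mono c1 var)
  finally show ?thesis unfolding eq using d by (simp add: field_simps)
qed

text \<open>Expanding the square, the diagonal contributes the total weight \<open>3 * pi\<close>,
  and separation makes each off-diagonal entry at most \<open>(2 + 6 * pi) * \<epsilon> / d\<close>.
  Cauchy-Schwarz on the off-diagonal part loses the number of frequencies, which the hypothesis on
  \<open>K\<close> pays for.\<close>

lemma dual_large_sieve:
  assumes \<epsilon>: "0 < \<epsilon>" "\<epsilon> \<le> 1" and J: "finite J" and \<Theta>: "finite \<Theta>" and d: "d > 0"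
    and sep: "\<And>\<theta> \<theta>' (l::int). \<theta> \<in> \<Theta> \<Longrightarrow> \<theta>' \<in> \<Theta> \<Longrightarrow> \<theta> \<noteq> \<theta>' \<Longrightarrow> d \<le> \<bar>\<theta> - \<theta>' - of_int l\<bar>"
    and K: "\<epsilon> * real (card \<Theta>) \<le> K * d"
  shows "(\<Sum>j\<in>J. weight \<epsilon> y j * (norm (\<Sum>\<theta>\<in>\<Theta>. c \<theta> * ex (\<theta> * of_int j)))\<^sup>2)
    \<le> (3 * pi + (2 + 6 * pi) * K) * (\<Sum>\<theta>\<in>\<Theta>. (norm (c \<theta>))\<^sup>2)"
proof -
  obtain M where M: "J \<subseteq> {- int M..int M}" using subset_int_interval[OF J] .
  let ?I = "{- int M..int M}" and ?\<beta> = "(2 + 6 * pi) * \<epsilon> / d"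
  have \<beta>: "?\<beta> \<ge> 0" using \<epsilon> d by simp
  define B where "B \<alpha> = (\<Sum>j\<in>?I. of_real (weight \<epsilon> y j) * ex (\<alpha> * of_int j))" for \<alpha>
  have B0: "norm (B 0) \<le> 3 * pi"
  proof -
    have "B 0 = of_real (\<Sum>j\<in>?I. weight \<epsilon> y j)" by (simp add: B_def)
    then have "norm (B 0) = \<bar>\<Sum>j\<in>?I. weight \<epsilon> y j\<bar>" by (simp only: norm_of_real)
    also have "\<dots> = (\<Sum>j\<in>?I. weight \<epsilon> y j)" using \<epsilon> by (intro abs_of_nonneg sum_nonneg weight_nonneg)
    also have "\<dots> \<le> 3 * pi" by (rule sum_weight_le[OF \<epsilon>]) simp
    finally show ?thesis .
  qed
  \<comment> \<open>The off-diagonal bound is added on the diagonal too, so that its contribution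
    sums to the full square of the coefficient sum.\<close>
  have Bd: "norm (B (\<theta> - \<theta>')) \<le> (if \<theta> = \<theta>' then 3 * pi else 0) + ?\<beta>" if "\<theta> \<in> \<Theta>" "\<theta>' \<in> \<Theta>" for \<theta> \<theta>'
  proof (cases "\<theta> = \<theta>'")
    case False
    then show ?thesis
      unfolding B_def using norm_sum_weight_ex_le[OF \<epsilon> d, of "\<theta> - \<theta>'"] sep[OF that False] by simp
  qed (use B0 \<beta> in simp)
  have "(\<Sum>j\<in>J. weight \<epsilon> y j * (norm (\<Sum>\<theta>\<in>\<Theta>. c \<theta> * ex (\<theta> * of_int j)))\<^sup>2)
    \<le> (\<Sum>j\<in>?I. weight \<epsilon> y j * (norm (\<Sum>\<theta>\<in>\<Theta>. c \<theta> * ex (\<theta> * of_int j)))\<^sup>2)"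
    using M \<epsilon> by (intro sum_mono2) (auto simp: weight_nonneg)
  also have "\<dots> = norm (complex_of_real \<dots>)"
    using \<epsilon> unfolding norm_of_real by (intro abs_of_nonneg[symmetric] sum_nonneg mult_nonneg_nonneg weight_nonneg) auto
  also have "complex_of_real (\<Sum>j\<in>?I. weight \<epsilon> y j * (norm (\<Sum>\<theta>\<in>\<Theta>. c \<theta> * ex (\<theta> * of_int j)))\<^sup>2)
    = (\<Sum>\<theta>\<in>\<Theta>. \<Sum>\<theta>'\<in>\<Theta>. c \<theta> * cnj (c \<theta>') * B (\<theta> - \<theta>'))"
  proof -
    have "complex_of_real (\<Sum>j\<in>?I. weight \<epsilon> y j * (norm (\<Sum>\<theta>\<in>\<Theta>. c \<theta> * ex (\<theta> * of_int j)))\<^sup>2)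
      = (\<Sum>j\<in>?I. of_real (weight \<epsilon> y j) * ((\<Sum>\<theta>\<in>\<Theta>. c \<theta> * ex (\<theta> * of_int j)) * (\<Sum>\<theta>\<in>\<Theta>. cnj (c \<theta>) * ex (- (\<theta> * of_int j)))))"
      by (simp only: of_real_sum of_real_mult complex_norm_square cnj_sum complex_cnj_mult cnj_ex)
    also have "\<dots> = (\<Sum>j\<in>?I. \<Sum>\<theta>\<in>\<Theta>. \<Sum>\<theta>'\<in>\<Theta>. c \<theta> * cnj (c \<theta>') * (of_real (weight \<epsilon> y j) * ex ((\<theta> - \<theta>') * of_int j)))"
      unfolding sum_product unfolding sum_distrib_left left_diff_distrib ex_diff
      by (intro sum.cong refl) (simp only: mult_ac)
    also have "\<dots> = (\<Sum>\<theta>\<in>\<Theta>. \<Sum>j\<in>?I. \<Sum>\<theta>'\<in>\<Theta>. c \<theta> * cnj (c \<theta>') * (of_real (weight \<epsilon> y j) * ex ((\<theta> - \<theta>') * of_int j)))"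
      by (rule sum.swap)
    also have "\<dots> = (\<Sum>\<theta>\<in>\<Theta>. \<Sum>\<theta>'\<in>\<Theta>. \<Sum>j\<in>?I. c \<theta> * cnj (c \<theta>') * (of_real (weight \<epsilon> y j) * ex ((\<theta> - \<theta>') * of_int j)))"
      by (intro sum.cong refl sum.swap)
    finally show ?thesis by (simp only: B_def sum_distrib_left)
  qed
  also have "norm (\<Sum>\<theta>\<in>\<Theta>. \<Sum>\<theta>'\<in>\<Theta>. c \<theta> * cnj (c \<theta>') * B (\<theta> - \<theta>'))
    \<le> (\<Sum>\<theta>\<in>\<Theta>. \<Sum>\<theta>'\<in>\<Theta>. norm (c \<theta>) * norm (c \<theta>') * ((if \<theta> = \<theta>' then 3 * pi else 0) + ?\<beta>))"
  proof (intro sum_norm_le)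
    fix \<theta> \<theta>' assume "\<theta> \<in> \<Theta>" "\<theta>' \<in> \<Theta>"
    then show "norm (c \<theta> * cnj (c \<theta>') * B (\<theta> - \<theta>')) \<le> norm (c \<theta>) * norm (c \<theta>') * ((if \<theta> = \<theta>' then 3 * pi else 0) + ?\<beta>)"
      unfolding norm_mult complex_mod_cnj by (intro mult_left_mono Bd) auto
  qed
  also have "\<dots> = 3 * pi * (\<Sum>\<theta>\<in>\<Theta>. (norm (c \<theta>))\<^sup>2) + ?\<beta> * (\<Sum>\<theta>\<in>\<Theta>. norm (c \<theta>))\<^sup>2"
  proof -
    have "(\<Sum>\<theta>\<in>\<Theta>. \<Sum>\<theta>'\<in>\<Theta>. norm (c \<theta>) * norm (c \<theta>') * ((if \<theta> = \<theta>' then 3 * pi else 0) + ?\<beta>))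
      = (\<Sum>\<theta>\<in>\<Theta>. (\<Sum>\<theta>'\<in>\<Theta>. if \<theta> = \<theta>' then 3 * pi * (norm (c \<theta>) * norm (c \<theta>')) else 0) + (\<Sum>\<theta>'\<in>\<Theta>. ?\<beta> * (norm (c \<theta>) * norm (c \<theta>'))))"
      unfolding sum.distrib[symmetric] by (intro sum.cong refl) (simp add: distrib_left mult_ac)
    also have "\<dots> = (\<Sum>\<theta>\<in>\<Theta>. 3 * pi * (norm (c \<theta>))\<^sup>2 + (\<Sum>\<theta>'\<in>\<Theta>. ?\<beta> * (norm (c \<theta>) * norm (c \<theta>'))))"
      using \<Theta> by (intro sum.cong refl) (simp add: sum.delta' power2_eq_square)
    also have "\<dots> = 3 * pi * (\<Sum>\<theta>\<in>\<Theta>. (norm (c \<theta>))\<^sup>2) + ?\<beta> * (\<Sum>\<theta>\<in>\<Theta>. norm (c \<theta>))\<^sup>2"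
      by (simp only: sum.distrib sum_distrib_left[symmetric] power2_eq_square[of "sum _ _"] sum_product)
    finally show ?thesis .
  qed
  also have "?\<beta> * (\<Sum>\<theta>\<in>\<Theta>. norm (c \<theta>))\<^sup>2 \<le> ?\<beta> * ((\<Sum>\<theta>\<in>\<Theta>. (norm (c \<theta>))\<^sup>2) * real (card \<Theta>))"
    by (intro mult_left_mono sum_squared_le_sum_of_squares \<beta>)
  also have "\<dots> = (2 + 6 * pi) * (\<epsilon> * real (card \<Theta>) / d) * (\<Sum>\<theta>\<in>\<Theta>. (norm (c \<theta>))\<^sup>2)"
    by simp
  also have "\<dots> \<le> (2 + 6 * pi) * K * (\<Sum>\<theta>\<in>\<Theta>. (norm (c \<theta>))\<^sup>2)"
    using K d by (intro mult_right_mono mult_left_mono sum_nonneg) (auto simp: field_simps)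
  finally show ?thesis by (simp add: distrib_right)
qed

text \<open>Duality: the left side \<open>G\<close> is the pairing of \<open>v j * f j\<close> with
  the exponential sum whose coefficients are the \<open>g \<theta>\<close> themselves.
  Cauchy-Schwarz and the dual inequality give a bound for \<open>G * G\<close> with a factor
  \<open>G\<close> on the right, which is cancelled. The 16 is the square of the 4 in the bound on
  \<open>v\<close>.\<close>

lemma large_sieve_weighted:
  assumes \<epsilon>: "0 < \<epsilon>" "\<epsilon> \<le> 1" and J: "finite J" and \<Theta>: "finite \<Theta>" and d: "d > 0"
    and sep: "\<And>\<theta> \<theta>' (l::int). \<theta> \<in> \<Theta> \<Longrightarrow> \<theta>' \<in> \<Theta> \<Longrightarrow> \<theta> \<noteq> \<theta>' \<Longrightarrow> d \<le> \<bar>\<theta> - \<theta>' - of_int l\<bar>"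
    and K: "\<epsilon> * real (card \<Theta>) \<le> K * d" "K \<ge> 0"
    and v: "\<And>j. \<bar>v j\<bar> \<le> 4 * weight \<epsilon> y j"
  shows "(\<Sum>\<theta>\<in>\<Theta>. (norm (\<Sum>j\<in>J. of_real (v j) * f j * ex (- (\<theta> * of_int j))))\<^sup>2)
    \<le> 16 * (3 * pi + (2 + 6 * pi) * K) * (\<Sum>j\<in>J. weight \<epsilon> y j * (norm (f j))\<^sup>2)"
proof -
  define D where "D = 3 * pi + (2 + 6 * pi) * K"
  have D: "D \<ge> 0" using K by (simp add: D_def)
  define g where "g \<theta> = (\<Sum>j\<in>J. of_real (v j) * f j * ex (- (\<theta> * of_int j)))" for \<theta>
  define h where "h j = (\<Sum>\<theta>\<in>\<Theta>. g \<theta> * ex (\<theta> * of_int j))" for j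
  define G where "G = (\<Sum>\<theta>\<in>\<Theta>. (norm (g \<theta>))\<^sup>2)"
  define F where "F = (\<Sum>j\<in>J. weight \<epsilon> y j * (norm (f j))\<^sup>2)"
  have G0: "G \<ge> 0" by (simp add: G_def sum_nonneg)
  have F0: "F \<ge> 0" using \<epsilon> by (auto simp: F_def weight_nonneg intro!: sum_nonneg)
  have wn: "weight \<epsilon> y j \<ge> 0" for j using \<epsilon> by (simp add: weight_nonneg)
  have "complex_of_real G = (\<Sum>\<theta>\<in>\<Theta>. g \<theta> * cnj (g \<theta>))"
    by (simp only: G_def of_real_sum complex_norm_square)
  also have "\<dots> = (\<Sum>\<theta>\<in>\<Theta>. \<Sum>j\<in>J. of_real (v j) * cnj (f j) * (g \<theta> * ex (\<theta> * of_int j)))"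
  proof (intro sum.cong refl)
    fix \<theta>
    show "g \<theta> * cnj (g \<theta>) = (\<Sum>j\<in>J. of_real (v j) * cnj (f j) * (g \<theta> * ex (\<theta> * of_int j)))"
      unfolding g_def[of \<theta>, THEN arg_cong[of _ _ cnj]] cnj_sum sum_distrib_left
      by (intro sum.cong refl) (simp add: mult_ac)
  qed
  also have "\<dots> = (\<Sum>j\<in>J. of_real (v j) * cnj (f j) * h j)"
    unfolding h_def sum_distrib_left by (rule sum.swap)
  finally have "norm (complex_of_real G) = norm (\<Sum>j\<in>J. of_real (v j) * cnj (f j) * h j)" by simp
  also have "\<dots> \<le> (\<Sum>j\<in>J. 4 * weight \<epsilon> y j * norm (f j) * norm (h j))"
    using v by (intro sum_norm_le) (auto simp: norm_mult intro!: mult_right_mono)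
  finally have "G \<le> (\<Sum>j\<in>J. 4 * weight \<epsilon> y j * norm (f j) * norm (h j))" using G0 by simp
  also have "\<dots> = 4 * (\<Sum>j\<in>J. (sqrt (weight \<epsilon> y j) * norm (f j)) * (sqrt (weight \<epsilon> y j) * norm (h j)))"
    unfolding sum_distrib_left
  proof (intro sum.cong refl)
    fix j
    have "weight \<epsilon> y j = sqrt (weight \<epsilon> y j) * sqrt (weight \<epsilon> y j)" using wn by simp
    then show "4 * weight \<epsilon> y j * norm (f j) * norm (h j)
      = 4 * ((sqrt (weight \<epsilon> y j) * norm (f j)) * (sqrt (weight \<epsilon> y j) * norm (h j)))"
      by (metis mult.assoc mult.commute)
  qed
  finally have "G \<le> 4 * (\<Sum>j\<in>J. (sqrt (weight \<epsilon> y j) * norm (f j)) * (sqrt (weight \<epsilon> y j) * norm (h j)))" .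
  then have "G\<^sup>2 \<le> (4 * (\<Sum>j\<in>J. (sqrt (weight \<epsilon> y j) * norm (f j)) * (sqrt (weight \<epsilon> y j) * norm (h j))))\<^sup>2"
    using G0 by (intro power_mono)
  also have "\<dots> = 16 * (\<Sum>j\<in>J. (sqrt (weight \<epsilon> y j) * norm (f j)) * (sqrt (weight \<epsilon> y j) * norm (h j)))\<^sup>2"
    by (simp only: power_mult_distrib) simp
  also have "\<dots> \<le> 16 * ((\<Sum>j\<in>J. (sqrt (weight \<epsilon> y j) * norm (f j))\<^sup>2) * (\<Sum>j\<in>J. (sqrt (weight \<epsilon> y j) * norm (h j))\<^sup>2))"
    by (intro mult_left_mono Cauchy_Schwarz_ineq_sum) simp
  also have "\<dots> = 16 * (F * (\<Sum>j\<in>J. weight \<epsilon> y j * (norm (h j))\<^sup>2))"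
    using wn by (simp add: F_def power_mult_distrib)
  also have "\<dots> \<le> 16 * (F * (D * G))"
    unfolding D_def h_def G_def
    by (intro mult_left_mono F0 dual_large_sieve[OF \<epsilon> J \<Theta> d sep K(1)]) auto
  finally have *: "G * G \<le> (16 * D * F) * G" by (simp add: power2_eq_square mult_ac)
  have "G \<le> 16 * D * F"
  proof (cases "G = 0")
    case True
    then show ?thesis using D F0 by simp
  next
    case False
    then show ?thesis using G0 * by (simp add: mult_le_cancel_right)
  qed
  then show ?thesis by (simp only: G_def g_def D_def F_def)
qed

section \<open>Interpolation and Ramanujan sums\<close>

lemma has_bochner_integral_power_cutoff:
  fixes t :: real
  assumes "t \<ge> 0"
  shows "has_bochner_integral lborel (\<lambda>l. l ^ k * indicator {0..t} l) (t ^ Suc k / real (Suc k))"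
proof -
  have "integrable lborel (\<lambda>l::real. indicator {0..t} l *\<^sub>R l ^ k)"
    by (rule borel_integrable_compact) (auto intro!: continuous_intros)
  then show ?thesis
    using integral_power[OF assms, of k] by (simp add: has_bochner_integral_iff mult.commute)
qed

text \<open>Marcinkiewicz interpolation between \<open>L\<^sup>2\<close> and \<open>L\<^sup>\<infinity>\<close>: truncate \<open>f\<close> at height \<open>\<lambda> / (2 D)\<close>
  and integrate the resulting level set inequality against \<open>\<lambda>\<^sup>2\<^sup>k\<^sup>+\<^sup>1 d\<lambda>\<close>.\<close>

lemma marcinkiewicz_finite:
  fixes T :: "'y \<Rightarrow> 'j \<Rightarrow> complex"
  assumes "finite J" and \<nu>: "\<And>y. y \<in> Y \<Longrightarrow> \<nu> y \<ge> 0" and W: "\<And>j. j \<in> J \<Longrightarrow> W j \<ge> 0"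
    and A: "A \<ge> 0" and D: "D > 0"
    and L2: "\<And>f. (\<Sum>y\<in>Y. \<nu> y * (norm (\<Sum>j\<in>J. T y j * f j))\<^sup>2) \<le> A * (\<Sum>j\<in>J. W j * (norm (f j))\<^sup>2)"
    and Linf: "\<And>f c y. y \<in> Y \<Longrightarrow> (\<And>j. j \<in> J \<Longrightarrow> norm (f j) \<le> c) \<Longrightarrow> c \<ge> 0 \<Longrightarrow> norm (\<Sum>j\<in>J. T y j * f j) \<le> D * c"
  shows "(\<Sum>y\<in>Y. \<nu> y * norm (\<Sum>j\<in>J. T y j * f j) ^ (2 * k + 4))
    \<le> 4 * real (2 * k + 4) * A * (2 * D) ^ (2 * k + 2) * (\<Sum>j\<in>J. W j * norm (f j) ^ (2 * k + 4))"
proof -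
  define t where "t y = norm (\<Sum>j\<in>J. T y j * f j)" for y
  define s where "s j = 2 * D * norm (f j)" for j
  have t0: "t y \<ge> 0" and s0: "s j \<ge> 0" for y j using D by (simp_all add: t_def s_def)
  have level: "(\<Sum>y\<in>Y. \<nu> y * (l\<^sup>2 * indicator {0..t y} l)) \<le> 4 * A * (\<Sum>j\<in>J. W j * ((norm (f j))\<^sup>2 * indicator {0..s j} l))" for l :: real
  proof (cases "l > 0")
    case True
    define f1 where "f1 j = (if l \<le> s j then f j else 0)" for j
    have "l\<^sup>2 * indicator {0..t y} l \<le> 4 * (norm (\<Sum>j\<in>J. T y j * f1 j))\<^sup>2" if y: "y \<in> Y" for y
    proof (cases "l \<le> t y")
      case le: True
      \<comment> \<open>The part of \<open>f\<close> below height \<open>l / (2 * D)\<close>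
        contributes at most \<open>l / 2\<close>, so wherever the image reaches \<open>l\<close> the
        part \<open>f1\<close> must account for the other half.\<close>
      have "norm (\<Sum>j\<in>J. T y j * (f j - f1 j)) \<le> D * (l / (2 * D))"
        by (rule Linf[OF y]) (use True D in \<open>auto simp: f1_def s_def field_simps\<close>)
      moreover have "(\<Sum>j\<in>J. T y j * f j) = (\<Sum>j\<in>J. T y j * f1 j) + (\<Sum>j\<in>J. T y j * (f j - f1 j))"
        by (simp add: sum.distrib[symmetric] right_diff_distrib)
      ultimately have "t y \<le> norm (\<Sum>j\<in>J. T y j * f1 j) + l / 2"
        using D norm_triangle_ineq[of "\<Sum>j\<in>J. T y j * f1 j" "\<Sum>j\<in>J. T y j * (f j - f1 j)"] by (simp add: t_def)
      then have "l \<le> 2 * norm (\<Sum>j\<in>J. T y j * f1 j)" using le by linarith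
      then have "l\<^sup>2 \<le> (2 * norm (\<Sum>j\<in>J. T y j * f1 j))\<^sup>2" using True by (intro power_mono) auto
      then show ?thesis using le True by (simp add: power_mult_distrib)
    qed (simp add: indicator_def)
    then have "(\<Sum>y\<in>Y. \<nu> y * (l\<^sup>2 * indicator {0..t y} l)) \<le> (\<Sum>y\<in>Y. \<nu> y * (4 * (norm (\<Sum>j\<in>J. T y j * f1 j))\<^sup>2))"
      using \<nu> by (intro sum_mono mult_left_mono)
    also have "\<dots> = 4 * (\<Sum>y\<in>Y. \<nu> y * (norm (\<Sum>j\<in>J. T y j * f1 j))\<^sup>2)"
      by (simp add: sum_distrib_left mult_ac)
    also have "\<dots> \<le> 4 * (A * (\<Sum>j\<in>J. W j * (norm (f1 j))\<^sup>2))" by (intro mult_left_mono L2) auto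
    also have "(\<Sum>j\<in>J. W j * (norm (f1 j))\<^sup>2) = (\<Sum>j\<in>J. W j * ((norm (f j))\<^sup>2 * indicator {0..s j} l))"
      using True by (intro sum.cong refl) (simp add: f1_def indicator_def)
    finally show ?thesis by simp
  next
    case False
    then have "l\<^sup>2 * indicator {0..t y} l = 0" for y by (auto simp: indicator_def)
    then have "(\<Sum>y\<in>Y. \<nu> y * (l\<^sup>2 * indicator {0..t y} l)) = 0"
      by (simp only: mult_zero_right sum.neutral_const)
    then show ?thesis using A W by (auto intro!: mult_nonneg_nonneg sum_nonneg)
  qed
  \<comment> \<open>The powers of \<open>l\<close> are matched so that the left integrates to
    \<open>t y ^ (2 * k + 4)\<close>, while the right integrates to
    \<open>s j ^ (2 * k + 2)\<close>, which together with the square of \<open>norm (f j)\<close>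
    has the same degree.\<close>
  have I1: "has_bochner_integral lborel (\<lambda>l. \<Sum>y\<in>Y. \<nu> y * (l ^ (2 * k + 3) * indicator {0..t y} l))
     (\<Sum>y\<in>Y. \<nu> y * (t y ^ Suc (2 * k + 3) / real (Suc (2 * k + 3))))"
    by (intro has_bochner_integral_sum has_bochner_integral_mult_right has_bochner_integral_power_cutoff t0)
  have I2: "has_bochner_integral lborel (\<lambda>l. 4 * A * (\<Sum>j\<in>J. (W j * (norm (f j))\<^sup>2) * (l ^ (2 * k + 1) * indicator {0..s j} l)))
     (4 * A * (\<Sum>j\<in>J. (W j * (norm (f j))\<^sup>2) * (s j ^ Suc (2 * k + 1) / real (Suc (2 * k + 1)))))"
    by (intro has_bochner_integral_mult_right has_bochner_integral_sum has_bochner_integral_power_cutoff s0)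
  have le: "(\<Sum>y\<in>Y. \<nu> y * (l ^ (2 * k + 3) * indicator {0..t y} l)) \<le> 4 * A * (\<Sum>j\<in>J. (W j * (norm (f j))\<^sup>2) * (l ^ (2 * k + 1) * indicator {0..s j} l))" for l :: real
  proof (cases "l \<ge> 0")
    case True
    have "l ^ (2 * k + 1) * (\<Sum>y\<in>Y. \<nu> y * (l\<^sup>2 * indicator {0..t y} l)) \<le> l ^ (2 * k + 1) * (4 * A * (\<Sum>j\<in>J. W j * ((norm (f j))\<^sup>2 * indicator {0..s j} l)))"
      using True by (intro mult_left_mono level) auto
    moreover have "l ^ (2 * k + 1) * l\<^sup>2 = l ^ (2 * k + 3)" by (simp add: power_add eval_nat_numeral)
    then have "l ^ (2 * k + 1) * (\<nu> y * (l\<^sup>2 * i)) = \<nu> y * (l ^ (2 * k + 3) * i)" for i y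
      by (metis mult.assoc mult.left_commute)
    then have "l ^ (2 * k + 1) * (\<Sum>y\<in>Y. \<nu> y * (l\<^sup>2 * indicator {0..t y} l)) = (\<Sum>y\<in>Y. \<nu> y * (l ^ (2 * k + 3) * indicator {0..t y} l))"
      unfolding sum_distrib_left by (intro sum.cong refl)
    moreover have "l ^ (2 * k + 1) * (4 * A * (\<Sum>j\<in>J. W j * ((norm (f j))\<^sup>2 * indicator {0..s j} l)))
      = 4 * A * (\<Sum>j\<in>J. (W j * (norm (f j))\<^sup>2) * (l ^ (2 * k + 1) * indicator {0..s j} l))"
      by (simp only: sum_distrib_left mult_ac)
    ultimately show ?thesis by argo
  next
    case False
    then have "indicator {0..x} l = (0 :: real)" for x by (simp add: indicator_def)
    then show ?thesis by simp
  qed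
  have "(\<Sum>y\<in>Y. \<nu> y * (t y ^ Suc (2 * k + 3) / real (Suc (2 * k + 3))))
    \<le> 4 * A * (\<Sum>j\<in>J. (W j * (norm (f j))\<^sup>2) * (s j ^ Suc (2 * k + 1) / real (Suc (2 * k + 1))))"
    using integral_mono[OF integrable.intros[OF I1] integrable.intros[OF I2] le]
    unfolding has_bochner_integral_integral_eq[OF I1] has_bochner_integral_integral_eq[OF I2] .
  also have "\<dots> \<le> 4 * A * (\<Sum>j\<in>J. (W j * (norm (f j))\<^sup>2) * (2 * D * norm (f j)) ^ (2 * k + 2))"
  proof (intro mult_left_mono sum_mono)
    fix j assume "j \<in> J"
    have "s j ^ Suc (2 * k + 1) / real (Suc (2 * k + 1)) \<le> s j ^ Suc (2 * k + 1) / 1"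
      by (intro divide_left_mono) (auto intro!: mult_nonneg_nonneg s0)
    then show "s j ^ Suc (2 * k + 1) / real (Suc (2 * k + 1)) \<le> (2 * D * norm (f j)) ^ (2 * k + 2)"
      unfolding s_def[of j, symmetric] by simp
  qed (use A W in auto)
  also have "\<dots> = 4 * A * (2 * D) ^ (2 * k + 2) * (\<Sum>j\<in>J. W j * norm (f j) ^ (2 * k + 4))"
  proof -
    have "(W j * (norm (f j))\<^sup>2) * (2 * D * norm (f j)) ^ (2 * k + 2) = (2 * D) ^ (2 * k + 2) * (W j * norm (f j) ^ (2 * k + 4))" for j
    proof -
      have e1: "norm (f j) ^ (2 * k + 4) = (norm (f j))\<^sup>2 * norm (f j) ^ (2 * k + 2)"
        by (simp add: power_add eval_nat_numeral)
      have e2: "(2 * D * norm (f j)) ^ (2 * k + 2) = (2 * D) ^ (2 * k + 2) * norm (f j) ^ (2 * k + 2)"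
        by (rule power_mult_distrib)
      show ?thesis unfolding e1 e2 by (simp only: mult_ac)
    qed
    then show ?thesis by (simp only: sum_distrib_left mult_ac)
  qed
  finally have "(\<Sum>y\<in>Y. \<nu> y * (t y ^ (2 * k + 4) / real (2 * k + 4))) \<le> 4 * A * (2 * D) ^ (2 * k + 2) * (\<Sum>j\<in>J. W j * norm (f j) ^ (2 * k + 4))"
    by (simp add: eval_nat_numeral)
  then have "(\<Sum>y\<in>Y. \<nu> y * t y ^ (2 * k + 4)) / real (2 * k + 4) \<le> 4 * A * (2 * D) ^ (2 * k + 2) * (\<Sum>j\<in>J. W j * norm (f j) ^ (2 * k + 4))"
    by (simp only: sum_divide_distrib times_divide_eq_right)
  then have "(\<Sum>y\<in>Y. \<nu> y * t y ^ (2 * k + 4)) \<le> 4 * A * (2 * D) ^ (2 * k + 2) * (\<Sum>j\<in>J. W j * norm (f j) ^ (2 * k + 4)) * real (2 * k + 4)"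
    by (subst (asm) pos_divide_le_eq) auto
  then show ?thesis by (simp only: t_def mult_ac)
qed

section \<open>Ramanujan sums\<close>

definition residues_coprime :: "nat \<Rightarrow> nat set" where
  "residues_coprime q = {a \<in> {1..q}. coprime a q}"

definition ramanujan_sum :: "nat \<Rightarrow> int \<Rightarrow> complex" where
  "ramanujan_sum q x = (\<Sum>a\<in>residues_coprime q. ex (real a / real q * of_int x))"

lemma prod_primes_dvd_iff:
  fixes a :: nat
  assumes "finite S" "\<And>p. p \<in> S \<Longrightarrow> prime p"
  shows "\<Prod>S dvd a \<longleftrightarrow> (\<forall>p\<in>S. p dvd a)"
  using assms
proof (induction S rule: finite_induct)
  case (insert p S)
  have "coprime p (\<Prod>S)"
    using insert by (intro prod_coprime_right) (auto intro: primes_coprime)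
  then have "p * \<Prod>S dvd a \<longleftrightarrow> p dvd a \<and> \<Prod>S dvd a"
    by (meson divides_mult dvd_mult_left dvd_mult_right)
  then show ?case using insert by simp
qed simp

lemma sum_ex_full_period:
  assumes "d > 0"
  shows "(\<Sum>b\<in>{1..d}. ex (real b / real d * of_int x)) = (if int d dvd x then of_nat d else 0)"
proof -
  let ?f = "\<lambda>b. ex (of_int x / real d * real b)"
  have eq: "ex (real b / real d * of_int x) = ?f b" for b by (simp add: mult_ac)
  have "?f d = ?f 0" using assms by simp
  moreover have "{1..d} = insert d {1..<d}" "{..<d} = insert 0 {1..<d}" using assms by auto
  ultimately have "(\<Sum>b\<in>{1..d}. ?f b) = (\<Sum>b<d. ?f b)" by simp
  also have "\<dots> = (if int d dvd x then of_nat d else 0)"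
  proof (cases "int d dvd x")
    case True
    then obtain k where "x = int d * k" by blast
    then have "of_int x / real d = of_int k" using assms by simp
    then show ?thesis using True by simp
  next
    case False
    have n1: "of_int x / real d \<notin> \<int>"
    proof
      assume "of_int x / real d \<in> \<int>"
      then obtain k where "of_int x / real d = of_int k" by (auto elim: Ints_cases)
      then have "real_of_int x = of_int (k * int d)" using assms by (simp add: field_simps)
      then have "x = k * int d" by (simp only: of_int_eq_iff)
      with False show False by simp
    qed
    have n2: "of_int x / real d * real d \<in> \<int>" using assms by simp
    show ?thesis using False sum_ex_roots[OF n2 n1] by (simp only: if_False)
  qed
  finally show ?thesis by (simp only: eq)
qed

text \<open>Inclusion-exclusion over the prime divisors of \<open>q\<close>; the \<open>2\<^sup>\<omega>\<^sup>(\<^sup>q\<^sup>)\<close> terms are the source of the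
  factor in the theorem.\<close>

lemma norm_ramanujan_sum_le:
  assumes q: "q > 0"
  shows "norm (ramanujan_sum q x)
    \<le> (\<Sum>S\<in>Pow (prime_factors q). if int (q div \<Prod>S) dvd x then real (q div \<Prod>S) else 0)"
proof -
  let ?P = "prime_factors q"
  have prS: "finite S" "\<And>p. p \<in> S \<Longrightarrow> prime p" if "S \<in> Pow ?P" for S
    using that by (auto intro: finite_subset in_prime_factors_imp_prime)
  \<comment> \<open>Coprimality is the product over the primes \<open>p\<close> dividing
    \<open>q\<close> of 1 minus the indicator of \<open>p dvd a\<close>; the expansion runs over the
    squarefree divisors, that is, sets \<open>S\<close> of primes.\<close>
  have ie: "(if coprime a q then 1 else 0 :: complex) = (\<Sum>S\<in>Pow ?P. (- 1) ^ card S * (if \<Prod>S dvd a then 1 else 0))" for a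
  proof -
    have "coprime a q \<longleftrightarrow> (\<forall>p\<in>?P. \<not> p dvd a)"
    proof
      assume c: "coprime a q"
      show "\<forall>p\<in>?P. \<not> p dvd a"
      proof (intro ballI notI)
        fix p assume p: "p \<in> ?P" "p dvd a"
        then have "p dvd q" "prime p" by auto
        with c p have "is_unit p" by (meson coprime_common_divisor)
        then show False using \<open>prime p\<close> by simp
      qed
    next
      assume *: "\<forall>p\<in>?P. \<not> p dvd a"
      show "coprime a q"
      proof (rule ccontr)
        assume "\<not> coprime a q"
        then have "gcd a q \<noteq> 1" by (simp add: coprime_iff_gcd_eq_1)
        then obtain p where "prime p" "p dvd gcd a q" using prime_factor_nat by blast
        then show False using * q by (auto simp: prime_factors_dvd)
      qed
    qed
    then have "(if coprime a q then 1 else 0 :: complex) = (\<Prod>p\<in>?P. 1 - (if p dvd a then 1 else 0))"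
      by (auto intro!: prod.neutral[symmetric] prod_zero[symmetric])
    also have "\<dots> = (\<Sum>S\<in>Pow ?P. (- 1) ^ card S * (\<Prod>p\<in>S. if p dvd a then 1 else 0) * (\<Prod>p\<in>?P - S. 1))"
      by (rule prod_diff_conv_sum) simp
    also have "\<dots> = (\<Sum>S\<in>Pow ?P. (- 1) ^ card S * (if \<Prod>S dvd a then 1 else 0))"
    proof (intro sum.cong refl)
      fix S assume S: "S \<in> Pow ?P"
      have iff: "\<Prod>S dvd a \<longleftrightarrow> (\<forall>p\<in>S. p dvd a)"
        by (rule prod_primes_dvd_iff) (use prS[OF S] in auto)
      have "(\<Prod>p\<in>S. if p dvd a then 1 else 0 :: complex) = (if \<Prod>S dvd a then 1 else 0)"
        unfolding iff using prS(1)[OF S] by (auto intro!: prod.neutral prod_zero)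
      then show "(- 1) ^ card S * (\<Prod>p\<in>S. if p dvd a then 1 else 0 :: complex) * (\<Prod>p\<in>?P - S. 1) = (- 1) ^ card S * (if \<Prod>S dvd a then 1 else 0)"
        by simp
    qed
    finally show ?thesis .
  qed
  \<comment> \<open>The multiples of \<open>e\<close> up to \<open>q\<close> are
    \<open>e * b\<close> with \<open>b\<close> up to \<open>d\<close>, and their phases form a
    complete exponential sum modulo \<open>d\<close>.\<close>
  have inner: "(\<Sum>a\<in>{1..q}. (if \<Prod>S dvd a then 1 else 0) * ex (real a / real q * of_int x))
      = (if int (q div \<Prod>S) dvd x then of_nat (q div \<Prod>S) else 0)" if S: "S \<in> Pow ?P" for S
  proof -
    define e d where "e = \<Prod>S" and "d = q div e"
    have "e dvd q" unfolding e_def by (subst prod_primes_dvd_iff) (use prS[OF S] S in auto)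
    then have qde: "q = e * d" by (simp add: d_def)
    then have pos: "e > 0" "d > 0" using q by auto
    have "(\<Sum>a\<in>{1..q}. (if e dvd a then 1 else 0) * ex (real a / real q * of_int x))
      = (\<Sum>a\<in>{a \<in> {1..q}. e dvd a}. ex (real a / real q * of_int x))"
      by (intro sum.mono_neutral_cong_right) auto
    also have "{a \<in> {1..q}. e dvd a} = (\<lambda>b. e * b) ` {1..d}"
      using pos by (auto simp: qde elim!: dvdE)
    also have "(\<Sum>a\<in>(\<lambda>b. e * b) ` {1..d}. ex (real a / real q * of_int x)) = (\<Sum>b\<in>{1..d}. ex (real b / real d * of_int x))"
      using pos by (subst sum.reindex) (auto simp: inj_on_def qde)
    also have "\<dots> = (if int d dvd x then of_nat d else 0)" by (rule sum_ex_full_period[OF pos(2)])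
    finally show ?thesis by (simp only: e_def d_def)
  qed
  have "ramanujan_sum q x = (\<Sum>a\<in>{1..q}. (if coprime a q then 1 else 0) * ex (real a / real q * of_int x))"
    unfolding ramanujan_sum_def residues_coprime_def by (intro sum.mono_neutral_cong_left) auto
  also have "\<dots> = (\<Sum>a\<in>{1..q}. \<Sum>S\<in>Pow ?P. (- 1) ^ card S * ((if \<Prod>S dvd a then 1 else 0) * ex (real a / real q * of_int x)))"
    unfolding ie sum_distrib_right by (simp only: mult.assoc)
  also have "\<dots> = (\<Sum>S\<in>Pow ?P. (- 1) ^ card S * (\<Sum>a\<in>{1..q}. (if \<Prod>S dvd a then 1 else 0) * ex (real a / real q * of_int x)))"
    unfolding sum_distrib_left by (rule sum.swap)
  also have "norm \<dots> \<le> (\<Sum>S\<in>Pow ?P. if int (q div \<Prod>S) dvd x then real (q div \<Prod>S) else 0)"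
  proof (rule sum_norm_le)
    fix S assume S: "S \<in> Pow ?P"
    show "norm ((- 1) ^ card S * (\<Sum>a\<in>{1..q}. (if \<Prod>S dvd a then 1 else 0) * ex (real a / real q * of_int x)))
      \<le> (if int (q div \<Prod>S) dvd x then real (q div \<Prod>S) else 0)"
      unfolding inner[OF S] by (simp add: norm_mult norm_power)
  qed
  finally show ?thesis .
qed

text \<open>For each set \<open>S\<close> of primes the relevant \<open>j\<close> lie in one residue
  class modulo \<open>d\<close>. The factor \<open>d\<close> compensates for the sparsity of the
  class: the result is again a normalised lattice sum, now with spacing
  \<open>\<epsilon> * d \<le> \<epsilon> * q \<le> 1\<close>, hence at most \<open>3 * pi\<close>.
  There are \<open>2 ^ omega q\<close> sets.\<close>

lemma sum_weight_ramanujan_le: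
  assumes \<epsilon>: "0 < \<epsilon>" "\<epsilon> * real q \<le> 1" and q: "q > 0" and J: "finite J"
  shows "(\<Sum>j\<in>J. weight \<epsilon> y j * norm (ramanujan_sum q (x - j))) \<le> 3 * pi * 2 ^ omega q"
proof -
  let ?P = "prime_factors q"
  have "(\<Sum>j\<in>J. weight \<epsilon> y j * norm (ramanujan_sum q (x - j)))
    \<le> (\<Sum>j\<in>J. weight \<epsilon> y j * (\<Sum>S\<in>Pow ?P. if int (q div \<Prod>S) dvd x - j then real (q div \<Prod>S) else 0))"
    using \<epsilon> by (intro sum_mono mult_left_mono norm_ramanujan_sum_le q weight_nonneg)
  also have "\<dots> = (\<Sum>S\<in>Pow ?P. \<Sum>j\<in>J. weight \<epsilon> y j * (if int (q div \<Prod>S) dvd x - j then real (q div \<Prod>S) else 0))"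
    unfolding sum_distrib_left by (rule sum.swap)
  also have "\<dots> \<le> (\<Sum>S\<in>Pow ?P. 3 * pi)"
  proof (rule sum_mono)
    fix S assume S: "S \<in> Pow ?P"
    define d where "d = q div \<Prod>S"
    have "\<Prod>S dvd q"
      using S by (subst prod_primes_dvd_iff) (auto intro: finite_subset in_prime_factors_imp_prime)
    then have d: "d > 0" "d \<le> q" using q by (auto simp: d_def div_greater_zero_iff dvd_imp_le dvd_pos_nat)
    define e where "e = \<epsilon> * real d"
    have e: "0 < e" "e \<le> 1"
    proof -
      have "\<epsilon> * real d \<le> \<epsilon> * real q" using d \<epsilon> by (intro mult_left_mono) auto
      then show "e \<le> 1" using \<epsilon>(2) unfolding e_def by linarith
    qed (use d \<epsilon> in \<open>simp add: e_def\<close>)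
    define I where "I = (\<lambda>j. (j - x) div int d) ` {j \<in> J. int d dvd x - j}"
    have "(\<Sum>j\<in>J. weight \<epsilon> y j * (if int d dvd x - j then real d else 0)) = (\<Sum>j\<in>{j \<in> J. int d dvd x - j}. weight \<epsilon> y j * real d)"
      using J by (intro sum.mono_neutral_cong_right) auto
    also have "\<dots> = (\<Sum>i\<in>I. e * decay ((y - \<epsilon> * of_int x) - e * of_int i))"
      unfolding I_def
    proof (subst sum.reindex)
      show "inj_on (\<lambda>j. (j - x) div int d) {j \<in> J. int d dvd x - j}"
      proof (rule inj_onI)
        fix i j assume ij: "i \<in> {j \<in> J. int d dvd x - j}" "j \<in> {j \<in> J. int d dvd x - j}" "(i - x) div int d = (j - x) div int d"
        then have "int d dvd i - x" "int d dvd j - x" by (simp_all add: dvd_diff_commute)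
        then show "i = j" using ij(3) by (metis diff_add_cancel dvd_mult_div_cancel)
      qed
      show "(\<Sum>j\<in>{j \<in> J. int d dvd x - j}. weight \<epsilon> y j * real d)
        = sum ((\<lambda>i. e * decay ((y - \<epsilon> * of_int x) - e * of_int i)) \<circ> (\<lambda>j. (j - x) div int d)) {j \<in> J. int d dvd x - j}"
      proof (intro sum.cong refl)
        fix j assume "j \<in> {j \<in> J. int d dvd x - j}"
        then have "int d dvd j - x" by (simp add: dvd_diff_commute)
        then have "j - x = int d * ((j - x) div int d)" by simp
        then have "real_of_int (j - x) = real d * of_int ((j - x) div int d)" by (metis of_int_mult of_int_of_nat_eq)
        then have "e * of_int ((j - x) div int d) = \<epsilon> * (of_int j - of_int x)" by (simp add: e_def)
        then have E: "(y - \<epsilon> * of_int x) - e * of_int ((j - x) div int d) = y - \<epsilon> * of_int j"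
          by (simp add: algebra_simps)
        show "weight \<epsilon> y j * real d = ((\<lambda>i. e * decay ((y - \<epsilon> * of_int x) - e * of_int i)) \<circ> (\<lambda>j. (j - x) div int d)) j"
          unfolding comp_def E weight_def by (simp add: e_def)
      qed
    qed
    also have "\<dots> \<le> 3 * pi"
      using sum_weight_le[OF e, of I "y - \<epsilon> * of_int x"] J by (simp add: weight_def I_def)
    finally show "(\<Sum>j\<in>J. weight \<epsilon> y j * (if int (q div \<Prod>S) dvd x - j then real (q div \<Prod>S) else 0)) \<le> 3 * pi"
      by (simp only: d_def)
  qed
  also have "\<dots> = 3 * pi * 2 ^ omega q" by (simp add: card_Pow omega_def)
  finally show ?thesis .
qed

section \<open>Pairwise coprime moduli\<close>

lemma one_div_le_dist_int:
  assumes "x * real n \<in> \<int>" "x \<notin> \<int>" "n > 0"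
  shows "1 / real n \<le> \<bar>x - of_int l\<bar>"
proof -
  obtain k where k: "x * real n = of_int k" using assms(1) by (auto elim: Ints_cases)
  have "k - l * int n \<noteq> 0"
  proof
    assume "k - l * int n = 0"
    then have "x * real n = of_int l * real n" using k by (metis eq_iff_diff_eq_0 of_int_mult of_int_of_nat_eq)
    then have "x = of_int l" using assms(3) by simp
    then show False using assms(2) by simp
  qed
  then have "1 \<le> \<bar>real_of_int (k - l * int n)\<bar>" by linarith
  also have "real_of_int (k - l * int n) = (x - of_int l) * real n"
    using k by (simp add: algebra_simps)
  finally have "1 \<le> \<bar>x - of_int l\<bar> * real n" by (simp add: abs_mult)
  then show ?thesis using assms(3) by (simp add: field_simps)
qed

lemma finite_residues_coprime [simp]: "finite (residues_coprime q)"
  by (simp add: residues_coprime_def)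

lemma bij_betw_reduced_fracs:
  assumes "\<And>q. q \<in> Z \<Longrightarrow> q > 0"
  shows "bij_betw (\<lambda>(q, a). real a / real q) (Sigma Z residues_coprime) (reduced_fracs Z)"
  unfolding bij_betw_def
proof
  show "(\<lambda>(q, a). real a / real q) ` Sigma Z residues_coprime = reduced_fracs Z"
    unfolding reduced_fracs_def residues_coprime_def by force
  show "inj_on (\<lambda>(q, a). real a / real q) (Sigma Z residues_coprime)"
  proof (rule inj_onI, clarify)
    fix q a q' a'
    assume *: "q \<in> Z" "a \<in> residues_coprime q" "q' \<in> Z" "a' \<in> residues_coprime q'"
      "real a / real q = real a' / real q'"
    then have q: "q > 0" "q' > 0" using assms by auto
    have cop: "coprime a q" "coprime a' q'" using * by (auto simp: residues_coprime_def)
    have "real a * real q' = real a' * real q" using *(5) q by (simp add: field_simps)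
    then have eq: "a * q' = a' * q" by (metis of_nat_eq_iff of_nat_mult)
    have "q dvd q'" using eq cop(1) by (metis coprime_commute coprime_dvd_mult_right_iff dvd_triv_right)
    moreover have "q' dvd q" using eq cop(2) by (metis coprime_commute coprime_dvd_mult_right_iff dvd_triv_right)
    ultimately have "q = q'" by (rule dvd_antisym)
    then show "q = q' \<and> a = a'" using eq q by simp
  qed
qed

lemma sum_reduced_fracs:
  assumes "finite Z" "\<And>q. q \<in> Z \<Longrightarrow> q > 0"
  shows "(\<Sum>\<theta>\<in>reduced_fracs Z. h \<theta>) = (\<Sum>q\<in>Z. \<Sum>a\<in>residues_coprime q. h (real a / real q))"
  using sum.reindex_bij_betw[OF bij_betw_reduced_fracs, of Z h] assms
  by (simp add: sum.Sigma case_prod_unfold)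

lemma finite_reduced_fracs:
  assumes "finite Z" "\<And>q. q \<in> Z \<Longrightarrow> q > 0"
  shows "finite (reduced_fracs Z)"
  using bij_betw_finite[OF bij_betw_reduced_fracs, of Z] assms by simp

lemma reduced_fracsE:
  assumes "\<theta> \<in> reduced_fracs Z"
  obtains q a where "q \<in> Z" "\<theta> = real a / real q" "a \<in> residues_coprime q"
  using assms by (auto simp: reduced_fracs_def residues_coprime_def)

text \<open>A modulus above 1 excludes \<open>a = q\<close>, so the fraction is strictly between 0
  and 1. Its not being an integer is what gives each block mean zero.\<close>

lemma reduced_frac_props:
  assumes "\<theta> = real a / real q" "a \<in> residues_coprime q" "q > 1"
  shows "0 < \<theta>" "\<theta> < 1" "\<theta> \<notin> \<int>" "\<theta> * real q \<in> \<int>"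
proof -
  have a: "1 \<le> a" "a \<le> q" "coprime a q" using assms by (auto simp: residues_coprime_def)
  then have "a \<noteq> q" using assms(3) by auto
  then show 1: "0 < \<theta>" "\<theta> < 1" using a assms by auto
  show "\<theta> \<notin> \<int>"
  proof
    assume "\<theta> \<in> \<int>"
    then obtain k where "\<theta> = of_int k" by (auto elim: Ints_cases)
    then show False using 1 by simp
  qed
  show "\<theta> * real q \<in> \<int>" using assms by simp
qed

text \<open>Nonemptiness yields \<open>qZ \<ge> 2\<close>. For empty \<open>Z\<close> the number
  \<open>qZ\<close> could be any real; that case is settled directly in the theorem.\<close>

locale coprime_moduli =
  fixes Z :: "nat set" and qZ :: real
  assumes finite_Z: "finite Z" and coprime_Z: "pairwise coprime Z" and bound_Z: "real ` Z \<subseteq> {1<..qZ}"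
    and nonempty_Z: "Z \<noteq> {}"
begin

lemma gt1: "q \<in> Z \<Longrightarrow> q > 1" and le_qZ: "q \<in> Z \<Longrightarrow> real q \<le> qZ"
  using bound_Z by auto

lemma pos: "q \<in> Z \<Longrightarrow> q > 0"
  using gt1 by fastforce

lemma qZ_ge_2: "qZ \<ge> 2"
proof -
  obtain q where "q \<in> Z" using nonempty_Z by blast
  then have "q \<ge> 2" "real q \<le> qZ" using gt1 le_qZ by fastforce+
  then show ?thesis by linarith
qed

lemma finite_fracs: "finite (reduced_fracs Z)"
  using finite_reduced_fracs finite_Z pos by blast

lemma fracs_denominator:
  assumes "\<theta> \<in> reduced_fracs Z"
  obtains q where "q \<in> Z" "\<theta> * real q \<in> \<int>" "0 < \<theta>" "\<theta> < 1" "\<theta> \<notin> \<int>"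
  using assms reduced_frac_props gt1 by (metis reduced_fracsE)

text \<open>At most \<open>qZ\<close> moduli with at most \<open>qZ\<close> numerators each. The
  count is crude, but the permitted size of \<open>\<epsilon>\<close> leaves room for it.\<close>

lemma card_fracs: "real (card (reduced_fracs Z)) \<le> qZ\<^sup>2"
proof -
  have "real (card (reduced_fracs Z)) = (\<Sum>\<theta>\<in>reduced_fracs Z. 1)" by simp
  also have "\<dots> = (\<Sum>q\<in>Z. \<Sum>a\<in>residues_coprime q. 1)"
    using sum_reduced_fracs[OF finite_Z pos, of "\<lambda>_. 1 :: real"] by simp
  also have "\<dots> \<le> (\<Sum>q\<in>Z. qZ)"
  proof (rule sum_mono)
    fix q assume q: "q \<in> Z"
    have "card (residues_coprime q) \<le> card {1..q}" by (rule card_mono) (auto simp: residues_coprime_def)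
    then show "(\<Sum>a\<in>residues_coprime q. 1) \<le> qZ" using le_qZ[OF q] by simp
  qed
  also have "\<dots> = real (card Z) * qZ" by simp
  also have "real (card Z) \<le> qZ"
  proof -
    have "Z \<subseteq> {1..nat \<lfloor>qZ\<rfloor>}" using pos le_qZ by (auto simp: le_nat_floor Suc_le_eq)
    then have "card Z \<le> nat \<lfloor>qZ\<rfloor>" using card_mono[of "{1..nat \<lfloor>qZ\<rfloor>}" Z] by simp
    then show ?thesis using qZ_ge_2 by linarith
  qed
  finally show ?thesis using qZ_ge_2 by (simp add: power2_eq_square mult_right_mono)
qed

lemma fracs_separated:
  assumes "\<theta> \<in> reduced_fracs Z" "\<theta>' \<in> reduced_fracs Z" "\<theta> \<noteq> \<theta>'"
  shows "1 / qZ\<^sup>2 \<le> \<bar>\<theta> - \<theta>' - of_int l\<bar>"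
proof -
  obtain q where q: "q \<in> Z" "\<theta> * real q \<in> \<int>" "0 < \<theta>" "\<theta> < 1" using assms(1) by (rule fracs_denominator)
  obtain q' where q': "q' \<in> Z" "\<theta>' * real q' \<in> \<int>" "0 < \<theta>'" "\<theta>' < 1" using assms(2) by (rule fracs_denominator)
  have "(\<theta> * real q) * real q' - (\<theta>' * real q') * real q \<in> \<int>"
    by (rule Ints_diff[OF Ints_mult[OF q(2) Ints_of_nat] Ints_mult[OF q'(2) Ints_of_nat]])
  then have int: "(\<theta> - \<theta>') * real (q * q') \<in> \<int>" by (simp add: algebra_simps)
  have nint: "\<theta> - \<theta>' \<notin> \<int>"
  proof
    assume "\<theta> - \<theta>' \<in> \<int>"
    then obtain k where k: "\<theta> - \<theta>' = of_int k" by (auto elim: Ints_cases)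
    then have "-1 < real_of_int k" "real_of_int k < 1" using q q' by linarith+
    then have "k = 0" by linarith
    then show False using k assms(3) by simp
  qed
  have p: "q * q' > 0" using q q' pos by simp
  have "real (q * q') \<le> qZ\<^sup>2" using le_qZ[OF q(1)] le_qZ[OF q'(1)] by (simp add: power2_eq_square mult_mono)
  then have "1 / qZ\<^sup>2 \<le> 1 / real (q * q')" using p qZ_ge_2 by (intro divide_left_mono) auto
  also have "\<dots> \<le> \<bar>\<theta> - \<theta>' - of_int l\<bar>" by (rule one_div_le_dist_int[OF int nint p])
  finally show ?thesis .
qed

text \<open>A sum of \<open>r\<close> fractions has a denominator at most \<open>qZ ^ r\<close>, so
  a difference of two such sums has one at most \<open>qZ ^ (2 * r)\<close>. This is the origin of
  the threshold for \<open>\<epsilon>\<close>.\<close>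

lemma sums_of_fracs_separated:
  assumes "\<tau> \<in> {..<r} \<rightarrow> reduced_fracs Z" "\<sigma> \<in> {..<r} \<rightarrow> reduced_fracs Z"
    and "(\<Sum>i<r. \<tau> i) - (\<Sum>i<r. \<sigma> i) \<notin> \<int>"
  shows "1 / qZ ^ (2 * r) \<le> \<bar>(\<Sum>i<r. \<tau> i) - (\<Sum>i<r. \<sigma> i) - of_int l\<bar>"
proof -
  have "\<exists>n>0. real n \<le> qZ ^ r \<and> (\<Sum>i<r. \<tau> i) * real n \<in> \<int>" if "\<tau> \<in> {..<r} \<rightarrow> reduced_fracs Z" for \<tau> r
    using that
  proof (induction r)
    case 0
    show ?case by (intro exI[of _ 1]) auto
  next
    case (Suc r)
    then have "\<tau> \<in> {..<r} \<rightarrow> reduced_fracs Z" by auto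
    then obtain n where n: "n > 0" "real n \<le> qZ ^ r" "(\<Sum>i<r. \<tau> i) * real n \<in> \<int>" using Suc.IH by blast
    have "\<tau> r \<in> reduced_fracs Z" using Suc.prems by auto
    then obtain q where q: "q \<in> Z" "\<tau> r * real q \<in> \<int>" by (rule fracs_denominator)
    have "((\<Sum>i<r. \<tau> i) * real n) * real q + (\<tau> r * real q) * real n \<in> \<int>"
      by (rule Ints_add[OF Ints_mult[OF n(3) Ints_of_nat] Ints_mult[OF q(2) Ints_of_nat]])
    then have "(\<Sum>i<Suc r. \<tau> i) * real (q * n) \<in> \<int>" by (simp add: algebra_simps)
    moreover have "real (q * n) \<le> qZ ^ Suc r"
      using n(2) le_qZ[OF q(1)] qZ_ge_2 by (simp add: mult_mono)
    moreover have "q * n > 0" using n q pos by simp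
    ultimately show ?case by blast
  qed
  from this[OF assms(1)] this[OF assms(2)] obtain n n' where n: "n > 0" "real n \<le> qZ ^ r" "(\<Sum>i<r. \<tau> i) * real n \<in> \<int>"
    and n': "n' > 0" "real n' \<le> qZ ^ r" "(\<Sum>i<r. \<sigma> i) * real n' \<in> \<int>" by blast
  have "((\<Sum>i<r. \<tau> i) * real n) * real n' - ((\<Sum>i<r. \<sigma> i) * real n') * real n \<in> \<int>"
    by (rule Ints_diff[OF Ints_mult[OF n(3) Ints_of_nat] Ints_mult[OF n'(3) Ints_of_nat]])
  then have int: "((\<Sum>i<r. \<tau> i) - (\<Sum>i<r. \<sigma> i)) * real (n * n') \<in> \<int>" by (simp add: algebra_simps)
  have p: "n * n' > 0" using n n' by simp
  have "real (n * n') \<le> qZ ^ (2 * r)"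
    using n n' qZ_ge_2 by (simp add: mult_2 power_add mult_mono)
  then have "1 / qZ ^ (2 * r) \<le> 1 / real (n * n')" using p qZ_ge_2 by (intro divide_left_mono) auto
  also have "\<dots> \<le> \<bar>(\<Sum>i<r. \<tau> i) - (\<Sum>i<r. \<sigma> i) - of_int l\<bar>" by (rule one_div_le_dist_int[OF int assms(3) p])
  finally show ?thesis .
qed

lemma omega_le_Omega: "q \<in> Z \<Longrightarrow> omega q \<le> Omega Z"
  unfolding Omega_def using finite_Z by (intro Max_ge) auto

end

section \<open>Moments of the arithmetic blocks at a fixed point of the line\<close>

lemma parseval_residues:
  assumes q: "q > 0"
  shows "avg q (\<lambda>u. (norm (\<Sum>a\<in>residues_coprime q. ex (real a / real q * real u) * c a))\<^sup>2)
    = (\<Sum>a\<in>residues_coprime q. (norm (c a))\<^sup>2)"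
proof -
  let ?R = "residues_coprime q"
  have orth: "(\<Sum>u<q. ex ((real a / real q - real b / real q) * real u)) = (if a = b then of_nat q else 0)"
    if "a \<in> ?R" "b \<in> ?R" for a b
  proof (cases "a = b")
    case False
    have ab: "1 \<le> a" "a \<le> q" "1 \<le> b" "b \<le> q" using that by (auto simp: residues_coprime_def)
    have eq: "real a / real q - real b / real q = (real a - real b) / real q" by (simp add: diff_divide_distrib)
    have n1: "(real a - real b) / real q \<notin> \<int>"
    proof
      assume "(real a - real b) / real q \<in> \<int>"
      then obtain k where "(real a - real b) / real q = of_int k" by (auto elim: Ints_cases)
      then have "real_of_int (int a - int b) = real_of_int (k * int q)" using q by (simp add: field_simps)
      then have k: "int a - int b = k * int q" by (simp only: of_int_eq_iff)
      have "\<bar>int a - int b\<bar> < int q" using ab by linarith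
      then have "\<bar>k\<bar> * int q < 1 * int q" using k by (simp add: abs_mult)
      then have "\<bar>k\<bar> < 1" using q mult_less_cancel_right_pos[of "int q" "\<bar>k\<bar>" 1] by linarith
      then show False using k False by simp
    qed
    have n2: "(real a - real b) / real q * real q \<in> \<int>" using q by simp
    show ?thesis unfolding eq using sum_ex_roots[OF n2 n1] False by (simp only: if_False)
  qed simp
  have "complex_of_real (\<Sum>u<q. (norm (\<Sum>a\<in>?R. ex (real a / real q * real u) * c a))\<^sup>2)
    = (\<Sum>u<q. \<Sum>a\<in>?R. \<Sum>b\<in>?R. c a * cnj (c b) * ex ((real a / real q - real b / real q) * real u))"
    unfolding of_real_sum complex_norm_square cnj_sum sum_product left_diff_distrib ex_diff complex_cnj_mult cnj_ex
    by (simp only: mult_ac)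
  also have "\<dots> = (\<Sum>a\<in>?R. \<Sum>b\<in>?R. c a * cnj (c b) * (\<Sum>u<q. ex ((real a / real q - real b / real q) * real u)))"
    unfolding sum_distrib_left by (subst sum.swap, rule sum.cong[OF refl], rule sum.swap)
  also have "\<dots> = (\<Sum>a\<in>?R. \<Sum>b\<in>?R. if a = b then c a * cnj (c b) * of_nat q else 0)"
    by (intro sum.cong refl) (simp add: orth)
  also have "\<dots> = (\<Sum>a\<in>?R. c a * cnj (c a) * of_nat q)"
    by (intro sum.cong refl) (simp add: sum.delta')
  also have "\<dots> = complex_of_real (real q * (\<Sum>a\<in>?R. (norm (c a))\<^sup>2))"
    by (simp only: of_real_mult of_real_sum complex_norm_square sum_distrib_left of_real_of_nat_eq mult_ac)
  finally have "(\<Sum>u<q. (norm (\<Sum>a\<in>?R. ex (real a / real q * real u) * c a))\<^sup>2) = real q * (\<Sum>a\<in>?R. (norm (c a))\<^sup>2)"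
    by (simp only: of_real_eq_iff)
  then show ?thesis using q by (simp add: avg_def)
qed

text \<open>The blocks \<open>X f q\<close> are seen in two ways: as sums over fractions with
  denominator \<open>q\<close>, for which Parseval and the large sieve give the L2 bound summed over
  all \<open>q\<close>, and as convolutions with weighted Ramanujan sums, for which absolute
  summation gives the L-infinity bound. The first bound also handles the variance in Rosenthal's
  inequality.\<close>

lemma avg_fracs_moment_le:
  assumes r: "r \<ge> 2"
  shows "\<exists>C\<ge>0. \<forall>Z qZ \<epsilon> (J :: int set) f y. coprime_moduli Z qZ \<longrightarrow> 0 < \<epsilon> \<longrightarrow> \<epsilon> * qZ ^ 4 \<le> 1 \<longrightarrow> finite J \<longrightarrow>
     avg (\<Prod>Z) (\<lambda>u. norm (\<Sum>\<theta>\<in>reduced_fracs Z. ex (\<theta> * real u) *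
         (\<Sum>j\<in>J. of_real (\<epsilon> * vker (y - \<epsilon> * of_int j)) * f j * ex (- (\<theta> * of_int j)))) ^ (2 * r))
       \<le> C * (2 ^ Omega Z) ^ (2 * r - 2) * (\<Sum>j\<in>J. weight \<epsilon> y j * norm (f j) ^ (2 * r))"
proof -
  obtain C0 where C0: "C0 \<ge> 0" and ros: "\<And>Z X. indep_zero_mean Z X \<Longrightarrow>
     avg (\<Prod>Z) (\<lambda>u. norm (\<Sum>q\<in>Z. X q u) ^ (2 * r))
       \<le> C0 * ((\<Sum>q\<in>Z. avg q (\<lambda>u. norm (X q u) ^ 2)) ^ r + (\<Sum>q\<in>Z. avg q (\<lambda>u. norm (X q u) ^ (2 * r))))"
    using rosenthal_inequality[of r] r by auto
  define A where "A = 16 * (3 * pi + (2 + 6 * pi) * 1)"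
  have A: "A \<ge> 0" by (simp add: A_def)
  \<comment> \<open>\<open>C0\<close> is Rosenthal's constant. The first summand is the variance
    term after Jensen with mass \<open>3 * pi\<close>, the second the interpolated moments, where
    \<open>24 * pi\<close> is what \<open>2 * D\<close> leaves after removal of
    \<open>2 ^ Omega Z\<close>.\<close>
  define C where "C = C0 * (A ^ r * (1 + 3 * pi) ^ r + 4 * real (2 * r) * A * (24 * pi) ^ (2 * r - 2))"
  show ?thesis
  proof (intro exI[of _ C] conjI allI impI)
    fix Z :: "nat set" and qZ \<epsilon> y :: real and J :: "int set" and f :: "int \<Rightarrow> complex"
    assume "coprime_moduli Z qZ" and \<epsilon>0: "0 < \<epsilon>" and small: "\<epsilon> * qZ ^ 4 \<le> 1" and J: "finite J"
    then interpret coprime_moduli Z qZ by simp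
    have q1: "1 \<le> qZ" using qZ_ge_2 by simp
    have \<epsilon>q: "\<epsilon> * qZ \<le> 1"
    proof -
      have "\<epsilon> * qZ ^ 1 \<le> \<epsilon> * qZ ^ 4" using \<epsilon>0 q1 by (intro mult_left_mono power_increasing) auto
      then show ?thesis using small by simp
    qed
    have \<epsilon>: "0 < \<epsilon>" "\<epsilon> \<le> 1"
    proof -
      have "\<epsilon> * 1 \<le> \<epsilon> * qZ" using \<epsilon>0 q1 by (intro mult_left_mono) auto
      then show "\<epsilon> \<le> 1" using \<epsilon>q by simp
    qed (rule \<epsilon>0)
    define v where "v j = \<epsilon> * vker (y - \<epsilon> * of_int j)" for j :: int
    have v: "\<bar>v j\<bar> \<le> 4 * weight \<epsilon> y j" for j
      using mult_left_mono[OF abs_vker_le[of "y - \<epsilon> * of_int j"], of \<epsilon>] \<epsilon>0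
      by (simp add: v_def weight_def abs_mult)
    have W: "weight \<epsilon> y j \<ge> 0" for j using \<epsilon>0 by (rule weight_nonneg)
    define g where "g f \<theta> = (\<Sum>j\<in>J. of_real (v j) * f j * ex (- (\<theta> * of_int j)))" for f \<theta>
    define X where "X f q u = (\<Sum>a\<in>residues_coprime q. ex (real a / real q * real u) * g f (real a / real q))" for f q u
    define F where "F = (\<Sum>j\<in>J. weight \<epsilon> y j * norm (f j) ^ (2 * r))"
    have F: "F \<ge> 0" using W by (auto simp: F_def intro!: sum_nonneg)
    have sumX: "(\<Sum>q\<in>Z. X f q u) = (\<Sum>\<theta>\<in>reduced_fracs Z. ex (\<theta> * real u) * g f \<theta>)" for f u
      unfolding X_def by (subst sum_reduced_fracs[OF finite_Z pos]) auto
    have ind: "indep_zero_mean Z (X f)"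
      unfolding indep_zero_mean_def
    proof (intro conjI ballI allI finite_Z coprime_Z)
      fix q u assume q: "q \<in> Z"
      show "q > 0" using pos[OF q] .
      show "X f q u = X f q (u mod q)"
        unfolding X_def
      proof (intro sum.cong refl)
        fix a
        have "real u = real (u mod q) + real q * real (u div q)"
          by (metis mod_mult_div_eq of_nat_add of_nat_mult)
        then have "real a / real q * real u = real a / real q * real (u mod q) + real (a * (u div q))"
          using pos[OF q] by (simp add: distrib_left)
        then have "ex (real a / real q * real u) = ex (real a / real q * real (u mod q))"
          by (simp only: ex_add) simp
        then show "ex (real a / real q * real u) * g f (real a / real q) = ex (real a / real q * real (u mod q)) * g f (real a / real q)"
          by simp
      qed
      show "(\<Sum>u<q. X f q u) = 0"
      proof -
        have "(\<Sum>u<q. X f q u) = (\<Sum>a\<in>residues_coprime q. (\<Sum>u<q. ex (real a / real q * real u)) * g f (real a / real q))"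
          unfolding X_def sum_distrib_right by (rule sum.swap)
        also have "\<dots> = 0"
        proof (intro sum.neutral ballI)
          fix a assume a: "a \<in> residues_coprime q"
          note p = reduced_frac_props[OF refl a gt1[OF q]]
          show "(\<Sum>u<q. ex (real a / real q * real u)) * g f (real a / real q) = 0"
            unfolding sum_ex_roots[OF p(4) p(3)] by simp
        qed
        finally show ?thesis .
      qed
    qed
    have L2: "(\<Sum>q\<in>Z. avg q (\<lambda>u. norm (X f q u) ^ 2)) \<le> A * (\<Sum>j\<in>J. weight \<epsilon> y j * (norm (f j))\<^sup>2)" for f
    proof -
      have "(\<Sum>q\<in>Z. avg q (\<lambda>u. norm (X f q u) ^ 2)) = (\<Sum>\<theta>\<in>reduced_fracs Z. (norm (g f \<theta>))\<^sup>2)"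
      proof -
        have e: "(\<Sum>\<theta>\<in>reduced_fracs Z. (norm (g f \<theta>))\<^sup>2) = (\<Sum>q\<in>Z. \<Sum>a\<in>residues_coprime q. (norm (g f (real a / real q)))\<^sup>2)"
          by (rule sum_reduced_fracs) (auto intro: finite_Z pos)
        show ?thesis unfolding X_def e by (intro sum.cong refl parseval_residues pos)
      qed
      also have "\<dots> \<le> A * (\<Sum>j\<in>J. weight \<epsilon> y j * (norm (f j))\<^sup>2)"
        unfolding A_def g_def
      \<comment> \<open>The sieve is used with spacing \<open>1 / qZ\<^sup>2\<close> and
        \<open>K = 1\<close>; the count of fractions then calls for
        \<open>\<epsilon> * qZ ^ 4 \<le> 1\<close>.\<close>
      proof (rule large_sieve_weighted[OF \<epsilon> J finite_fracs _ fracs_separated _ _ v])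
        have "\<epsilon> * real (card (reduced_fracs Z)) \<le> \<epsilon> * qZ\<^sup>2"
          using card_fracs \<epsilon>0 by (intro mult_left_mono) auto
        also have "\<dots> \<le> 1 * (1 / qZ\<^sup>2)"
        proof -
          have "qZ ^ 4 = qZ\<^sup>2 * qZ\<^sup>2" by (simp add: power_add[symmetric])
          then show ?thesis using small q1 by (simp add: field_simps)
        qed
        finally show "\<epsilon> * real (card (reduced_fracs Z)) \<le> 1 * (1 / qZ\<^sup>2)" .
      qed (use q1 in auto)
      finally show ?thesis .
    qed
    \<comment> \<open>12 is the 4 from \<open>abs_vker_le\<close> times the 3 from the lattice
      sum.\<close>
    define D where "D = 12 * pi * 2 ^ Omega Z"
    have D: "D > 0" by (simp add: D_def)
    \<comment> \<open>Summing the phases over the numerators first turns the block into a kernel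
      depending on \<open>u - j\<close> through a Ramanujan sum.\<close>
    define T where "T = (\<lambda>(q, u) j. of_real (v j) * ramanujan_sum q (int u - j))"
    have XT: "X f q u = (\<Sum>j\<in>J. T (q, u) j * f j)" for f q u
    proof -
      have "X f q u = (\<Sum>a\<in>residues_coprime q. \<Sum>j\<in>J. of_real (v j) * ex (real a / real q * of_int (int u - j)) * f j)"
        unfolding X_def g_def sum_distrib_left
      proof (intro sum.cong refl)
        fix a j
        have "ex (real a / real q * of_int (int u - j)) = ex (real a / real q * real u) * ex (- (real a / real q * of_int j))"
          unfolding ex_add[symmetric] by (simp add: right_diff_distrib)
        then show "ex (real a / real q * real u) * (of_real (v j) * f j * ex (- (real a / real q * of_int j)))
          = of_real (v j) * ex (real a / real q * of_int (int u - j)) * f j"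
          by (simp only: mult_ac)
      qed
      also have "\<dots> = (\<Sum>j\<in>J. \<Sum>a\<in>residues_coprime q. of_real (v j) * ex (real a / real q * of_int (int u - j)) * f j)"
        by (rule sum.swap)
      also have "\<dots> = (\<Sum>j\<in>J. T (q, u) j * f j)"
        by (simp add: T_def ramanujan_sum_def sum_distrib_left sum_distrib_right)
      finally show ?thesis .
    qed
    have Linf: "norm (\<Sum>j\<in>J. T p j * f j) \<le> D * c"
      if pY: "p \<in> Sigma Z (\<lambda>q. {..<q})" and "\<And>j. j \<in> J \<Longrightarrow> norm (f j) \<le> c" "c \<ge> 0" for f c p
    proof -
      obtain q u where p: "p = (q, u)" "q \<in> Z" using pY by auto
      have "norm (\<Sum>j\<in>J. T p j * f j) \<le> (\<Sum>j\<in>J. (4 * weight \<epsilon> y j * norm (ramanujan_sum q (int u - j))) * c)"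
        using v that(2) W by (intro sum_norm_le) (auto simp: T_def p norm_mult intro!: mult_mono)
      also have "\<dots> = 4 * (\<Sum>j\<in>J. weight \<epsilon> y j * norm (ramanujan_sum q (int u - j))) * c"
        by (simp add: sum_distrib_left sum_distrib_right mult_ac)
      also have "\<dots> \<le> 4 * (3 * pi * 2 ^ omega q) * c"
      proof (intro mult_right_mono mult_left_mono sum_weight_ramanujan_le \<epsilon>0 J that)
        have "\<epsilon> * real q \<le> \<epsilon> * qZ" using le_qZ[OF p(2)] \<epsilon>0 by (intro mult_left_mono) auto
        then show "\<epsilon> * real q \<le> 1" using \<epsilon>q by linarith
      qed (use pos[OF p(2)] in auto)
      also have "\<dots> \<le> 4 * (3 * pi * 2 ^ Omega Z) * c"
        using omega_le_Omega[OF p(2)] that(3) by (intro mult_right_mono mult_left_mono power_increasing) auto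
      finally show ?thesis by (simp add: D_def)
    qed
    \<comment> \<open>The pairs \<open>(q, u)\<close> with mass \<open>1 / q\<close> form the
      measure space of the interpolation; uniting all moduli in it keeps the L2 constant
      \<open>A\<close>, independent of their number.\<close>
    have avgY: "(\<Sum>p\<in>Sigma Z (\<lambda>q. {..<q}). 1 / real (fst p) * h (X f (fst p) (snd p))) = (\<Sum>q\<in>Z. avg q (\<lambda>u. h (X f q u)))" for h f
    proof -
      have "(\<Sum>p\<in>Sigma Z (\<lambda>q. {..<q}). 1 / real (fst p) * h (X f (fst p) (snd p))) = (\<Sum>q\<in>Z. \<Sum>u<q. 1 / real q * h (X f q u))"
        using finite_Z by (subst sum.Sigma) (auto simp: case_prod_unfold)
      then show ?thesis by (simp add: avg_def sum_distrib_left[symmetric] sum_divide_distrib)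
    qed
    \<comment> \<open>The interpolation is stated for exponents \<open>2 * k + 4\<close>, here with
      \<open>k = r - 2\<close>; for \<open>k\<close> a natural number this needs
      \<open>r \<ge> 2\<close>.\<close>
    have "2 * (r - 2) + 4 = 2 * r" "2 * (r - 2) + 2 = 2 * r - 2" using r by auto
    note k = this
    have Linf': "(\<Sum>p\<in>Sigma Z (\<lambda>q. {..<q}). 1 / real (fst p) * norm (\<Sum>j\<in>J. T p j * f j) ^ (2 * (r - 2) + 4))
      \<le> 4 * real (2 * (r - 2) + 4) * A * (2 * D) ^ (2 * (r - 2) + 2) * (\<Sum>j\<in>J. weight \<epsilon> y j * norm (f j) ^ (2 * (r - 2) + 4))"
    proof (rule marcinkiewicz_finite[OF J _ _ A D _ Linf])
      fix f
      show "(\<Sum>p\<in>Sigma Z (\<lambda>q. {..<q}). 1 / real (fst p) * (norm (\<Sum>j\<in>J. T p j * f j))\<^sup>2) \<le> A * (\<Sum>j\<in>J. weight \<epsilon> y j * (norm (f j))\<^sup>2)"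
        using L2[of f] avgY[of "\<lambda>x. (norm x)\<^sup>2" f] by (simp add: XT)
    qed (use W in auto)
    have Lr: "(\<Sum>q\<in>Z. avg q (\<lambda>u. norm (X f q u) ^ (2 * r))) \<le> 4 * real (2 * r) * A * (2 * D) ^ (2 * r - 2) * F"
      using Linf' avgY[of "\<lambda>x. norm x ^ (2 * r)" f] unfolding k F_def by (simp add: XT)
    have "(\<Sum>q\<in>Z. avg q (\<lambda>u. norm (X f q u) ^ 2)) ^ r \<le> (A * (\<Sum>j\<in>J. weight \<epsilon> y j * (norm (f j))\<^sup>2)) ^ r"
      by (intro power_mono L2 sum_nonneg avg_nonneg) auto
    also have "\<dots> = A ^ r * (\<Sum>j\<in>J. weight \<epsilon> y j * (norm (f j))\<^sup>2) ^ r" by (rule power_mult_distrib)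
    also have "\<dots> \<le> A ^ r * ((1 + 3 * pi) ^ r * (\<Sum>j\<in>J. weight \<epsilon> y j * ((norm (f j))\<^sup>2) ^ r))"
      using r W A by (intro mult_left_mono weighted_sum_power_le sum_weight_le \<epsilon> J) auto
    finally have L2r: "(\<Sum>q\<in>Z. avg q (\<lambda>u. norm (X f q u) ^ 2)) ^ r \<le> A ^ r * (1 + 3 * pi) ^ r * F"
      by (simp add: F_def power_mult)
    let ?o = "(2 ^ Omega Z) ^ (2 * r - 2) :: real"
    have o1: "?o \<ge> 1" by (intro one_le_power) simp
    have "avg (\<Prod>Z) (\<lambda>u. norm (\<Sum>q\<in>Z. X f q u) ^ (2 * r))
      \<le> C0 * ((\<Sum>q\<in>Z. avg q (\<lambda>u. norm (X f q u) ^ 2)) ^ r + (\<Sum>q\<in>Z. avg q (\<lambda>u. norm (X f q u) ^ (2 * r))))"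
      by (rule ros[OF ind])
    also have "\<dots> \<le> C0 * (A ^ r * (1 + 3 * pi) ^ r * F * ?o + 4 * real (2 * r) * A * (2 * D) ^ (2 * r - 2) * F)"
    proof (intro mult_left_mono add_mono C0 Lr)
      have "A ^ r * (1 + 3 * pi) ^ r * F * 1 \<le> A ^ r * (1 + 3 * pi) ^ r * F * ?o"
        using o1 A F by (intro mult_left_mono) auto
      then show "(\<Sum>q\<in>Z. avg q (\<lambda>u. norm (X f q u) ^ 2)) ^ r \<le> A ^ r * (1 + 3 * pi) ^ r * F * ?o"
        using L2r by linarith
    qed
    also have "(2 * D) ^ (2 * r - 2) = (24 * pi) ^ (2 * r - 2) * ?o"
    proof -
      have "2 * D = (24 * pi) * 2 ^ Omega Z" by (simp add: D_def)
      then show ?thesis by (simp only: power_mult_distrib)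
    qed
    also have "C0 * (A ^ r * (1 + 3 * pi) ^ r * F * ?o + 4 * real (2 * r) * A * ((24 * pi) ^ (2 * r - 2) * ?o) * F) = C * ?o * F"
      unfolding C_def by (simp only: distrib_left distrib_right mult_ac)
    finally show "avg (\<Prod>Z) (\<lambda>u. norm (\<Sum>\<theta>\<in>reduced_fracs Z. ex (\<theta> * real u) *
         (\<Sum>j\<in>J. of_real (\<epsilon> * vker (y - \<epsilon> * of_int j)) * f j * ex (- (\<theta> * of_int j)))) ^ (2 * r))
       \<le> C * (2 ^ Omega Z) ^ (2 * r - 2) * (\<Sum>j\<in>J. weight \<epsilon> y j * norm (f j) ^ (2 * r))"
      by (simp only: sumX g_def v_def F_def)
  qed (use C0 A in \<open>simp add: C_def\<close>)
qed

section \<open>The operators on the circle\<close>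

definition circle :: "real measure" where
  "circle = restrict_space lebesgue {-1/2<..1/2}"

lemma LINT_circle: "(LINT \<xi>:{-1/2<..1/2}|lebesgue. f \<xi>) = (\<integral>\<xi>. f \<xi> \<partial>circle)"
  for f :: "real \<Rightarrow> complex"
  by (simp add: circle_def set_lebesgue_integral_def integral_restrict_space)

lemma space_circle: "space circle = {-1/2<..1/2}"
  by (simp add: circle_def space_restrict_space)

interpretation circle: finite_measure circle
proof
  have "emeasure circle (space circle) = emeasure lebesgue {-1/2<..1/2::real}"
    unfolding space_circle unfolding circle_def by (subst emeasure_restrict_space) auto
  then show "emeasure circle (space circle) \<noteq> \<infinity>" by (simp add: emeasure_completion)
qed

lemma borel_measurable_circle:
  "f \<in> borel_measurable lebesgue \<Longrightarrow> f \<in> borel_measurable circle"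
  unfolding circle_def by (rule measurable_restrict_space1)

lemma borel_measurable_ex_circle [measurable]:
  "(\<lambda>\<xi>. ex (x * \<xi>)) \<in> borel_measurable circle" "(\<lambda>\<xi>. ex (- (x * \<xi>))) \<in> borel_measurable circle"
proof -
  have "(\<lambda>\<xi>. ex (- (x * \<xi>))) \<in> borel_measurable lebesgue" by (rule measurable_completion) simp
  then show "(\<lambda>\<xi>. ex (- (x * \<xi>))) \<in> borel_measurable circle" by (rule borel_measurable_circle)
  show "(\<lambda>\<xi>. ex (x * \<xi>)) \<in> borel_measurable circle"
    by (rule borel_measurable_circle[OF borel_measurable_ex_mult_lebesgue(1)])
qed

lemma integrable_circle:
  fixes g :: "real \<Rightarrow> 'b :: {banach, second_countable_topology}"
  assumes "g \<in> borel_measurable circle" "\<And>\<xi>. norm (g \<xi>) \<le> b"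
  shows "integrable circle g"
  using assms by (intro circle.integrable_const_bound[where B = b]) auto

lemma integral_circle_ex: "(\<integral>\<xi>. ex (of_int k * \<xi>) \<partial>circle) = (if k = 0 then 1 else 0)"
proof -
  have si: "set_integrable lborel {-1/2<..1/2} (\<lambda>\<xi>. ex (of_int k * \<xi>))"
    unfolding set_integrable_def
  proof (rule Bochner_Integration.integrable_bound)
    show "integrable lborel (indicator {-1/2<..1/2::real} :: real \<Rightarrow> real)"
      by (rule integrable_real_indicator) auto
  qed (auto simp: indicator_def)
  have hi: "((\<lambda>\<xi>. ex (of_int k * \<xi>)) has_integral (if k = 0 then 1 else 0)) {-1/2..1/2}"
  proof (cases "k = 0")
    case True
    then show ?thesis using has_integral_const_real[of "1::complex" "-1/2" "1/2"] by simp
  next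
    case False
    define F where "F \<xi> = ex (of_int k * \<xi>) / (2 * pi * \<i> * of_int k)" for \<xi>
    have "((\<lambda>\<xi>. ex (of_int k * \<xi>)) has_integral (F (1/2) - F (-1/2))) {-1/2..1/2}"
    proof (rule fundamental_theorem_of_calculus)
      fix \<xi> :: real assume "\<xi> \<in> {-1/2..1/2}"
      have "((\<lambda>\<xi>. exp (\<i> * complex_of_real (2 * pi * (of_int k * \<xi>)))) has_vector_derivative
          exp (\<i> * complex_of_real (2 * pi * (of_int k * \<xi>))) * (2 * pi * \<i> * of_int k)) (at \<xi> within {-1/2..1/2})"
        by (auto intro!: derivative_eq_intros has_vector_derivative_real_field)
      then have "((\<lambda>\<xi>. ex (of_int k * \<xi>)) has_vector_derivative ex (of_int k * \<xi>) * (2 * pi * \<i> * of_int k)) (at \<xi> within {-1/2..1/2})"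
        by (simp add: ex_def cis_conv_exp)
      then have "((\<lambda>\<xi>. ex (of_int k * \<xi>) / (2 * pi * \<i> * of_int k)) has_vector_derivative
          ex (of_int k * \<xi>) * (2 * pi * \<i> * of_int k) / (2 * pi * \<i> * of_int k)) (at \<xi> within {-1/2..1/2})"
        by (rule has_vector_derivative_divide)
      then show "(F has_vector_derivative ex (of_int k * \<xi>)) (at \<xi> within {-1/2..1/2})"
        using False by (simp add: F_def[abs_def])
    qed auto
    moreover have "ex (of_int k * (1/2)) = ex (of_int k * (-1/2))"
    proof -
      have "ex (of_int k * (1/2)) = ex (of_int k * (-1/2) + of_int k)" by (rule arg_cong[where f = ex]) simp
      then show ?thesis unfolding ex_add by simp
    qed
    ultimately show ?thesis using False by (simp add: F_def)
  qed
  have "((\<lambda>\<xi>. ex (of_int k * \<xi>)) has_integral (if k = 0 then 1 else 0)) {-1/2<..1/2}"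
  proof (rule has_integral_spike_set_eq[THEN iffD1, OF _ _ hi])
    have "negligible {-1/2::real}" by simp
    then show "negligible {x \<in> {-1/2..1/2} - {-1/2<..1/2::real}. ex (of_int k * x) \<noteq> 0}"
      by (rule negligible_subset) auto
    show "negligible {x \<in> {-1/2<..1/2} - {-1/2..1/2::real}. ex (of_int k * x) \<noteq> 0}"
      by (rule negligible_subset[OF negligible_empty]) auto
  qed
  then have "(LINT \<xi>:{-1/2<..1/2}|lborel. ex (of_int k * \<xi>)) = (if k = 0 then 1 else 0)"
    using set_borel_integral_eq_integral(2)[OF si] by (simp add: integral_unique)
  moreover have "(LINT \<xi>:{-1/2<..1/2}|lebesgue. ex (of_int k * \<xi>)) = (LINT \<xi>:{-1/2<..1/2}|lborel. ex (of_int k * \<xi>))"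
    unfolding set_lebesgue_integral_def by (rule integral_completion) measurable
  ultimately show ?thesis by (simp only: LINT_circle)
qed

lemma norm_trig_poly_le: "norm (\<Sum>j\<in>J. f j * ex (g j)) \<le> (\<Sum>j\<in>J. norm (f j))"
  by (intro sum_norm_le) (simp add: norm_mult)

lemma parseval_trig_poly:
  assumes J: "finite J"
  shows "(\<integral>\<xi>. (norm (\<Sum>j\<in>J. f j * ex (- (of_int j * \<xi>))))\<^sup>2 \<partial>circle) = (\<Sum>j\<in>J. (norm (f j))\<^sup>2)"
proof -
  have ii: "integrable circle (\<lambda>\<xi>. c * ex (of_int k * \<xi>))" for c :: complex and k :: int
    by (rule integrable_circle[where b = "norm c"]) (auto simp: norm_mult)
  have eq: "complex_of_real ((norm (\<Sum>j\<in>J. f j * ex (- (of_int j * \<xi>))))\<^sup>2) = (\<Sum>i\<in>J. \<Sum>j\<in>J. f i * cnj (f j) * ex (of_int (j - i) * \<xi>))" for \<xi>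
    unfolding complex_norm_square cnj_sum sum_product
  proof (intro sum.cong refl)
    fix i j
    have "ex (of_int (j - i) * \<xi>) = ex (- (of_int i * \<xi>)) * ex (of_int j * \<xi>)"
      unfolding ex_add[symmetric] by (simp add: left_diff_distrib)
    then show "f i * ex (- (of_int i * \<xi>)) * cnj (f j * ex (- (of_int j * \<xi>))) = f i * cnj (f j) * ex (of_int (j - i) * \<xi>)"
      by (simp add: mult_ac)
  qed
  have "complex_of_real (\<integral>\<xi>. (norm (\<Sum>j\<in>J. f j * ex (- (of_int j * \<xi>))))\<^sup>2 \<partial>circle)
    = (\<integral>\<xi>. complex_of_real ((norm (\<Sum>j\<in>J. f j * ex (- (of_int j * \<xi>))))\<^sup>2) \<partial>circle)"
    by (rule integral_complex_of_real[symmetric])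
  also have "\<dots> = (\<Sum>i\<in>J. \<Sum>j\<in>J. f i * cnj (f j) * (\<integral>\<xi>. ex (of_int (j - i) * \<xi>) \<partial>circle))"
  proof -
    let ?g = "\<lambda>i j \<xi>. f i * cnj (f j) * ex (of_int (j - i) * \<xi>)"
    have "(\<integral>\<xi>. (\<Sum>i\<in>J. \<Sum>j\<in>J. ?g i j \<xi>) \<partial>circle) = (\<Sum>i\<in>J. (\<integral>\<xi>. (\<Sum>j\<in>J. ?g i j \<xi>) \<partial>circle))"
      by (intro Bochner_Integration.integral_sum Bochner_Integration.integrable_sum ii)
    also have "\<dots> = (\<Sum>i\<in>J. \<Sum>j\<in>J. (\<integral>\<xi>. ?g i j \<xi> \<partial>circle))"
      by (intro sum.cong refl Bochner_Integration.integral_sum ii)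
    finally show ?thesis unfolding eq by (simp only: integral_mult_right_zero)
  qed
  also have "\<dots> = (\<Sum>i\<in>J. \<Sum>j\<in>J. if i = j then f i * cnj (f j) else 0)"
    by (intro sum.cong refl) (simp add: integral_circle_ex del: of_int_diff)
  also have "\<dots> = complex_of_real (\<Sum>j\<in>J. (norm (f j))\<^sup>2)"
    using J by (simp add: sum.delta' complex_norm_square del: of_real_power)
  finally show ?thesis by (simp only: of_real_eq_iff)
qed

text \<open>The integral of the squared distance from \<open>g\<close> to the trigonometric
  polynomial \<open>P\<close> built from its coefficients is nonnegative; the cross term and the
  square of \<open>P\<close> both equal the sum on the left.\<close>

lemma bessel_circle:
  assumes gm [measurable]: "g \<in> borel_measurable circle" and gb: "\<And>\<xi>. norm (g \<xi>) \<le> b" and A: "finite A"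
  shows "(\<Sum>n\<in>A. (norm (\<integral>\<xi>. g \<xi> * ex (of_int n * \<xi>) \<partial>circle))\<^sup>2) \<le> (\<integral>\<xi>. (norm (g \<xi>))\<^sup>2 \<partial>circle)"
proof -
  define c where "c n = (\<integral>\<xi>. g \<xi> * ex (of_int n * \<xi>) \<partial>circle)" for n :: int
  define P where "P \<xi> = (\<Sum>n\<in>A. c n * ex (- (of_int n * \<xi>)))" for \<xi>
  have P_meas [measurable]: "P \<in> borel_measurable circle" unfolding P_def[abs_def] by measurable
  have "continuous_on UNIV cnj" by (intro continuous_intros)
  then have [measurable]: "(\<lambda>\<xi>. cnj (P \<xi>)) \<in> borel_measurable circle"
    by (intro measurable_compose[OF P_meas] borel_measurable_continuous_onI)
  have b0: "b \<ge> 0" using gb[of 0] norm_ge_zero[of "g 0"] by linarith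
  have Pb: "norm (P \<xi>) \<le> (\<Sum>n\<in>A. norm (c n))" for \<xi> unfolding P_def by (rule norm_trig_poly_le)
  have i1: "integrable circle (\<lambda>\<xi>. (norm (g \<xi>))\<^sup>2)"
    by (rule integrable_circle[where b = "b\<^sup>2"]) (auto intro!: power_mono gb)
  have i2: "integrable circle (\<lambda>\<xi>. (norm (P \<xi>))\<^sup>2)"
    by (rule integrable_circle[where b = "(\<Sum>n\<in>A. norm (c n))\<^sup>2"]) (auto intro!: power_mono Pb)
  have i3: "integrable circle (\<lambda>\<xi>. g \<xi> * cnj (P \<xi>))"
    by (rule integrable_circle[where b = "b * (\<Sum>n\<in>A. norm (c n))"]) (auto simp: norm_mult intro!: mult_mono gb Pb b0)
  have i4: "integrable circle (\<lambda>\<xi>. cnj (c n) * (g \<xi> * ex (of_int n * \<xi>)))" for n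
    by (rule integrable_circle[where b = "norm (c n) * b"]) (auto simp: norm_mult intro!: mult_left_mono gb)
  have "(\<integral>\<xi>. g \<xi> * cnj (P \<xi>) \<partial>circle) = (\<integral>\<xi>. (\<Sum>n\<in>A. cnj (c n) * (g \<xi> * ex (of_int n * \<xi>))) \<partial>circle)"
    by (intro Bochner_Integration.integral_cong refl) (simp add: P_def cnj_sum sum_distrib_left mult_ac)
  also have "\<dots> = (\<Sum>n\<in>A. cnj (c n) * c n)"
    using i4 by (subst Bochner_Integration.integral_sum) (auto simp: c_def)
  also have "\<dots> = complex_of_real (\<Sum>n\<in>A. (norm (c n))\<^sup>2)"
    by (simp only: of_real_sum complex_norm_square mult.commute)
  finally have cross: "Re (\<integral>\<xi>. g \<xi> * cnj (P \<xi>) \<partial>circle) = (\<Sum>n\<in>A. (norm (c n))\<^sup>2)" by simp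
  have PP: "(\<integral>\<xi>. (norm (P \<xi>))\<^sup>2 \<partial>circle) = (\<Sum>n\<in>A. (norm (c n))\<^sup>2)"
    unfolding P_def by (rule parseval_trig_poly[OF A])
  have "0 \<le> (\<integral>\<xi>. (norm (g \<xi> - P \<xi>))\<^sup>2 \<partial>circle)" by simp
  also have "\<dots> = (\<integral>\<xi>. (norm (g \<xi>))\<^sup>2 - 2 * Re (g \<xi> * cnj (P \<xi>)) + (norm (P \<xi>))\<^sup>2 \<partial>circle)"
    by (intro Bochner_Integration.integral_cong refl)
       (simp add: cmod_power2, simp add: power2_eq_square algebra_simps)
  also have "\<dots> = (\<integral>\<xi>. (norm (g \<xi>))\<^sup>2 \<partial>circle) - 2 * Re (\<integral>\<xi>. g \<xi> * cnj (P \<xi>) \<partial>circle) + (\<integral>\<xi>. (norm (P \<xi>))\<^sup>2 \<partial>circle)"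
  proof -
    have i3': "integrable circle (\<lambda>\<xi>. 2 * Re (g \<xi> * cnj (P \<xi>)))" using i3 by (intro integrable_mult_right integrable_Re)
    have "Re (\<integral>\<xi>. g \<xi> * cnj (P \<xi>) \<partial>circle) = (\<integral>\<xi>. Re (g \<xi> * cnj (P \<xi>)) \<partial>circle)"
      by (rule integral_Re[OF i3, symmetric])
    then show ?thesis
      by (simp only: Bochner_Integration.integral_add[OF Bochner_Integration.integrable_diff[OF i1 i3'] i2]
          Bochner_Integration.integral_diff[OF i1 i3'] integral_mult_right_zero)
  qed
  finally have "(\<Sum>n\<in>A. (norm (c n))\<^sup>2) \<le> (\<integral>\<xi>. (norm (g \<xi>))\<^sup>2 \<partial>circle)"
    unfolding cross PP by simp
  then show ?thesis by (simp only: c_def)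
qed

section \<open>Symbols and kernels of the operators\<close>

text \<open>On the period \<open>(-1/2, 1/2]\<close> only \<open>|l| \<le> 3\<close> contributes to the periodisation, as \<open>\<theta> \<in> [0, 1]\<close> and \<open>\<epsilon> \<le> 1/2\<close>.\<close>

definition frac_symbol :: "(real \<Rightarrow> complex) \<Rightarrow> real \<Rightarrow> real \<Rightarrow> real \<Rightarrow> complex" where
  "frac_symbol m \<epsilon> \<theta> \<xi> = (\<Sum>l\<in>{-3..3::int}. m (inverse \<epsilon> * (\<xi> - of_int l - \<theta>)))"

definition frac_kernel :: "(real \<Rightarrow> complex) \<Rightarrow> real \<Rightarrow> real \<Rightarrow> int \<Rightarrow> complex" where
  "frac_kernel m \<epsilon> \<theta> n = (\<integral>\<xi>. frac_symbol m \<epsilon> \<theta> \<xi> * ex (of_int n * \<xi>) \<partial>circle)"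

locale band_multiplier =
  fixes m :: "real \<Rightarrow> complex" and b \<epsilon> :: real
  assumes m_measurable: "m \<in> borel_measurable lebesgue"
    and m_bound: "\<And>x. norm (m x) \<le> b"
    and m_support: "\<And>x. x \<notin> {-1/2<..1/2} \<Longrightarrow> m x = 0"
    and eps: "0 < \<epsilon>" "\<epsilon> \<le> 1/2"
begin

lemma b_nonneg: "b \<ge> 0"
  using m_bound[of 0] norm_ge_zero[of "m 0"] by linarith

lemma m_integrable: "integrable lebesgue m"
  by (rule integrable_bounded_support[OF m_measurable _ m_support])
     (auto simp: bounded_iff intro!: exI[of _ b] m_bound)

lemma m_scaled_measurable [measurable]: "(\<lambda>\<xi>. m (inverse \<epsilon> * (\<xi> - c))) \<in> borel_measurable lebesgue"
proof -
  have "(\<lambda>\<xi>. (- c * inverse \<epsilon>) + inverse \<epsilon> * \<xi>) \<in> lebesgue \<rightarrow>\<^sub>M lebesgue"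
    using lebesgue_affine_measurable[of "\<lambda>_. inverse \<epsilon>" "- c * inverse \<epsilon>"] eps by (simp add: mult_ac)
  then have "(\<lambda>\<xi>. m ((- c * inverse \<epsilon>) + inverse \<epsilon> * \<xi>)) \<in> borel_measurable lebesgue"
    using m_measurable by (rule measurable_compose)
  then show ?thesis by (simp add: algebra_simps)
qed

lemma m_scaled_nonzeroD:
  assumes "m (inverse \<epsilon> * x) \<noteq> 0"
  shows "- (\<epsilon> / 2) < x" "x \<le> \<epsilon> / 2"
proof -
  have "inverse \<epsilon> * x \<in> {-1/2<..1/2}" using assms m_support by blast
  then show "- (\<epsilon> / 2) < x" "x \<le> \<epsilon> / 2" using eps by (auto simp: field_simps)
qed

lemma frac_symbol_measurable [measurable]: "frac_symbol m \<epsilon> \<theta> \<in> borel_measurable lebesgue"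
proof -
  have "(\<lambda>\<xi>. m (inverse \<epsilon> * (\<xi> - (of_int l + \<theta>)))) \<in> borel_measurable lebesgue" for l :: int by measurable
  then have "(\<lambda>\<xi>. m (inverse \<epsilon> * (\<xi> - of_int l - \<theta>))) \<in> borel_measurable lebesgue" for l :: int
    by (simp add: diff_diff_eq)
  then show ?thesis unfolding frac_symbol_def[abs_def] by (intro borel_measurable_sum)
qed

lemma frac_symbol_measurable_circle [measurable]: "frac_symbol m \<epsilon> \<theta> \<in> borel_measurable circle"
  by (rule borel_measurable_circle[OF frac_symbol_measurable])

text \<open>The translates of the scaled \<open>m\<close> have disjoint supports, so at each
  \<open>\<xi>\<close> at most one pair \<open>(\<theta>, l)\<close> contributes. Different
  fractions are kept apart by the hypothesis, different \<open>l\<close> by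
  \<open>\<epsilon> \<le> 1/2\<close>.\<close>

lemma norm_sum_frac_symbol_le:
  assumes \<Theta>: "finite \<Theta>"
    and sep: "\<And>\<theta> \<theta>' (l::int). \<theta> \<in> \<Theta> \<Longrightarrow> \<theta>' \<in> \<Theta> \<Longrightarrow> \<theta> \<noteq> \<theta>' \<Longrightarrow> \<epsilon> \<le> \<bar>\<theta> - \<theta>' - of_int l\<bar>"
  shows "norm (\<Sum>\<theta>\<in>\<Theta>. frac_symbol m \<epsilon> \<theta> \<xi>) \<le> b"
proof -
  define g where "g = (\<lambda>(\<theta>, l :: int). m (inverse \<epsilon> * (\<xi> - of_int l - \<theta>)))"
  let ?S = "\<Theta> \<times> {-3..3::int}"
  have eq: "(\<Sum>\<theta>\<in>\<Theta>. frac_symbol m \<epsilon> \<theta> \<xi>) = (\<Sum>x\<in>?S. g x)"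
    using \<Theta> by (simp add: frac_symbol_def sum.cartesian_product g_def case_prod_unfold)
  have one: "x = y" if "x \<in> ?S" "y \<in> ?S" "g x \<noteq> 0" "g y \<noteq> 0" for x y
  proof -
    obtain \<theta> l \<theta>' l' where xy: "x = (\<theta>, l)" "y = (\<theta>', l')" by (meson surj_pair)
    have "m (inverse \<epsilon> * (\<xi> - of_int l - \<theta>)) \<noteq> 0" "m (inverse \<epsilon> * (\<xi> - of_int l' - \<theta>')) \<noteq> 0"
      using that xy by (simp_all add: g_def)
    \<comment> \<open>Both points lie in an interval of length \<open>\<epsilon>\<close> that is
      open on the left, so their difference is strictly less than \<open>\<epsilon>\<close>.\<close>
    from m_scaled_nonzeroD[OF this(1)] m_scaled_nonzeroD[OF this(2)] have less: "\<bar>\<theta> - \<theta>' - of_int (l' - l)\<bar> < \<epsilon>" by simp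
    have "\<theta> = \<theta>'"
    proof (rule ccontr)
      assume "\<theta> \<noteq> \<theta>'"
      then have "\<epsilon> \<le> \<bar>\<theta> - \<theta>' - of_int (l' - l)\<bar>" using that xy by (intro sep) auto
      with less show False by linarith
    qed
    moreover from this less have "\<bar>real_of_int (l' - l)\<bar> < 1" using eps by simp
    then have "l = l'" by linarith
    ultimately show ?thesis using xy by simp
  qed
  show ?thesis
  proof (cases "\<exists>x\<in>?S. g x \<noteq> 0")
    case True
    then obtain x where x: "x \<in> ?S" "g x \<noteq> 0" by blast
    have "(\<Sum>y\<in>?S. g y) = (\<Sum>y\<in>{x}. g y)"
      using \<Theta> x one by (intro sum.mono_neutral_right) auto
    then show ?thesis unfolding eq using m_bound by (simp add: g_def case_prod_unfold)
  next
    case False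
    then have "(\<Sum>y\<in>?S. g y) = 0" by (intro sum.neutral) auto
    then show ?thesis unfolding eq using b_nonneg by simp
  qed
qed

lemma norm_frac_symbol_le: "norm (frac_symbol m \<epsilon> \<theta> \<xi>) \<le> b"
  using norm_sum_frac_symbol_le[of "{\<theta>}"] by simp

lemma infsum_eq_frac_symbol:
  assumes \<theta>: "0 \<le> \<theta>" "\<theta> \<le> 1" and \<xi>: "\<xi> \<in> {-1/2<..1/2}"
  shows "(\<Sum>\<^sub>\<infinity>l::int. m (inverse \<epsilon> * (\<xi> - of_int l - \<theta>)) * F) = frac_symbol m \<epsilon> \<theta> \<xi> * F"
proof -
  have "(\<Sum>\<^sub>\<infinity>l::int. m (inverse \<epsilon> * (\<xi> - of_int l - \<theta>)) * F) = (\<Sum>\<^sub>\<infinity>l\<in>{-3..3::int}. m (inverse \<epsilon> * (\<xi> - of_int l - \<theta>)) * F)"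
  proof (rule infsum_cong_neutral)
    fix l :: int assume l: "l \<in> UNIV - {-3..3}"
    have "m (inverse \<epsilon> * (\<xi> - of_int l - \<theta>)) = 0"
    proof (rule ccontr)
      assume "m (inverse \<epsilon> * (\<xi> - of_int l - \<theta>)) \<noteq> 0"
      from m_scaled_nonzeroD[OF this] have "-3 \<le> real_of_int l" "real_of_int l \<le> 3" using \<theta> \<xi> eps by auto
      then have "-3 \<le> l" "l \<le> 3" by linarith+
      then show False using l by simp
    qed
    then show "m (inverse \<epsilon> * (\<xi> - of_int l - \<theta>)) * F = 0" by simp
  qed auto
  then show ?thesis by (simp add: frac_symbol_def sum_distrib_right)
qed

lemma frac_op_eq:
  assumes \<theta>: "0 \<le> \<theta>" "\<theta> \<le> 1"
  shows "frac_op m \<epsilon> \<theta> f n = (\<integral>\<xi>. frac_symbol m \<epsilon> \<theta> \<xi> * fourier_Z f \<xi> * ex (of_int n * \<xi>) \<partial>circle)"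
  unfolding frac_op_def inv_fourier_Z_def LINT_circle
proof (intro Bochner_Integration.integral_cong refl)
  fix \<xi> assume "\<xi> \<in> space circle"
  then have "\<xi> \<in> {-1/2<..1/2}" by (simp only: space_circle)
  moreover have "cis (2 * pi * of_int n * \<xi>) = ex (of_int n * \<xi>)" by (simp add: ex_def mult.assoc)
  ultimately show "(\<Sum>\<^sub>\<infinity>l::int. m (inverse \<epsilon> * (\<xi> - of_int l - \<theta>)) * fourier_Z f \<xi>) * cis (2 * pi * of_int n * \<xi>)
    = frac_symbol m \<epsilon> \<theta> \<xi> * fourier_Z f \<xi> * ex (of_int n * \<xi>)"
    by (simp only: infsum_eq_frac_symbol[OF \<theta>])
qed

lemma fourier_Z_finite:
  assumes "finite J" "\<And>j. j \<notin> J \<Longrightarrow> f j = 0"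
  shows "fourier_Z f \<xi> = (\<Sum>j\<in>J. f j * ex (- (of_int j * \<xi>)))"
proof -
  have "fourier_Z f \<xi> = (\<Sum>\<^sub>\<infinity>j\<in>J. f j * ex (- (of_int j * \<xi>)))"
    unfolding fourier_Z_def by (rule infsum_cong_neutral) (use assms in \<open>auto simp: ex_def mult.assoc\<close>)
  then show ?thesis using assms by simp
qed

lemma frac_op_finite:
  assumes \<theta>: "0 \<le> \<theta>" "\<theta> \<le> 1" and J: "finite J" and f: "\<And>j. j \<notin> J \<Longrightarrow> f j = 0"
  shows "frac_op m \<epsilon> \<theta> f n = (\<Sum>j\<in>J. f j * frac_kernel m \<epsilon> \<theta> (n - j))"
proof -
  have i: "integrable circle (\<lambda>\<xi>. c * (frac_symbol m \<epsilon> \<theta> \<xi> * ex (of_int k * \<xi>)))" for c :: complex and k :: int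
    by (rule integrable_circle[where b = "norm c * b"])
       (auto simp: norm_mult intro!: mult_left_mono norm_frac_symbol_le)
  have F: "fourier_Z f \<xi> = (\<Sum>j\<in>J. f j * ex (- (of_int j * \<xi>)))" for \<xi>
    by (rule fourier_Z_finite[OF J]) (rule f)
  have "frac_op m \<epsilon> \<theta> f n = (\<integral>\<xi>. (\<Sum>j\<in>J. f j * (frac_symbol m \<epsilon> \<theta> \<xi> * ex (of_int (n - j) * \<xi>))) \<partial>circle)"
    unfolding frac_op_eq[OF \<theta>] F sum_distrib_left sum_distrib_right
  proof (intro Bochner_Integration.integral_cong sum.cong refl)
    fix \<xi> j
    have "ex (of_int (n - j) * \<xi>) = ex (- (of_int j * \<xi>)) * ex (of_int n * \<xi>)"
      unfolding ex_add[symmetric] by (simp add: left_diff_distrib)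
    then show "frac_symbol m \<epsilon> \<theta> \<xi> * (f j * ex (- (of_int j * \<xi>))) * ex (of_int n * \<xi>) = f j * (frac_symbol m \<epsilon> \<theta> \<xi> * ex (of_int (n - j) * \<xi>))"
      by (simp only: mult_ac)
  qed
  also have "\<dots> = (\<Sum>j\<in>J. f j * frac_kernel m \<epsilon> \<theta> (n - j))"
    unfolding frac_kernel_def integral_mult_right_zero[symmetric] by (intro Bochner_Integration.integral_sum i)
  finally show ?thesis .
qed

text \<open>Substituting \<open>\<xi> = l + \<theta> + \<epsilon> * \<eta>\<close> in each term, the
  integer \<open>l\<close> drops out of the phase because \<open>n\<close> is an integer. The
  truncations to the period then tile: every \<open>\<eta>\<close> in the support is counted for
  exactly one \<open>l\<close>. The operator is thus the one at frequency 0, modulated by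
  \<open>\<theta>\<close>.\<close>

lemma frac_kernel_eq:
  assumes \<theta>: "0 \<le> \<theta>" "\<theta> \<le> 1"
  shows "frac_kernel m \<epsilon> \<theta> n = ex (\<theta> * of_int n) * (of_real \<epsilon> * mult_kernel m (\<epsilon> * of_int n))"
proof -
  let ?I = "{-1/2<..1/2::real}"
  define h where "h l \<xi> = indicator ?I \<xi> *\<^sub>R (m (inverse \<epsilon> * (\<xi> - of_int l - \<theta>)) * ex (of_int n * \<xi>))" for l :: int and \<xi>
  define k where "k l \<eta> = indicator ?I (of_int l + \<theta> + \<epsilon> * \<eta>) *\<^sub>R (m \<eta> * ex (\<epsilon> * of_int n * \<eta>))" for l :: int and \<eta>
  have ib: "integrable lebesgue (\<lambda>\<eta>. m \<eta> * ex (\<epsilon> * of_int n * \<eta>))"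
    by (rule integrable_m_ex[OF m_integrable m_support])
  have kint: "integrable lebesgue (k l)" for l
  proof (rule Bochner_Integration.integrable_bound[OF ib])
    have "(\<lambda>\<eta>. indicator ?I (of_int l + \<theta> + \<epsilon> * \<eta>) :: real) \<in> borel_measurable lebesgue"
      by (rule measurable_completion) measurable
    then show "k l \<in> borel_measurable lebesgue"
      unfolding k_def[abs_def] using ib by (intro borel_measurable_scaleR) auto
  qed (auto simp: k_def indicator_def)
  have hk: "(\<integral>\<xi>. h l \<xi> \<partial>lebesgue) = of_real \<epsilon> * ex (\<theta> * of_int n) * (\<integral>\<eta>. k l \<eta> \<partial>lebesgue)" for l
  proof -
    have "(\<integral>\<xi>. h l \<xi> \<partial>lebesgue) = \<bar>\<epsilon>\<bar> *\<^sub>R (\<integral>\<eta>. h l ((of_int l + \<theta>) + \<epsilon> * \<eta>) \<partial>lebesgue)"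
      using eps by (intro lebesgue_integral_real_affine) simp
    also have "(\<integral>\<eta>. h l ((of_int l + \<theta>) + \<epsilon> * \<eta>) \<partial>lebesgue) = (\<integral>\<eta>. ex (\<theta> * of_int n) * k l \<eta> \<partial>lebesgue)"
    proof (intro Bochner_Integration.integral_cong refl)
      fix \<eta>
      have "of_int n * ((of_int l + \<theta>) + \<epsilon> * \<eta>) = of_int (n * l) + (\<theta> * of_int n + \<epsilon> * of_int n * \<eta>)"
        by (simp add: algebra_simps)
      then have "ex (of_int n * ((of_int l + \<theta>) + \<epsilon> * \<eta>)) = ex (\<theta> * of_int n) * ex (\<epsilon> * of_int n * \<eta>)"
        by (simp only: ex_add) (simp del: of_int_mult)
      moreover have "inverse \<epsilon> * ((of_int l + \<theta>) + \<epsilon> * \<eta> - of_int l - \<theta>) = \<eta>" using eps by simp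
      ultimately show "h l ((of_int l + \<theta>) + \<epsilon> * \<eta>) = ex (\<theta> * of_int n) * k l \<eta>"
        by (simp only: h_def k_def) (simp add: indicator_def)
    qed
    also have "\<dots> = ex (\<theta> * of_int n) * (\<integral>\<eta>. k l \<eta> \<partial>lebesgue)" by (rule integral_mult_right_zero)
    finally show ?thesis using eps by (simp add: scaleR_conv_of_real)
  qed
  have "m (inverse \<epsilon> * (\<xi> - of_int l - \<theta>)) * ex (of_int n * \<xi>) = m (inverse \<epsilon> * (\<xi> - (of_int l + \<theta>))) * ex (of_int n * \<xi>)" for \<xi> l
    by (simp add: diff_diff_eq)
  then have hint: "integrable circle (\<lambda>\<xi>. m (inverse \<epsilon> * (\<xi> - of_int l - \<theta>)) * ex (of_int n * \<xi>))" for l :: int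
  proof (simp only:, intro integrable_circle[where b = b])
    show "(\<lambda>\<xi>. m (inverse \<epsilon> * (\<xi> - (of_int l + \<theta>))) * ex (of_int n * \<xi>)) \<in> borel_measurable circle"
      by (intro borel_measurable_times borel_measurable_circle[OF m_scaled_measurable] borel_measurable_ex_circle)
  qed (auto simp: norm_mult m_bound)
  have "frac_kernel m \<epsilon> \<theta> n = (\<Sum>l\<in>{-3..3::int}. (\<integral>\<xi>. m (inverse \<epsilon> * (\<xi> - of_int l - \<theta>)) * ex (of_int n * \<xi>) \<partial>circle))"
    unfolding frac_kernel_def frac_symbol_def sum_distrib_right
    by (intro Bochner_Integration.integral_sum hint)
  also have "\<dots> = (\<Sum>l\<in>{-3..3::int}. (\<integral>\<xi>. h l \<xi> \<partial>lebesgue))"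
    by (simp only: LINT_circle[symmetric] set_lebesgue_integral_def h_def)
  also have "\<dots> = of_real \<epsilon> * ex (\<theta> * of_int n) * (\<integral>\<eta>. (\<Sum>l\<in>{-3..3::int}. k l \<eta>) \<partial>lebesgue)"
    using kint unfolding hk by (subst Bochner_Integration.integral_sum) (auto simp: sum_distrib_left)
  also have "(\<integral>\<eta>. (\<Sum>l\<in>{-3..3::int}. k l \<eta>) \<partial>lebesgue) = mult_kernel m (\<epsilon> * of_int n)"
    unfolding mult_kernel_def
  proof (intro Bochner_Integration.integral_cong refl)
    fix \<eta>
    show "(\<Sum>l\<in>{-3..3::int}. k l \<eta>) = m \<eta> * ex (\<epsilon> * of_int n * \<eta>)"
    proof (cases "\<eta> \<in> {-1/2<..1/2}")
      case False
      then show ?thesis using m_support by (simp add: k_def)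
    next
      case True
      have "\<epsilon> * \<eta> \<le> \<epsilon> * (1/2)" "\<epsilon> * (- 1/2) \<le> \<epsilon> * \<eta>" using eps True mult_left_mono[of \<eta> "1/2" \<epsilon>] mult_left_mono[of "-1/2" \<eta> \<epsilon>] by auto
      then have r: "-1/4 \<le> \<epsilon> * \<eta>" "\<epsilon> * \<eta> \<le> 1/4" using eps by linarith+
      \<comment> \<open>The unique integer that moves \<open>\<theta> + \<epsilon> * \<eta>\<close>
        into the half-open period.\<close>
      define L where "L = \<lfloor>1/2 - (\<theta> + \<epsilon> * \<eta>)\<rfloor>"
      have L: "-1/2 < of_int L + \<theta> + \<epsilon> * \<eta>" "of_int L + \<theta> + \<epsilon> * \<eta> \<le> 1/2"
        unfolding L_def by linarith+
      have "-3 \<le> real_of_int L" "real_of_int L \<le> 3" using L \<theta> r by linarith+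
      then have Lr: "L \<in> {-3..3}" by simp
      have "k l \<eta> = 0" if "l \<noteq> L" for l
      proof -
        have "of_int l + \<theta> + \<epsilon> * \<eta> \<notin> ?I"
        proof
          assume "of_int l + \<theta> + \<epsilon> * \<eta> \<in> ?I"
          then have "\<bar>real_of_int l - of_int L\<bar> < 1" using L by auto
          then show False using that by linarith
        qed
        then show ?thesis by (simp add: k_def)
      qed
      then have "(\<Sum>l\<in>{-3..3::int}. k l \<eta>) = (\<Sum>l\<in>{L}. k l \<eta>)"
        using Lr by (intro sum.mono_neutral_right) auto
      then show ?thesis using L by (simp add: k_def)
    qed
  qed
  finally show ?thesis by (simp add: mult_ac)
qed

end

section \<open>Bounded extensions\<close>

lemma integrable_count_space_iff:
  fixes g :: "'a \<Rightarrow> real"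
  assumes "\<And>x. g x \<ge> 0"
  shows "integrable (count_space UNIV) g \<longleftrightarrow> g summable_on UNIV"
    and "g summable_on UNIV \<Longrightarrow> (\<integral>x. g x \<partial>count_space UNIV) = (\<Sum>\<^sub>\<infinity>x. g x)"
proof -
  have eq: "Infinite_Sum.abs_summable_on g UNIV \<longleftrightarrow> integrable (count_space UNIV) g"
    using abs_summable_equivalent[of g UNIV] by (simp add: Infinite_Set_Sum.abs_summable_on_def)
  then show 1: "integrable (count_space UNIV) g \<longleftrightarrow> g summable_on UNIV" using assms by simp
  show "(\<integral>x. g x \<partial>count_space UNIV) = (\<Sum>\<^sub>\<infinity>x. g x)" if "g summable_on UNIV"
  proof -
    have "Infinite_Set_Sum.abs_summable_on g UNIV"
      using 1 that by (simp add: Infinite_Set_Sum.abs_summable_on_def)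
    from infsetsum_infsum[OF this] show ?thesis by (simp add: infsetsum_def)
  qed
qed

lemma lp_Z_iff:
  assumes "r \<ge> 1"
  shows "f \<in> lp_Z (2 * real r) \<longleftrightarrow> (\<lambda>n. norm (f n) ^ (2 * r)) summable_on UNIV"
  unfolding Lp_iff_power[OF assms] by (simp add: integrable_count_space_iff(1))

lemma lp_Z_norm_power:
  assumes "r \<ge> 1" "f \<in> lp_Z (2 * real r)"
  shows "lp_Z_norm (2 * real r) f ^ (2 * r) = (\<Sum>\<^sub>\<infinity>n. norm (f n) ^ (2 * r))"
  using assms unfolding Lp_norm_power[OF assms(1)] lp_Z_iff[OF assms(1)]
  by (intro integrable_count_space_iff(2)) auto

lemma lp_Z_1_summable: "f \<in> lp_Z 1 \<Longrightarrow> (\<lambda>n. norm (f n)) summable_on UNIV"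
  by (simp add: Lp_def integrable_count_space_iff(1))

lemma sum_le_lp_Z_norm:
  assumes "r \<ge> 1" "f \<in> lp_Z (2 * real r)" "finite A"
  shows "(\<Sum>n\<in>A. norm (f n) ^ (2 * r)) \<le> lp_Z_norm (2 * real r) f ^ (2 * r)"
  unfolding lp_Z_norm_power[OF assms(1,2)]
  using assms by (intro finite_sum_le_infsum) (auto simp: lp_Z_iff)

lemma norm_le_lp_Z_norm:
  assumes "r \<ge> 1" "f \<in> lp_Z (2 * real r)"
  shows "norm (f n) \<le> lp_Z_norm (2 * real r) f"
proof -
  have "norm (f n) ^ (2 * r) \<le> lp_Z_norm (2 * real r) f ^ (2 * r)"
    using sum_le_lp_Z_norm[OF assms, of "{n}"] by simp
  then show ?thesis using assms(1) by (simp add: power_mono_iff Lp_norm_nonneg)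
qed

lemma lp_Z_bound:
  assumes r: "r \<ge> 1" and B: "\<And>A. finite A \<Longrightarrow> (\<Sum>n\<in>A. norm (f n) ^ (2 * r)) \<le> c ^ (2 * r)" and c: "c \<ge> 0"
  shows "f \<in> lp_Z (2 * real r)" "lp_Z_norm (2 * real r) f \<le> c"
proof -
  have s: "(\<lambda>n. norm (f n) ^ (2 * r)) summable_on UNIV"
    by (rule nonneg_bdd_above_summable_on) (auto intro!: bdd_aboveI2 B)
  then show f: "f \<in> lp_Z (2 * real r)" by (simp add: lp_Z_iff[OF r])
  have "lp_Z_norm (2 * real r) f ^ (2 * r) \<le> c ^ (2 * r)"
    unfolding lp_Z_norm_power[OF r f] by (rule infsum_le_finite_sums[OF s B])
  then show "lp_Z_norm (2 * real r) f \<le> c"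
    using r c by (simp add: power_mono_iff Lp_norm_nonneg)
qed

definition trunc :: "nat \<Rightarrow> (int \<Rightarrow> complex) \<Rightarrow> int \<Rightarrow> complex" where
  "trunc N f j = (if j \<in> {- int N..int N} then f j else 0)"

lemma filterlim_int_intervals: "filterlim (\<lambda>N. {- int N..int N}) (finite_subsets_at_top UNIV) sequentially"
  unfolding filterlim_def le_filter_def
proof (intro allI impI)
  fix P assume "eventually P (finite_subsets_at_top (UNIV :: int set))"
  then obtain X where X: "finite X" "\<And>Y. finite Y \<Longrightarrow> X \<subseteq> Y \<Longrightarrow> P Y"
    unfolding eventually_finite_subsets_at_top by auto
  obtain M where M: "X \<subseteq> {- int M..int M}" using subset_int_interval[OF X(1)] .
  have "P {- int N..int N}" if "N \<ge> M" for N
    using M that by (intro X(2)) auto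
  then show "eventually P (filtermap (\<lambda>N. {- int N..int N}) sequentially)"
    unfolding eventually_filtermap eventually_sequentially by blast
qed

lemma summable_on_LIMSEQ:
  fixes g :: "int \<Rightarrow> 'b :: {topological_comm_monoid_add, t2_space}"
  assumes "g summable_on UNIV"
  shows "(\<lambda>N. \<Sum>j\<in>{- int N..int N}. g j) \<longlonglongrightarrow> (\<Sum>\<^sub>\<infinity>j. g j)"
  using has_sum_infsum[OF assms] filterlim_int_intervals unfolding has_sum_def by (rule filterlim_compose)

lemma trunc_lp_Z:
  assumes r: "r \<ge> 1"
  shows "trunc N f \<in> lp_Z (2 * real r)" "trunc N f \<in> lp_Z 1"
proof -
  have "(\<lambda>n. norm (trunc N f n) ^ k) summable_on UNIV" if "k \<ge> 1" for k
  proof (rule finite_nonzero_values_imp_summable_on)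
    have "norm (trunc N f x) ^ k = 0" if "x \<notin> {- int N..int N}" for x
      using that \<open>k \<ge> 1\<close> by (simp only: trunc_def if_False norm_zero power_0_left) simp
    then have "{x \<in> UNIV. norm (trunc N f x) ^ k \<noteq> 0} \<subseteq> {- int N..int N}" by blast
    then show "finite {x \<in> UNIV. norm (trunc N f x) ^ k \<noteq> 0}"
      by (rule finite_subset) (rule finite_atLeastAtMost_int)
  qed
  note s = this
  show "trunc N f \<in> lp_Z (2 * real r)"
    unfolding lp_Z_iff[OF r] by (rule s) (use r in simp)
  show "trunc N f \<in> lp_Z 1"
    using s[of 1] by (simp add: Lp_def integrable_count_space_iff(1))
qed

text \<open>Density of finitely supported functions, in the concrete form that the tails of the
  convergent sum of powers tend to 0.\<close>

lemma trunc_tail: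
  assumes r: "r \<ge> 1" and f: "f \<in> lp_Z (2 * real r)"
  shows "(\<lambda>n. f n - trunc N f n) \<in> lp_Z (2 * real r)"
    and "(\<lambda>N. lp_Z_norm (2 * real r) (\<lambda>n. f n - trunc N f n)) \<longlonglongrightarrow> 0"
proof -
  have s: "(\<lambda>n. norm (f n) ^ (2 * r)) summable_on UNIV" using f by (simp add: lp_Z_iff[OF r])
  define t where "t = (\<Sum>\<^sub>\<infinity>n. norm (f n) ^ (2 * r))"
  define R where "R N = t - (\<Sum>j\<in>{- int N..int N}. norm (f j) ^ (2 * r))" for N
  have R0: "R N \<ge> 0" for N
    unfolding R_def t_def using finite_sum_le_infsum[OF s, of "{- int N..int N}"] by simp
  have tail: "(\<Sum>n\<in>A. norm (f n - trunc N f n) ^ (2 * r)) \<le> root (2 * r) (R N) ^ (2 * r)" if "finite A" for A N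
  proof -
    let ?I = "{- int N..int N}"
    have "(\<Sum>n\<in>A. norm (f n - trunc N f n) ^ (2 * r)) = (\<Sum>n\<in>A - ?I. norm (f n) ^ (2 * r))"
      using that r by (intro sum.mono_neutral_cong_right) (auto simp: trunc_def)
    also have "\<dots> = (\<Sum>n\<in>(A - ?I) \<union> ?I. norm (f n) ^ (2 * r)) - (\<Sum>n\<in>?I. norm (f n) ^ (2 * r))"
      using that by (subst sum.union_disjoint) auto
    also have "\<dots> \<le> R N"
      unfolding R_def t_def using that by (intro diff_right_mono finite_sum_le_infsum[OF s]) auto
    finally show ?thesis using r R0 by simp
  qed
  have nn: "root (2 * r) (R N) \<ge> 0" for N using R0 by (intro real_root_ge_zero)
  show "(\<lambda>n. f n - trunc N f n) \<in> lp_Z (2 * real r)" by (rule lp_Z_bound(1)[OF r tail nn])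
  have "R \<longlonglongrightarrow> t - t" unfolding R_def[abs_def] t_def by (intro tendsto_intros summable_on_LIMSEQ s)
  then have "(\<lambda>N. root (2 * r) (R N)) \<longlonglongrightarrow> root (2 * r) 0" by (intro tendsto_real_root) simp
  then have lim: "(\<lambda>N. root (2 * r) (R N)) \<longlonglongrightarrow> 0" by simp
  show "(\<lambda>N. lp_Z_norm (2 * real r) (\<lambda>n. f n - trunc N f n)) \<longlonglongrightarrow> 0"
    by (rule tendsto_sandwich[OF _ _ tendsto_const lim])
       (auto intro!: always_eventually Lp_norm_nonneg lp_Z_bound(2)[OF r tail nn])
qed

definition partial_conv :: "(int \<Rightarrow> complex) \<Rightarrow> nat \<Rightarrow> (int \<Rightarrow> complex) \<Rightarrow> int \<Rightarrow> complex" where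
  "partial_conv \<kappa> N f n = (\<Sum>j\<in>{- int N..int N}. f j * \<kappa> (n - j))"

text \<open>Finite sums on the input and on the output side let the bound be stated before any
  convergence is known.\<close>

definition conv_bounded :: "nat \<Rightarrow> (int \<Rightarrow> complex) \<Rightarrow> real \<Rightarrow> bool" where
  "conv_bounded r \<kappa> C \<longleftrightarrow> (\<forall>(J :: int set) A f. finite J \<longrightarrow> finite A \<longrightarrow>
     (\<Sum>n\<in>A. norm (\<Sum>j\<in>J. f j * \<kappa> (n - j)) ^ (2 * r)) \<le> C * (\<Sum>j\<in>J. norm (f j) ^ (2 * r)))"

text \<open>At a single point \<open>n\<close> the bound is tested on \<open>f'\<close>, which has
  modulus at most that of \<open>f\<close> and phases aligned with the kernel. The convolution at
  \<open>n\<close> is then the sum of absolute values, bounded uniformly in the finite set.\<close>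

lemma conv_bounded_summable:
  assumes r: "r \<ge> 1" and C: "conv_bounded r \<kappa> C" "C \<ge> 0" and f: "f \<in> lp_Z (2 * real r)"
  shows "(\<lambda>j. f j * \<kappa> (n - j)) summable_on UNIV"
proof -
  let ?t = "C * lp_Z_norm (2 * real r) f ^ (2 * r)"
  have "(\<Sum>j\<in>J. norm (f j * \<kappa> (n - j))) \<le> root (2 * r) ?t" if J: "finite J" for J
  proof -
    define f' where "f' j = norm (f j) * cnj (sgn (\<kappa> (n - j)))" for j
    have f': "norm (f' j) \<le> norm (f j)" for j
      by (auto simp: f'_def norm_mult norm_sgn intro: mult_left_le)
    have "f' j * \<kappa> (n - j) = of_real (norm (f j * \<kappa> (n - j)))" for j
    proof (cases "\<kappa> (n - j) = 0")
      case False
      have "cnj (sgn (\<kappa> (n - j))) * \<kappa> (n - j) = cnj (\<kappa> (n - j)) * \<kappa> (n - j) / of_real (norm (\<kappa> (n - j)))"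
        by (simp add: sgn_div_norm scaleR_conv_of_real divide_inverse mult_ac)
      also have "\<dots> = of_real ((norm (\<kappa> (n - j)))\<^sup>2) / of_real (norm (\<kappa> (n - j)))"
        by (simp only: complex_norm_square mult.commute)
      also have "\<dots> = of_real (norm (\<kappa> (n - j)))"
        using False by (simp add: power2_eq_square)
      finally show ?thesis by (simp add: f'_def norm_mult mult.assoc)
    qed (simp add: f'_def)
    then have "(\<Sum>j\<in>J. f' j * \<kappa> (n - j)) = of_real (\<Sum>j\<in>J. norm (f j * \<kappa> (n - j)))" by simp
    then have "norm (\<Sum>j\<in>J. f' j * \<kappa> (n - j)) = \<bar>\<Sum>j\<in>J. norm (f j * \<kappa> (n - j))\<bar>" by (simp only: norm_of_real)
    then have "(\<Sum>j\<in>J. norm (f j * \<kappa> (n - j))) ^ (2 * r) = norm (\<Sum>j\<in>J. f' j * \<kappa> (n - j)) ^ (2 * r)"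
      by (simp add: abs_of_nonneg sum_nonneg)
    also have "\<dots> \<le> C * (\<Sum>j\<in>J. norm (f' j) ^ (2 * r))"
      using C(1)[unfolded conv_bounded_def, rule_format, of J "{n}" f'] J by simp
    also have "\<dots> \<le> C * (\<Sum>j\<in>J. norm (f j) ^ (2 * r))"
      by (intro mult_left_mono sum_mono power_mono f' C(2)) auto
    also have "\<dots> \<le> ?t" by (intro mult_left_mono sum_le_lp_Z_norm r f J C(2))
    finally have "(\<Sum>j\<in>J. norm (f j * \<kappa> (n - j))) ^ (2 * r) \<le> ?t" .
    then have "root (2 * r) ((\<Sum>j\<in>J. norm (f j * \<kappa> (n - j))) ^ (2 * r)) \<le> root (2 * r) ?t"
      using r by (intro real_root_le_mono) auto
    moreover have "root (2 * r) ((\<Sum>j\<in>J. norm (f j * \<kappa> (n - j))) ^ (2 * r)) = (\<Sum>j\<in>J. norm (f j * \<kappa> (n - j)))"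
      using r by (intro real_root_power_cancel) (auto intro!: sum_nonneg)
    ultimately show ?thesis by simp
  qed
  then have "(\<lambda>j. norm (f j * \<kappa> (n - j))) summable_on UNIV"
    by (intro nonneg_bdd_above_summable_on) (auto intro!: bdd_aboveI2)
  then show ?thesis by (rule abs_summable_summable)
qed

text \<open>A form of Fatou's lemma: for a fixed finite set of points the limit may be taken
  termwise, and the right side is bounded by the full norm of \<open>f\<close> for every
  \<open>N\<close>.\<close>

lemma lp_Z_norm_limit_le:
  assumes r: "r \<ge> 1" and lim: "\<And>n. (\<lambda>N. G N n) \<longlonglongrightarrow> g n" and C: "C \<ge> 0" and f: "f \<in> lp_Z (2 * real r)"
    and le: "\<And>N A. finite A \<Longrightarrow> (\<Sum>n\<in>A. norm (G N n) ^ (2 * r)) \<le> C ^ (2 * r) * (\<Sum>j\<in>{- int N..int N}. norm (f j) ^ (2 * r))"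
  shows "g \<in> lp_Z (2 * real r)" "lp_Z_norm (2 * real r) g \<le> C * lp_Z_norm (2 * real r) f"
proof -
  have B: "(\<Sum>n\<in>A. norm (g n) ^ (2 * r)) \<le> (C * lp_Z_norm (2 * real r) f) ^ (2 * r)" if A: "finite A" for A
  proof (rule LIMSEQ_le_const2)
    show "(\<lambda>N. \<Sum>n\<in>A. norm (G N n) ^ (2 * r)) \<longlonglongrightarrow> (\<Sum>n\<in>A. norm (g n) ^ (2 * r))"
      by (intro tendsto_intros lim)
    have "(\<Sum>n\<in>A. norm (G N n) ^ (2 * r)) \<le> (C * lp_Z_norm (2 * real r) f) ^ (2 * r)" for N
    proof -
      note le[OF A, of N]
      also have "C ^ (2 * r) * (\<Sum>j\<in>{- int N..int N}. norm (f j) ^ (2 * r)) \<le> C ^ (2 * r) * lp_Z_norm (2 * real r) f ^ (2 * r)"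
        using C by (intro mult_left_mono sum_le_lp_Z_norm r f) auto
      finally show ?thesis by (simp add: power_mult_distrib)
    qed
    then show "\<exists>N. \<forall>n\<ge>N. (\<Sum>i\<in>A. norm (G n i) ^ (2 * r)) \<le> (C * lp_Z_norm (2 * real r) f) ^ (2 * r)" by blast
  qed
  have nn: "C * lp_Z_norm (2 * real r) f \<ge> 0" by (rule mult_nonneg_nonneg[OF C Lp_norm_nonneg])
  show "g \<in> lp_Z (2 * real r)" by (rule lp_Z_bound(1)[OF r B nn])
  show "lp_Z_norm (2 * real r) g \<le> C * lp_Z_norm (2 * real r) f" by (rule lp_Z_bound(2)[OF r B nn])
qed

context band_multiplier
begin

lemma frac_op_trunc:
  assumes \<theta>: "0 \<le> \<theta>" "\<theta> \<le> 1"
  shows "frac_op m \<epsilon> \<theta> (trunc N f) n = partial_conv (frac_kernel m \<epsilon> \<theta>) N f n"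
proof -
  have "frac_op m \<epsilon> \<theta> (trunc N f) n = (\<Sum>j\<in>{- int N..int N}. trunc N f j * frac_kernel m \<epsilon> \<theta> (n - j))"
    by (rule frac_op_finite[OF \<theta>]) (auto simp: trunc_def)
  then show ?thesis by (simp add: partial_conv_def trunc_def)
qed

text \<open>Dominated convergence on the circle: the partial sums of the Fourier series are bounded
  by the sum of \<open>norm (f j)\<close>, and the symbol by \<open>b\<close>.\<close>

lemma frac_op_LIMSEQ:
  assumes \<theta>: "0 \<le> \<theta>" "\<theta> \<le> 1" and f: "f \<in> lp_Z 1"
  shows "(\<lambda>N. partial_conv (frac_kernel m \<epsilon> \<theta>) N f n) \<longlonglongrightarrow> frac_op m \<epsilon> \<theta> f n"
proof -
  define s where "s N \<xi> = (\<Sum>j\<in>{- int N..int N}. f j * ex (- (of_int j * \<xi>)))" for N \<xi>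
  define t where "t = (\<Sum>\<^sub>\<infinity>j. norm (f j))"
  note sf = lp_Z_1_summable[OF f]
  have fs: "fourier_Z (trunc N f) \<xi> = s N \<xi>" for N \<xi>
  proof -
    have "fourier_Z (trunc N f) \<xi> = (\<Sum>j\<in>{- int N..int N}. trunc N f j * ex (- (of_int j * \<xi>)))"
      by (rule fourier_Z_finite) (auto simp: trunc_def)
    then show ?thesis by (simp add: s_def trunc_def)
  qed
  have slim: "(\<lambda>N. s N \<xi>) \<longlonglongrightarrow> fourier_Z f \<xi>" for \<xi>
  proof -
    have "(\<lambda>j. norm (f j * ex (- (of_int j * \<xi>)))) summable_on UNIV" using sf by (simp add: norm_mult)
    then have "(\<lambda>j. f j * ex (- (of_int j * \<xi>))) summable_on UNIV" by (rule abs_summable_summable)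
    from summable_on_LIMSEQ[OF this] show ?thesis by (simp add: s_def fourier_Z_def ex_def mult.assoc)
  qed
  have sb: "norm (s N \<xi>) \<le> t" for N \<xi>
  proof -
    have "norm (s N \<xi>) \<le> (\<Sum>j\<in>{- int N..int N}. norm (f j))" unfolding s_def by (rule norm_trig_poly_le)
    also have "\<dots> \<le> t" unfolding t_def by (rule finite_sum_le_infsum[OF sf]) auto
    finally show ?thesis .
  qed
  have [measurable]: "s N \<in> borel_measurable circle" for N unfolding s_def[abs_def] by measurable
  have [measurable]: "fourier_Z f \<in> borel_measurable circle"
    by (rule borel_measurable_LIMSEQ_metric[OF _ slim]) simp
  have "(\<lambda>N. \<integral>\<xi>. frac_symbol m \<epsilon> \<theta> \<xi> * s N \<xi> * ex (of_int n * \<xi>) \<partial>circle)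
      \<longlonglongrightarrow> (\<integral>\<xi>. frac_symbol m \<epsilon> \<theta> \<xi> * fourier_Z f \<xi> * ex (of_int n * \<xi>) \<partial>circle)"
  proof (rule integral_dominated_convergence[where w = "\<lambda>_. b * t"])
    show "AE \<xi> in circle. (\<lambda>N. frac_symbol m \<epsilon> \<theta> \<xi> * s N \<xi> * ex (of_int n * \<xi>)) \<longlonglongrightarrow> frac_symbol m \<epsilon> \<theta> \<xi> * fourier_Z f \<xi> * ex (of_int n * \<xi>)"
      by (intro AE_I2 tendsto_intros slim)
    show "AE \<xi> in circle. norm (frac_symbol m \<epsilon> \<theta> \<xi> * s N \<xi> * ex (of_int n * \<xi>)) \<le> b * t" for N
      by (intro AE_I2) (auto simp: norm_mult intro!: mult_mono norm_frac_symbol_le sb b_nonneg)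
  qed auto
  then show ?thesis unfolding frac_op_trunc[OF \<theta>, symmetric] frac_op_eq[OF \<theta>] fs .
qed

text \<open>The extension is the absolutely convergent convolution with the kernel. It agrees with
  \<open>frac_op\<close> on summable functions because both are limits of the same truncated
  convolutions.\<close>

lemma is_frac_ext_exists:
  assumes r: "r \<ge> 1" and \<theta>: "0 \<le> \<theta>" "\<theta> \<le> 1" and C: "conv_bounded r (frac_kernel m \<epsilon> \<theta>) C" "C \<ge> 0"
  shows "\<exists>S. is_frac_ext (2 * real r) m \<epsilon> \<theta> S"
proof -
  let ?k = "frac_kernel m \<epsilon> \<theta>"
  define S where "S f n = (\<Sum>\<^sub>\<infinity>j. f j * ?k (n - j))" for f n
  note summ = conv_bounded_summable[OF r C]
  have lim: "(\<lambda>N. partial_conv ?k N f n) \<longlonglongrightarrow> S f n" if "f \<in> lp_Z (2 * real r)" for f n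
    unfolding S_def partial_conv_def by (rule summable_on_LIMSEQ[OF summ[OF that]])
  have bd: "S f \<in> lp_Z (2 * real r)" "lp_Z_norm (2 * real r) (S f) \<le> root (2 * r) C * lp_Z_norm (2 * real r) f"
    if f: "f \<in> lp_Z (2 * real r)" for f
  proof -
    have C': "root (2 * r) C ^ (2 * r) = C" "root (2 * r) C \<ge> 0" using C(2) r by simp_all
    have "(\<Sum>n\<in>A. norm (partial_conv ?k N f n) ^ (2 * r)) \<le> root (2 * r) C ^ (2 * r) * (\<Sum>j\<in>{- int N..int N}. norm (f j) ^ (2 * r))"
      if "finite A" for A N
      using C(1) that unfolding C' partial_conv_def conv_bounded_def by simp
    from lp_Z_norm_limit_le[OF r lim[OF f] C'(2) f this]
    show "S f \<in> lp_Z (2 * real r)" "lp_Z_norm (2 * real r) (S f) \<le> root (2 * r) C * lp_Z_norm (2 * real r) f" by auto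
  qed
  have "bounded_Lp_extension (2 * real r) (count_space UNIV) (lp_Z 1) (frac_op m \<epsilon> \<theta>) S (root (2 * r) C)"
    unfolding bounded_Lp_extension_def AE_count_space
  proof (intro conjI ballI allI impI bd)
    fix f g n assume fg: "f \<in> lp_Z (2 * real r)" "g \<in> lp_Z (2 * real r)"
    show "S (\<lambda>y. f y + g y) n = S f n + S g n"
      unfolding S_def distrib_right by (rule infsum_add[OF summ[OF fg(1)] summ[OF fg(2)]])
  next
    fix f n and c :: complex assume f: "f \<in> lp_Z (2 * real r)"
    show "S (\<lambda>y. c * f y) n = c * S f n"
      unfolding S_def mult.assoc by (rule infsum_cmult_right) (rule summ[OF f])
  next
    fix f n assume "f \<in> lp_Z 1 \<inter> lp_Z (2 * real r)"
    then show "S f n = frac_op m \<epsilon> \<theta> f n"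
      using LIMSEQ_unique[OF lim frac_op_LIMSEQ[OF \<theta>]] by blast
  qed
  then show ?thesis by blast
qed

text \<open>Holds for every admissible \<open>S\<close>, so the arbitrary choice in
  \<open>frac_ext\<close> is harmless. On truncations \<open>S\<close> is given by the kernel, and
  its value on the tail is at most the operator bound times the norm of the tail.\<close>

lemma frac_ext_LIMSEQ:
  assumes r: "r \<ge> 1" and \<theta>: "0 \<le> \<theta>" "\<theta> \<le> 1" and S: "is_frac_ext (2 * real r) m \<epsilon> \<theta> S"
    and f: "f \<in> lp_Z (2 * real r)"
  shows "(\<lambda>N. partial_conv (frac_kernel m \<epsilon> \<theta>) N f n) \<longlonglongrightarrow> S f n"
proof -
  from S obtain B where B: "bounded_Lp_extension (2 * real r) (count_space UNIV) (lp_Z 1) (frac_op m \<epsilon> \<theta>) S B" by blast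
  have bd: "S h \<in> lp_Z (2 * real r)" "lp_Z_norm (2 * real r) (S h) \<le> B * lp_Z_norm (2 * real r) h" if "h \<in> lp_Z (2 * real r)" for h
    using B that unfolding bounded_Lp_extension_def by blast+
  have add: "S (\<lambda>y. g y + h y) n = S g n + S h n" if "g \<in> lp_Z (2 * real r)" "h \<in> lp_Z (2 * real r)" for g h
    using B that unfolding bounded_Lp_extension_def AE_count_space by blast
  have ext: "S h n = frac_op m \<epsilon> \<theta> h n" if "h \<in> lp_Z 1" "h \<in> lp_Z (2 * real r)" for h
    using B that unfolding bounded_Lp_extension_def AE_count_space by blast
  have "norm (S f n - partial_conv (frac_kernel m \<epsilon> \<theta>) N f n) \<le> \<bar>B\<bar> * lp_Z_norm (2 * real r) (\<lambda>n. f n - trunc N f n)" for N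
  proof -
    \<comment> \<open>Additivity holds at every point, since almost everywhere for the counting
      measure means everywhere.\<close>
    have "S f n = S (\<lambda>y. trunc N f y + (f y - trunc N f y)) n" by simp
    also have "\<dots> = S (trunc N f) n + S (\<lambda>y. f y - trunc N f y) n"
      by (rule add[OF trunc_lp_Z(1)[OF r] trunc_tail(1)[OF r f]])
    also have "S (trunc N f) n = partial_conv (frac_kernel m \<epsilon> \<theta>) N f n"
      by (simp only: ext[OF trunc_lp_Z(2)[OF r] trunc_lp_Z(1)[OF r]] frac_op_trunc[OF \<theta>])
    finally have "norm (S f n - partial_conv (frac_kernel m \<epsilon> \<theta>) N f n) = norm (S (\<lambda>y. f y - trunc N f y) n)" by simp
    also have "\<dots> \<le> lp_Z_norm (2 * real r) (S (\<lambda>y. f y - trunc N f y))"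
      by (rule norm_le_lp_Z_norm[OF r bd(1)[OF trunc_tail(1)[OF r f]]])
    also have "\<dots> \<le> B * lp_Z_norm (2 * real r) (\<lambda>n. f n - trunc N f n)" by (rule bd(2)[OF trunc_tail(1)[OF r f]])
    also have "\<dots> \<le> \<bar>B\<bar> * lp_Z_norm (2 * real r) (\<lambda>n. f n - trunc N f n)" by (intro mult_right_mono Lp_norm_nonneg) auto
    finally show ?thesis .
  qed
  then have le: "\<And>N. norm (partial_conv (frac_kernel m \<epsilon> \<theta>) N f n - S f n) \<le> \<bar>B\<bar> * lp_Z_norm (2 * real r) (\<lambda>n. f n - trunc N f n)"
    by (simp add: norm_minus_commute)
  have lim: "(\<lambda>N. \<bar>B\<bar> * lp_Z_norm (2 * real r) (\<lambda>n. f n - trunc N f n)) \<longlonglongrightarrow> 0"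
    using tendsto_mult_left[OF trunc_tail(2)[OF r f], of "\<bar>B\<bar>"] by simp
  have "(\<lambda>N. partial_conv (frac_kernel m \<epsilon> \<theta>) N f n - S f n) \<longlonglongrightarrow> 0"
    by (rule Lim_null_comparison[OF always_eventually lim]) (rule allI, rule le)
  then show ?thesis by (rule LIM_zero_cancel)
qed

end

section \<open>Bounds for finitely supported functions\<close>

lemma integrable_weight: "\<epsilon> > 0 \<Longrightarrow> integrable lborel (\<lambda>y. \<Sum>j\<in>J. weight \<epsilon> y j * c j)"
  unfolding weight_def using integrable_decay_shift(2)
  by (intro Bochner_Integration.integrable_sum integrable_mult_left integrable_mult_right) auto

text \<open>The factor \<open>\<epsilon>\<close> cancels the \<open>1 / \<epsilon>\<close> of the
  transference bound, which makes the final estimates uniform in \<open>\<epsilon>\<close>.\<close>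

lemma integral_weight: "(LBINT y. (\<Sum>j\<in>J. weight \<epsilon> y j * c j)) = \<epsilon> * pi * (\<Sum>j\<in>J. c j)"
proof -
  have "(LBINT y. (\<Sum>j\<in>J. weight \<epsilon> y j * c j)) = (\<Sum>j\<in>J. (LBINT y. weight \<epsilon> y j * c j))"
    unfolding weight_def using integrable_decay_shift(2)
    by (intro Bochner_Integration.integral_sum integrable_mult_left integrable_mult_right) auto
  also have "\<dots> = (\<Sum>j\<in>J. \<epsilon> * pi * c j)"
    unfolding weight_def integral_mult_left_zero integral_mult_right_zero integral_decay_shift(2) ..
  finally show ?thesis by (simp add: sum_distrib_left)
qed

lemma bandlimited_mono:
  assumes A: "bandlimited s M A" and "M \<le> M'" "0 \<le> s"
  shows "bandlimited s M' A"
  unfolding bandlimited_def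
proof (intro allI impI)
  fix T :: "(nat \<times> nat) set" and c \<nu> \<alpha> D
  assume T: "finite T" and D: "\<forall>\<beta>. \<bar>\<beta> - \<alpha>\<bar> \<le> s \<longrightarrow> norm (\<Sum>t\<in>T. c t * ex (\<beta> * of_int (\<nu> t))) \<le> D"
  have "norm (\<Sum>t\<in>T. c t * ex (\<alpha> * of_int (\<nu> t)) * A (\<nu> t)) \<le> M * D"
    by (rule bandlimitedD[OF A T]) (use D in blast)
  \<comment> \<open>Taking \<open>\<beta> = \<alpha>\<close> in the test condition shows that
    \<open>D\<close> is nonnegative.\<close>
  also have "norm (\<Sum>t\<in>T. c t * ex (\<alpha> * of_int (\<nu> t))) \<le> D" using D assms(3) by simp
  then have "0 \<le> D" using norm_ge_zero by (rule order_trans[rotated])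
  then have "M * D \<le> M' * D" using assms(2) by (rule mult_right_mono[rotated])
  finally show "norm (\<Sum>t\<in>T. c t * ex (\<alpha> * of_int (\<nu> t)) * A (\<nu> t)) \<le> M' * D" .
qed

text \<open>The transference bound as a predicate on its constant, so that one constant can be fixed
  for \<open>m\<close> before \<open>\<epsilon>\<close> and \<open>Z\<close> are chosen.\<close>

definition transference_constant :: "nat \<Rightarrow> (real \<Rightarrow> complex) \<Rightarrow> real \<Rightarrow> bool" where
  "transference_constant r m C \<longleftrightarrow> C \<ge> 0 \<and> (\<forall>\<epsilon> (J :: int set) a A. 0 < \<epsilon> \<longrightarrow> \<epsilon> \<le> 1 \<longrightarrow> finite J \<longrightarrow> finite A \<longrightarrow>
     (\<Sum>n\<in>A. norm (\<Sum>j\<in>J. a j * (of_real \<epsilon> * mult_kernel m (\<epsilon> * of_int (n - j)))) ^ (2 * r))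
       \<le> C / \<epsilon> * (LBINT y. norm (\<Sum>j\<in>J. a j * of_real (\<epsilon> * vker (y - \<epsilon> * of_int j))) ^ (2 * r)))"

context band_multiplier
begin

lemma eps_le_1: "\<epsilon> \<le> 1"
  using eps by simp

lemma frac_kernel_diff:
  assumes \<theta>: "0 \<le> \<theta>" "\<theta> \<le> 1"
  shows "frac_kernel m \<epsilon> \<theta> (n - j) = ex (\<theta> * of_int n) * (ex (- (\<theta> * of_int j)) * (of_real \<epsilon> * mult_kernel m (\<epsilon> * of_int (n - j))))"
proof -
  have "ex (\<theta> * of_int (n - j)) = ex (\<theta> * of_int n) * ex (- (\<theta> * of_int j))"
    unfolding ex_add[symmetric] by (simp add: right_diff_distrib)
  then show ?thesis unfolding frac_kernel_eq[OF \<theta>] by (simp only: mult.assoc)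
qed

text \<open>For a single fraction the modulations by \<open>\<theta>\<close> are unimodular and can
  be moved into \<open>f\<close> and out of the norm, so the transference bound applies directly. It
  remains to apply Jensen with mass \<open>12 * pi\<close>. This is what makes the extension of each
  operator exist.\<close>

lemma conv_bounded_frac_kernel:
  assumes r: "r \<ge> 1" and \<theta>: "0 \<le> \<theta>" "\<theta> \<le> 1" and C: "transference_constant r m C"
  shows "conv_bounded r (frac_kernel m \<epsilon> \<theta>) (C * (1 + 12 * pi) ^ (2 * r) * 4 * pi)"
  unfolding conv_bounded_def
proof (intro allI impI)
  fix J A :: "int set" and f :: "int \<Rightarrow> complex"
  assume J: "finite J" and A: "finite A"
  define a where "a j = f j * ex (- (\<theta> * of_int j))" for j :: int
  have na: "norm (a j) = norm (f j)" for j by (simp add: a_def norm_mult)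
  have p: "2 * r \<ge> 1" using r by simp
  have "norm (\<Sum>j\<in>J. f j * frac_kernel m \<epsilon> \<theta> (n - j)) = norm (\<Sum>j\<in>J. a j * (of_real \<epsilon> * mult_kernel m (\<epsilon> * of_int (n - j))))" for n
  proof -
    have "(\<Sum>j\<in>J. f j * frac_kernel m \<epsilon> \<theta> (n - j)) = ex (\<theta> * of_int n) * (\<Sum>j\<in>J. a j * (of_real \<epsilon> * mult_kernel m (\<epsilon> * of_int (n - j))))"
      unfolding frac_kernel_diff[OF \<theta>] a_def sum_distrib_left by (simp only: mult_ac)
    then show ?thesis by (simp add: norm_mult)
  qed
  then have "(\<Sum>n\<in>A. norm (\<Sum>j\<in>J. f j * frac_kernel m \<epsilon> \<theta> (n - j)) ^ (2 * r))
     = (\<Sum>n\<in>A. norm (\<Sum>j\<in>J. a j * (of_real \<epsilon> * mult_kernel m (\<epsilon> * of_int (n - j)))) ^ (2 * r))" by simp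
  also have "\<dots> \<le> C / \<epsilon> * (LBINT y. norm (\<Sum>j\<in>J. a j * of_real (\<epsilon> * vker (y - \<epsilon> * of_int j))) ^ (2 * r))"
    using C eps(1) eps_le_1 J A unfolding transference_constant_def by blast
  also have "\<dots> \<le> C / \<epsilon> * (LBINT y. (\<Sum>j\<in>J. weight \<epsilon> y j * ((1 + 12 * pi) ^ (2 * r) * 4 * norm (f j) ^ (2 * r))))"
  proof (intro mult_left_mono integral_mono integrable_weight integrable_vker_sum_power eps(1) p)
    fix y
    have "norm (\<Sum>j\<in>J. a j * of_real (\<epsilon> * vker (y - \<epsilon> * of_int j))) \<le> (\<Sum>j\<in>J. 4 * weight \<epsilon> y j * norm (f j))"
    proof (rule sum_norm_le)
      fix j
      have "\<bar>\<epsilon> * vker (y - \<epsilon> * of_int j)\<bar> \<le> 4 * weight \<epsilon> y j"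
        using mult_left_mono[OF abs_vker_le[of "y - \<epsilon> * of_int j"], of \<epsilon>] eps by (simp add: weight_def abs_mult)
      then have "norm (a j) * \<bar>\<epsilon> * vker (y - \<epsilon> * of_int j)\<bar> \<le> norm (f j) * (4 * weight \<epsilon> y j)"
        unfolding na by (intro mult_left_mono) auto
      then show "norm (a j * of_real (\<epsilon> * vker (y - \<epsilon> * of_int j))) \<le> 4 * weight \<epsilon> y j * norm (f j)"
        unfolding norm_mult norm_of_real by (simp only: mult_ac)
    qed
    then have "norm (\<Sum>j\<in>J. a j * of_real (\<epsilon> * vker (y - \<epsilon> * of_int j))) ^ (2 * r) \<le> (\<Sum>j\<in>J. 4 * weight \<epsilon> y j * norm (f j)) ^ (2 * r)"
      by (intro power_mono) auto
    also have "\<dots> \<le> (1 + 12 * pi) ^ (2 * r) * (\<Sum>j\<in>J. 4 * weight \<epsilon> y j * norm (f j) ^ (2 * r))"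
      using sum_weight_le[OF eps(1) eps_le_1 J, of y] weight_nonneg[OF eps(1)]
      by (intro weighted_sum_power_le p) (auto simp: sum_distrib_left[symmetric])
    also have "\<dots> = (\<Sum>j\<in>J. weight \<epsilon> y j * ((1 + 12 * pi) ^ (2 * r) * 4 * norm (f j) ^ (2 * r)))"
      unfolding sum_distrib_left by (simp only: mult_ac)
    finally show "norm (\<Sum>j\<in>J. a j * of_real (\<epsilon> * vker (y - \<epsilon> * of_int j))) ^ (2 * r)
      \<le> (\<Sum>j\<in>J. weight \<epsilon> y j * ((1 + 12 * pi) ^ (2 * r) * 4 * norm (f j) ^ (2 * r)))" .
  qed (use C eps in \<open>auto simp: transference_constant_def\<close>)
  also have "\<dots> = C * (1 + 12 * pi) ^ (2 * r) * 4 * pi * (\<Sum>j\<in>J. norm (f j) ^ (2 * r))"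
    unfolding integral_weight sum_distrib_left[symmetric] using eps by simp
  finally show "(\<Sum>n\<in>A. norm (\<Sum>j\<in>J. f j * frac_kernel m \<epsilon> \<theta> (n - j)) ^ (2 * r))
     \<le> C * (1 + 12 * pi) ^ (2 * r) * 4 * pi * (\<Sum>j\<in>J. norm (f j) ^ (2 * r))" .
qed

text \<open>The convolution is the Fourier integral of a function \<open>h\<close> supported where
  the scaled multiplier is. The mass \<open>M\<close> depends on \<open>g\<close> and
  \<open>J\<close>, but it enters only the bounded error that vanishes in
  \<open>sum_power_transfer\<close>.\<close>

lemma bandlimited_low_frequency:
  assumes J: "finite J"
  shows "\<exists>M. bandlimited (\<epsilon> / 2) M (\<lambda>n. \<Sum>j\<in>J. g j * (of_real \<epsilon> * mult_kernel m (\<epsilon> * of_int (n - j))))"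
proof -
  define h where "h \<xi> = (\<Sum>j\<in>J. g j * (ex (- of_int j * \<xi>) * m (inverse \<epsilon> * \<xi>)))" for \<xi>
  have mi: "integrable lebesgue (\<lambda>\<xi>. m (inverse \<epsilon> * \<xi>))"
    using lebesgue_integrable_real_affine[OF m_integrable, of "inverse \<epsilon>" 0] eps by simp
  have exi: "integrable lebesgue (\<lambda>\<xi>. ex (x * \<xi>) * m (inverse \<epsilon> * \<xi>))" for x
  proof (rule Bochner_Integration.integrable_bound[OF mi])
    show "(\<lambda>\<xi>. ex (x * \<xi>) * m (inverse \<epsilon> * \<xi>)) \<in> borel_measurable lebesgue"
      using borel_measurable_integrable[OF mi] by (intro borel_measurable_times borel_measurable_ex_mult_lebesgue)
  qed (simp add: norm_mult)
  have hi: "integrable lebesgue h"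
    unfolding h_def[abs_def] by (intro Bochner_Integration.integrable_sum integrable_mult_right exi)
  have supp: "h \<xi> = 0" if "\<bar>\<xi>\<bar> > \<epsilon> / 2" for \<xi>
  proof -
    have "m (inverse \<epsilon> * \<xi>) = 0"
      using m_scaled_nonzeroD[of \<xi>] that by (cases "m (inverse \<epsilon> * \<xi>) = 0") auto
    then show ?thesis by (simp add: h_def)
  qed
  have eq: "(\<integral>\<xi>. h \<xi> * ex (\<xi> * of_int n) \<partial>lebesgue) = (\<Sum>j\<in>J. g j * (of_real \<epsilon> * mult_kernel m (\<epsilon> * of_int (n - j))))" for n :: int
  proof -
    have k: "(\<integral>\<xi>. ex (of_int (n - j) * \<xi>) * m (inverse \<epsilon> * \<xi>) \<partial>lebesgue) = of_real \<epsilon> * mult_kernel m (\<epsilon> * of_int (n - j))" for j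
    proof -
      have "(\<integral>\<xi>. ex (of_int (n - j) * \<xi>) * m (inverse \<epsilon> * \<xi>) \<partial>lebesgue)
        = \<bar>\<epsilon>\<bar> *\<^sub>R (\<integral>\<eta>. ex (of_int (n - j) * (0 + \<epsilon> * \<eta>)) * m (inverse \<epsilon> * (0 + \<epsilon> * \<eta>)) \<partial>lebesgue)"
        using eps by (intro lebesgue_integral_real_affine) simp
      also have "\<dots> = of_real \<epsilon> * (\<integral>\<eta>. m \<eta> * ex (\<epsilon> * of_int (n - j) * \<eta>) \<partial>lebesgue)"
        using eps by (simp add: scaleR_conv_of_real mult_ac del: of_int_diff)
      finally show ?thesis by (simp only: mult_kernel_def)
    qed
    have "(\<integral>\<xi>. h \<xi> * ex (\<xi> * of_int n) \<partial>lebesgue) = (\<integral>\<xi>. (\<Sum>j\<in>J. g j * (ex (of_int (n - j) * \<xi>) * m (inverse \<epsilon> * \<xi>))) \<partial>lebesgue)"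
      unfolding h_def sum_distrib_right
    proof (intro Bochner_Integration.integral_cong sum.cong refl)
      fix \<xi> j
      have "ex (of_int (n - j) * \<xi>) = ex (- of_int j * \<xi>) * ex (\<xi> * of_int n)"
        unfolding ex_add[symmetric] by (simp add: algebra_simps)
      then show "g j * (ex (- of_int j * \<xi>) * m (inverse \<epsilon> * \<xi>)) * ex (\<xi> * of_int n) = g j * (ex (of_int (n - j) * \<xi>) * m (inverse \<epsilon> * \<xi>))"
        by (simp only: mult_ac)
    qed
    also have "\<dots> = (\<Sum>j\<in>J. (\<integral>\<xi>. g j * (ex (of_int (n - j) * \<xi>) * m (inverse \<epsilon> * \<xi>)) \<partial>lebesgue))"
      by (intro Bochner_Integration.integral_sum integrable_mult_right exi)
    finally show ?thesis by (simp only: integral_mult_right_zero k)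
  qed
  have "bandlimited (\<epsilon> / 2) (\<integral>\<xi>. norm (h \<xi>) \<partial>lebesgue) (\<lambda>n. \<integral>\<xi>. h \<xi> * ex (\<xi> * of_int n) \<partial>lebesgue)"
    by (rule bandlimited_integral[OF borel_measurable_integrable[OF hi] hi]) (rule supp)
  then show ?thesis unfolding eq by (rule exI)
qed

end

section \<open>Sums over all fractions at once\<close>

locale coprime_band_multiplier = coprime_moduli Z qZ + band_multiplier m b \<epsilon>
  for Z :: "nat set" and qZ :: real and m :: "real \<Rightarrow> complex" and b \<epsilon> :: real
begin

lemma fracs_unit: "\<theta> \<in> reduced_fracs Z \<Longrightarrow> 0 \<le> \<theta> \<and> \<theta> \<le> 1"
  by (meson fracs_denominator less_imp_le)

text \<open>The total symbol \<open>H\<close> is bounded by \<open>b\<close> because its pieces have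
  disjoint supports. Bessel's inequality for \<open>H * P\<close> and Parseval for the trigonometric
  polynomial \<open>P\<close> finish.\<close>

lemma sum_fracs_bound_L2:
  assumes sep: "\<epsilon> \<le> 1 / qZ\<^sup>2" and J: "finite J" and A: "finite A"
  shows "(\<Sum>n\<in>A. (norm (\<Sum>\<theta>\<in>reduced_fracs Z. \<Sum>j\<in>J. f j * frac_kernel m \<epsilon> \<theta> (n - j)))\<^sup>2) \<le> b\<^sup>2 * (\<Sum>j\<in>J. (norm (f j))\<^sup>2)"
proof -
  define H where "H \<xi> = (\<Sum>\<theta>\<in>reduced_fracs Z. frac_symbol m \<epsilon> \<theta> \<xi>)" for \<xi>
  define P where "P \<xi> = (\<Sum>j\<in>J. f j * ex (- (of_int j * \<xi>)))" for \<xi>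
  have [measurable]: "H \<in> borel_measurable circle" "P \<in> borel_measurable circle"
    unfolding H_def[abs_def] P_def[abs_def] by measurable
  have Hb: "norm (H \<xi>) \<le> b" for \<xi>
    unfolding H_def using sep fracs_separated by (intro norm_sum_frac_symbol_le finite_fracs) (meson order_trans)
  have Pb: "norm (P \<xi>) \<le> (\<Sum>j\<in>J. norm (f j))" for \<xi> unfolding P_def by (rule norm_trig_poly_le)
  have ii: "integrable circle (\<lambda>\<xi>. f j * (frac_symbol m \<epsilon> \<theta> \<xi> * ex (of_int (n - j) * \<xi>)))" for \<theta> n j
    by (rule integrable_circle[where b = "norm (f j) * b"])
       (auto simp: norm_mult intro!: mult_left_mono norm_frac_symbol_le)
  have eq: "(\<Sum>\<theta>\<in>reduced_fracs Z. \<Sum>j\<in>J. f j * frac_kernel m \<epsilon> \<theta> (n - j)) = (\<integral>\<xi>. (H \<xi> * P \<xi>) * ex (of_int n * \<xi>) \<partial>circle)" for n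
  proof -
    have "(\<Sum>\<theta>\<in>reduced_fracs Z. \<Sum>j\<in>J. f j * frac_kernel m \<epsilon> \<theta> (n - j))
      = (\<Sum>\<theta>\<in>reduced_fracs Z. \<Sum>j\<in>J. (\<integral>\<xi>. f j * (frac_symbol m \<epsilon> \<theta> \<xi> * ex (of_int (n - j) * \<xi>)) \<partial>circle))"
      unfolding frac_kernel_def integral_mult_right_zero ..
    also have "\<dots> = (\<integral>\<xi>. (\<Sum>\<theta>\<in>reduced_fracs Z. \<Sum>j\<in>J. f j * (frac_symbol m \<epsilon> \<theta> \<xi> * ex (of_int (n - j) * \<xi>))) \<partial>circle)"
    proof -
      have "(\<integral>\<xi>. (\<Sum>\<theta>\<in>reduced_fracs Z. \<Sum>j\<in>J. f j * (frac_symbol m \<epsilon> \<theta> \<xi> * ex (of_int (n - j) * \<xi>))) \<partial>circle)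
        = (\<Sum>\<theta>\<in>reduced_fracs Z. (\<integral>\<xi>. (\<Sum>j\<in>J. f j * (frac_symbol m \<epsilon> \<theta> \<xi> * ex (of_int (n - j) * \<xi>))) \<partial>circle))"
        by (intro Bochner_Integration.integral_sum Bochner_Integration.integrable_sum ii)
      also have "\<dots> = (\<Sum>\<theta>\<in>reduced_fracs Z. \<Sum>j\<in>J. (\<integral>\<xi>. f j * (frac_symbol m \<epsilon> \<theta> \<xi> * ex (of_int (n - j) * \<xi>)) \<partial>circle))"
        by (intro sum.cong refl Bochner_Integration.integral_sum ii)
      finally show ?thesis by (rule sym)
    qed
    also have "\<dots> = (\<integral>\<xi>. (H \<xi> * P \<xi>) * ex (of_int n * \<xi>) \<partial>circle)"
      unfolding H_def P_def sum_product unfolding sum_distrib_right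
    proof (intro Bochner_Integration.integral_cong sum.cong refl)
      fix \<xi> \<theta> j
      have "ex (of_int (n - j) * \<xi>) = ex (- (of_int j * \<xi>)) * ex (of_int n * \<xi>)"
        unfolding ex_add[symmetric] by (simp add: left_diff_distrib)
      then show "f j * (frac_symbol m \<epsilon> \<theta> \<xi> * ex (of_int (n - j) * \<xi>)) = frac_symbol m \<epsilon> \<theta> \<xi> * (f j * ex (- (of_int j * \<xi>))) * ex (of_int n * \<xi>)"
        by (simp only: mult_ac)
    qed
    finally show ?thesis .
  qed
  have HPb: "norm (H \<xi> * P \<xi>) \<le> b * norm (P \<xi>)" for \<xi>
    unfolding norm_mult by (intro mult_right_mono Hb) auto
  have "(\<Sum>n\<in>A. (norm (\<integral>\<xi>. (H \<xi> * P \<xi>) * ex (of_int n * \<xi>) \<partial>circle))\<^sup>2) \<le> (\<integral>\<xi>. (norm (H \<xi> * P \<xi>))\<^sup>2 \<partial>circle)"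
  proof (rule bessel_circle[OF _ _ A])
    show "norm (H \<xi> * P \<xi>) \<le> b * (\<Sum>j\<in>J. norm (f j))" for \<xi>
      using HPb[of \<xi>] mult_left_mono[OF Pb[of \<xi>] b_nonneg] by linarith
  qed measurable
  also have "\<dots> \<le> (\<integral>\<xi>. b\<^sup>2 * (norm (P \<xi>))\<^sup>2 \<partial>circle)"
  proof (rule integral_mono)
    show "integrable circle (\<lambda>\<xi>. (norm (H \<xi> * P \<xi>))\<^sup>2)"
    proof (rule integrable_circle[where b = "(b * (\<Sum>j\<in>J. norm (f j)))\<^sup>2"])
      fix \<xi>
      have "norm (H \<xi> * P \<xi>) \<le> b * (\<Sum>j\<in>J. norm (f j))"
        using HPb[of \<xi>] mult_left_mono[OF Pb[of \<xi>] b_nonneg] by linarith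
      then have "(norm (H \<xi> * P \<xi>))\<^sup>2 \<le> (b * (\<Sum>j\<in>J. norm (f j)))\<^sup>2" by (rule power_mono) simp
      then show "norm ((norm (H \<xi> * P \<xi>))\<^sup>2) \<le> (b * (\<Sum>j\<in>J. norm (f j)))\<^sup>2" by simp
    qed measurable
    show "integrable circle (\<lambda>\<xi>. b\<^sup>2 * (norm (P \<xi>))\<^sup>2)"
      by (rule integrable_mult_right, rule integrable_circle[where b = "(\<Sum>j\<in>J. norm (f j))\<^sup>2"]) (auto intro!: power_mono Pb)
    show "(norm (H \<xi> * P \<xi>))\<^sup>2 \<le> b\<^sup>2 * (norm (P \<xi>))\<^sup>2" for \<xi>
      unfolding power_mult_distrib[symmetric] by (intro power_mono HPb) auto
  qed
  also have "\<dots> = b\<^sup>2 * (\<Sum>j\<in>J. (norm (f j))\<^sup>2)"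
    unfolding integral_mult_right_zero P_def parseval_trig_poly[OF J] ..
  finally show ?thesis by (simp only: eq)
qed

text \<open>The phases are frozen at \<open>u\<close>, the resulting convolution is transferred to
  the line for each \<open>u\<close>, the average over \<open>u\<close> is taken under the integral,
  and the moment bound is applied at each point \<open>y\<close> of the line.\<close>

lemma sum_fracs_bound_high:
  assumes r: "r \<ge> 2" and C: "transference_constant r m C" and C1: "C1 \<ge> 0"
    and small: "real r * \<epsilon> < 1 / qZ ^ (2 * r)"
    and moment: "\<And>(J :: int set) f y. finite J \<Longrightarrow>
      avg (\<Prod>Z) (\<lambda>u. norm (\<Sum>\<theta>\<in>reduced_fracs Z. ex (\<theta> * real u) *
         (\<Sum>j\<in>J. of_real (\<epsilon> * vker (y - \<epsilon> * of_int j)) * f j * ex (- (\<theta> * of_int j)))) ^ (2 * r))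
       \<le> C1 * (\<Sum>j\<in>J. weight \<epsilon> y j * norm (f j) ^ (2 * r))"
    and J: "finite J" and A: "finite A"
  shows "(\<Sum>n\<in>A. norm (\<Sum>\<theta>\<in>reduced_fracs Z. \<Sum>j\<in>J. f j * frac_kernel m \<epsilon> \<theta> (n - j)) ^ (2 * r))
    \<le> C * C1 * pi * (\<Sum>j\<in>J. norm (f j) ^ (2 * r))"
proof -
  let ?\<Theta> = "reduced_fracs Z"
  define Q where "Q = \<Prod>Z"
  have Q: "Q > 0" unfolding Q_def using pos by (intro prod_pos) auto
  define \<phi> where "\<phi> \<theta> n = (\<Sum>j\<in>J. f j * ex (- (\<theta> * of_int j)) * (of_real \<epsilon> * mult_kernel m (\<epsilon> * of_int (n - j))))" for \<theta> and n :: int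
  \<comment> \<open>For frozen \<open>u\<close> all fractions are absorbed into these coefficients,
    so the multiplier bound is used on one convolution only.\<close>
  define a where "a u j = f j * (\<Sum>\<theta>\<in>?\<Theta>. ex (\<theta> * real u) * ex (- (\<theta> * of_int j)))" for u and j :: int
  define I where "I u = (LBINT y. norm (\<Sum>j\<in>J. a u j * of_real (\<epsilon> * vker (y - \<epsilon> * of_int j))) ^ (2 * r))" for u
  have C0: "C / \<epsilon> \<ge> 0" using C eps by (simp add: transference_constant_def)
  \<comment> \<open>A common mass for the finitely many fractions, the maximum of the individual
    ones.\<close>
  obtain M where M: "bandlimited (\<epsilon> / 2) M (\<phi> \<theta>)" if "\<theta> \<in> ?\<Theta>" for \<theta>
  proof -
    have "\<forall>\<theta>. \<exists>M. bandlimited (\<epsilon> / 2) M (\<phi> \<theta>)"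
      unfolding \<phi>_def by (intro allI bandlimited_low_frequency J)
    then obtain M where M: "\<And>\<theta>. bandlimited (\<epsilon> / 2) (M \<theta>) (\<phi> \<theta>)" by metis
    show ?thesis
    proof (rule that)
      fix \<theta> assume "\<theta> \<in> ?\<Theta>"
      then have "M \<theta> \<le> Max (M ` ?\<Theta>)" using finite_fracs by (intro Max_ge) auto
      then show "bandlimited (\<epsilon> / 2) (Max (M ` ?\<Theta>)) (\<phi> \<theta>)" using M eps by (intro bandlimited_mono[OF M]) auto
    qed
  qed
  have swap: "(\<Sum>\<theta>\<in>?\<Theta>. ex (\<theta> * real u) * (\<Sum>j\<in>J. f j * ex (- (\<theta> * of_int j)) * c j)) = (\<Sum>j\<in>J. a u j * c j)" for u c
  proof -
    have "(\<Sum>\<theta>\<in>?\<Theta>. ex (\<theta> * real u) * (\<Sum>j\<in>J. f j * ex (- (\<theta> * of_int j)) * c j))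
      = (\<Sum>j\<in>J. \<Sum>\<theta>\<in>?\<Theta>. ex (\<theta> * real u) * (f j * ex (- (\<theta> * of_int j)) * c j))"
      unfolding sum_distrib_left by (rule sum.swap)
    then show ?thesis unfolding a_def sum_distrib_left sum_distrib_right by (simp only: mult_ac)
  qed
  have "(\<Sum>n\<in>A. norm (\<Sum>\<theta>\<in>?\<Theta>. \<Sum>j\<in>J. f j * frac_kernel m \<epsilon> \<theta> (n - j)) ^ (2 * r))
    = (\<Sum>n\<in>A. norm (\<Sum>\<theta>\<in>?\<Theta>. ex (\<theta> * of_int n) * \<phi> \<theta> n) ^ (2 * r))"
  proof -
    have "(\<Sum>j\<in>J. f j * frac_kernel m \<epsilon> \<theta> (n - j)) = ex (\<theta> * of_int n) * \<phi> \<theta> n" if "\<theta> \<in> ?\<Theta>" for \<theta> n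
    proof -
      have \<theta>: "0 \<le> \<theta>" "\<theta> \<le> 1" using fracs_unit[OF that] by auto
      show ?thesis unfolding \<phi>_def sum_distrib_left frac_kernel_diff[OF \<theta>] by (simp only: mult_ac)
    qed
    then show ?thesis by simp
  qed
  also have "\<dots> \<le> (\<Sum>u<Q. C / \<epsilon> * I u) / real Q"
  \<comment> \<open>A product of \<open>2 * r\<close> factors of bandwidth
    \<open>\<epsilon> / 2\<close> has bandwidth \<open>r * \<epsilon>\<close>; \<open>d\<close> is
    what this leaves of the gap \<open>1 / qZ ^ (2 * r)\<close>, and it is positive by the strict
    bound on \<open>\<epsilon>\<close>.\<close>
  proof (rule sum_power_transfer[where s = "\<epsilon> / 2" and M = M and d = "1 / qZ ^ (2 * r) - real r * \<epsilon>"])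
    show "finite ?\<Theta>" by (rule finite_fracs)
    show "\<theta> * real Q \<in> \<int>" if \<theta>: "\<theta> \<in> ?\<Theta>" for \<theta>
    proof -
      obtain q where q: "q \<in> Z" "\<theta> * real q \<in> \<int>" using \<theta> by (rule fracs_denominator)
      have "q dvd Q" unfolding Q_def using finite_Z q by (intro dvd_prodI) auto
      then obtain k where "Q = q * k" by blast
      then have eq: "\<theta> * real Q = (\<theta> * real q) * real k" by simp
      show ?thesis unfolding eq by (rule Ints_mult[OF q(2) Ints_of_nat])
    qed
    show "1 / qZ ^ (2 * r) - real r * \<epsilon> > 0" using small by simp
    fix \<tau> \<sigma> l assume "\<tau> \<in> {..<r} \<rightarrow> ?\<Theta>" "\<sigma> \<in> {..<r} \<rightarrow> ?\<Theta>" "(\<Sum>i<r. \<tau> i) - (\<Sum>i<r. \<sigma> i) \<notin> \<int>"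
    from sums_of_fracs_separated[OF this, of l]
    show "2 * real r * (\<epsilon> / 2) + (1 / qZ ^ (2 * r) - real r * \<epsilon>) \<le> \<bar>(\<Sum>i<r. \<tau> i) - (\<Sum>i<r. \<sigma> i) - of_int l\<bar>" by simp
  next
    fix u and A' :: "int set" assume A': "finite A'"
    have "(\<Sum>n\<in>A'. norm (\<Sum>\<theta>\<in>?\<Theta>. ex (\<theta> * real u) * \<phi> \<theta> n) ^ (2 * r))
      = (\<Sum>n\<in>A'. norm (\<Sum>j\<in>J. a u j * (of_real \<epsilon> * mult_kernel m (\<epsilon> * of_int (n - j)))) ^ (2 * r))"
      unfolding \<phi>_def swap ..
    also have "\<dots> \<le> C / \<epsilon> * I u"
      using C eps(1) eps_le_1 J A' unfolding transference_constant_def I_def by blast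
    finally show "(\<Sum>n\<in>A'. norm (\<Sum>\<theta>\<in>?\<Theta>. ex (\<theta> * real u) * \<phi> \<theta> n) ^ (2 * r)) \<le> C / \<epsilon> * I u" .
  qed (use Q M A in auto)
  also have "\<dots> = C / \<epsilon> * avg Q I" unfolding avg_def sum_distrib_left[symmetric] by simp
  finally have 1: "(\<Sum>n\<in>A. norm (\<Sum>\<theta>\<in>?\<Theta>. \<Sum>j\<in>J. f j * frac_kernel m \<epsilon> \<theta> (n - j)) ^ (2 * r)) \<le> C / \<epsilon> * avg Q I" .
  have "avg Q I = (LBINT y. avg Q (\<lambda>u. norm (\<Sum>j\<in>J. a u j * of_real (\<epsilon> * vker (y - \<epsilon> * of_int j))) ^ (2 * r)))"
    unfolding avg_def I_def integral_divide_zero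
    by (intro arg_cong2[where f = "(/)"] refl Bochner_Integration.integral_sum[symmetric] integrable_vker_sum_power eps(1)) (use r in simp)
  also have "\<dots> \<le> (LBINT y. (\<Sum>j\<in>J. weight \<epsilon> y j * (C1 * norm (f j) ^ (2 * r))))"
  proof (rule integral_mono)
    show "integrable lborel (\<lambda>y. avg Q (\<lambda>u. norm (\<Sum>j\<in>J. a u j * of_real (\<epsilon> * vker (y - \<epsilon> * of_int j))) ^ (2 * r)))"
      unfolding avg_def by (intro integrable_divide_zero Bochner_Integration.integrable_sum integrable_vker_sum_power eps(1)) (use r in auto)
    show "integrable lborel (\<lambda>y. \<Sum>j\<in>J. weight \<epsilon> y j * (C1 * norm (f j) ^ (2 * r)))"
      by (rule integrable_weight[OF eps(1)])
    fix y
    have "(\<Sum>\<theta>\<in>?\<Theta>. ex (\<theta> * real u) * (\<Sum>j\<in>J. of_real (\<epsilon> * vker (y - \<epsilon> * of_int j)) * f j * ex (- (\<theta> * of_int j))))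
      = (\<Sum>j\<in>J. a u j * of_real (\<epsilon> * vker (y - \<epsilon> * of_int j)))" for u
      using swap[of u "\<lambda>j. of_real (\<epsilon> * vker (y - \<epsilon> * of_int j))"] by (simp only: mult_ac)
    then have "avg Q (\<lambda>u. norm (\<Sum>j\<in>J. a u j * of_real (\<epsilon> * vker (y - \<epsilon> * of_int j))) ^ (2 * r))
      \<le> C1 * (\<Sum>j\<in>J. weight \<epsilon> y j * norm (f j) ^ (2 * r))"
      using moment[OF J, of y f] by (simp only: Q_def)
    also have "\<dots> = (\<Sum>j\<in>J. weight \<epsilon> y j * (C1 * norm (f j) ^ (2 * r)))"
      unfolding sum_distrib_left by (simp only: mult_ac)
    finally show "avg Q (\<lambda>u. norm (\<Sum>j\<in>J. a u j * of_real (\<epsilon> * vker (y - \<epsilon> * of_int j))) ^ (2 * r))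
      \<le> (\<Sum>j\<in>J. weight \<epsilon> y j * (C1 * norm (f j) ^ (2 * r)))" .
  qed
  also have "\<dots> = \<epsilon> * pi * (C1 * (\<Sum>j\<in>J. norm (f j) ^ (2 * r)))"
    unfolding integral_weight sum_distrib_left ..
  finally have "C / \<epsilon> * avg Q I \<le> C / \<epsilon> * (\<epsilon> * pi * (C1 * (\<Sum>j\<in>J. norm (f j) ^ (2 * r))))"
    by (rule mult_left_mono) (rule C0)
  with 1 have "(\<Sum>n\<in>A. norm (\<Sum>\<theta>\<in>?\<Theta>. \<Sum>j\<in>J. f j * frac_kernel m \<epsilon> \<theta> (n - j)) ^ (2 * r))
     \<le> C / \<epsilon> * (\<epsilon> * pi * (C1 * (\<Sum>j\<in>J. norm (f j) ^ (2 * r))))" by (rule order_trans)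
  then show ?thesis using eps by (simp add: mult_ac)
qed

end

section \<open>Choice of the constants and passage from finite sums to the full spaces\<close>

lemma two_power_powr:
  assumes "r \<ge> 1"
  shows "((2 ^ k) powr (1 - 1 / real r)) ^ (2 * r) = (2 ^ k :: real) ^ (2 * r - 2)"
proof -
  have "((2 ^ k) powr (1 - 1 / real r)) ^ (2 * r) = (2 ^ k :: real) powr ((1 - 1 / real r) * real (2 * r))"
    by (simp add: powr_powr[symmetric] powr_realpow del: of_nat_mult)
  also have "(1 - 1 / real r) * real (2 * r) = real (2 * r - 2)"
    using assms by (simp add: of_nat_diff algebra_simps)
  also have "(2 ^ k :: real) powr real (2 * r - 2) = (2 ^ k) ^ (2 * r - 2)"
    by (rule powr_realpow) simp
  finally show ?thesis .
qed

lemma (in coprime_moduli) small_epsilon: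
  assumes r: "r \<ge> 1" and \<epsilon>: "0 < \<epsilon>" "\<epsilon> < inverse (real r) * inverse (qZ ^ (2 * r))"
  shows "real r * \<epsilon> < 1 / qZ ^ (2 * r)" "k \<le> 2 * r \<Longrightarrow> \<epsilon> * qZ ^ k \<le> 1"
proof -
  have q: "qZ ^ (2 * r) > 0" using qZ_ge_2 by simp
  show 1: "real r * \<epsilon> < 1 / qZ ^ (2 * r)" using \<epsilon> r q by (simp add: field_simps)
  assume k: "k \<le> 2 * r"
  have "\<epsilon> * qZ ^ k \<le> (real r * \<epsilon>) * qZ ^ (2 * r)"
  proof (rule mult_mono)
    show "\<epsilon> \<le> real r * \<epsilon>" using mult_right_mono[of 1 "real r" \<epsilon>] r \<epsilon> by simp
    show "qZ ^ k \<le> qZ ^ (2 * r)" using k qZ_ge_2 by (intro power_increasing) auto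
  qed (use r \<epsilon> qZ_ge_2 in auto)
  also have "\<dots> \<le> 1" using 1 q by (simp add: field_simps)
  finally show "\<epsilon> * qZ ^ k \<le> 1" .
qed

lemma sum_fracs_finite_bound:
  assumes r: "r \<ge> 1" and m: "m \<in> borel_measurable lebesgue" "\<And>x. norm (m x) \<le> b"
    and supp: "\<And>x. x \<notin> {-1/2<..1/2} \<Longrightarrow> m x = 0" and Ct: "transference_constant r m Ct"
  shows "\<exists>c\<ge>0. \<forall>Z qZ \<epsilon> J A f. coprime_moduli Z qZ \<longrightarrow> 0 < \<epsilon> \<longrightarrow> \<epsilon> < inverse (real r) * inverse (qZ ^ (2 * r)) \<longrightarrow>
      finite J \<longrightarrow> finite A \<longrightarrow>
      (\<Sum>n\<in>A. norm (\<Sum>\<theta>\<in>reduced_fracs Z. \<Sum>j\<in>J. f j * frac_kernel m \<epsilon> \<theta> (n - j)) ^ (2 * r))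
        \<le> c * (2 ^ Omega Z) ^ (2 * r - 2) * (\<Sum>j\<in>J. norm (f j) ^ (2 * r))"
proof -
  have loc: "coprime_band_multiplier Z qZ m b \<epsilon>"
    if Z: "coprime_moduli Z qZ" and \<epsilon>: "0 < \<epsilon>" "\<epsilon> < inverse (real r) * inverse (qZ ^ (2 * r))" for Z qZ \<epsilon>
  proof -
    have "\<epsilon> * 2 \<le> \<epsilon> * qZ ^ 1"
      using coprime_moduli.qZ_ge_2[OF Z] \<epsilon> by simp
    also have "\<dots> \<le> 1" using r by (intro coprime_moduli.small_epsilon(2)[OF Z r \<epsilon>]) simp
    finally have "\<epsilon> \<le> 1/2" by simp
    then show ?thesis
      using Z m supp \<epsilon>(1) by (intro coprime_band_multiplier.intro band_multiplier.intro) auto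
  qed
  show ?thesis
  \<comment> \<open>For \<open>r = 1\<close> the bound on \<open>\<epsilon>\<close> gives only
    \<open>\<epsilon> * qZ\<^sup>2 < 1\<close>, enough for disjoint supports but not for the large
    sieve; the factor \<open>2 ^ Omega Z\<close> then has exponent 0.\<close>
  proof (cases "r = 1")
    case True
    show ?thesis
    proof (intro exI[of _ "b\<^sup>2"] conjI allI impI)
      fix Z qZ \<epsilon> and J A :: "int set" and f
      assume Z: "coprime_moduli Z qZ" and \<epsilon>: "0 < \<epsilon>" "\<epsilon> < inverse (real r) * inverse (qZ ^ (2 * r))"
        and JA: "finite J" "finite A"
      interpret coprime_band_multiplier Z qZ m b \<epsilon> by (rule loc[OF Z \<epsilon>])
      have "\<epsilon> \<le> 1 / qZ\<^sup>2" using \<epsilon> True by (simp add: inverse_eq_divide)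
      from sum_fracs_bound_L2[OF this JA, of f]
      show "(\<Sum>n\<in>A. norm (\<Sum>\<theta>\<in>reduced_fracs Z. \<Sum>j\<in>J. f j * frac_kernel m \<epsilon> \<theta> (n - j)) ^ (2 * r))
        \<le> b\<^sup>2 * (2 ^ Omega Z) ^ (2 * r - 2) * (\<Sum>j\<in>J. norm (f j) ^ (2 * r))"
        using True by simp
    qed simp
  next
    case False
    then have r2: "r \<ge> 2" using r by simp
    obtain C1 where C1: "C1 \<ge> 0" and moment: "\<And>Z qZ \<epsilon> (J :: int set) f y. coprime_moduli Z qZ \<Longrightarrow> 0 < \<epsilon> \<Longrightarrow> \<epsilon> * qZ ^ 4 \<le> 1 \<Longrightarrow> finite J \<Longrightarrow>
     avg (\<Prod>Z) (\<lambda>u. norm (\<Sum>\<theta>\<in>reduced_fracs Z. ex (\<theta> * real u) *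
         (\<Sum>j\<in>J. of_real (\<epsilon> * vker (y - \<epsilon> * of_int j)) * f j * ex (- (\<theta> * of_int j)))) ^ (2 * r))
       \<le> C1 * (2 ^ Omega Z) ^ (2 * r - 2) * (\<Sum>j\<in>J. weight \<epsilon> y j * norm (f j) ^ (2 * r))"
      using avg_fracs_moment_le[OF r2] by blast
    show ?thesis
    proof (intro exI[of _ "Ct * C1 * pi"] conjI allI impI)
      fix Z qZ \<epsilon> and J A :: "int set" and f
      assume Z: "coprime_moduli Z qZ" and \<epsilon>: "0 < \<epsilon>" "\<epsilon> < inverse (real r) * inverse (qZ ^ (2 * r))"
        and JA: "finite J" "finite A"
      interpret coprime_band_multiplier Z qZ m b \<epsilon> by (rule loc[OF Z \<epsilon>])
      have "\<epsilon> * qZ ^ 4 \<le> 1" using r2 by (intro small_epsilon(2)[OF r \<epsilon>]) simp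
      note mom = moment[OF Z \<epsilon>(1) this]
      have "C1 * (2 ^ Omega Z) ^ (2 * r - 2) \<ge> 0" using C1 by simp
      from sum_fracs_bound_high[OF r2 Ct this small_epsilon(1)[OF r \<epsilon>] mom JA, of f]
      show "(\<Sum>n\<in>A. norm (\<Sum>\<theta>\<in>reduced_fracs Z. \<Sum>j\<in>J. f j * frac_kernel m \<epsilon> \<theta> (n - j)) ^ (2 * r))
        \<le> Ct * C1 * pi * (2 ^ Omega Z) ^ (2 * r - 2) * (\<Sum>j\<in>J. norm (f j) ^ (2 * r))"
        by (simp only: mult_ac)
    qed (use C1 Ct in \<open>simp add: transference_constant_def\<close>)
  qed
qed

text \<open>The integral of a non-integrable function is 0 by convention, so a norm bound alone
  would be vacuous outside the space; membership is asserted along with it. For the same reason the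
  conclusion includes that \<open>frac_ext\<close> really is a bounded extension.\<close>

theorem theorem5p1:
  fixes r :: nat and m :: "real \<Rightarrow> complex"
  assumes "r \<ge> 1"
    and "\<exists>B. Lp_multiplier (2 * real r) m B"
    and "\<And>x. x \<notin> {-1/2<..1/2} \<Longrightarrow> m x = 0"
  shows "\<exists>C\<ge>0. \<forall>(Z :: nat set) (qZ :: real) (\<epsilon> :: real).
           finite Z \<longrightarrow> pairwise coprime Z \<longrightarrow> real ` Z \<subseteq> {1<..qZ} \<longrightarrow>
           0 < \<epsilon> \<longrightarrow> \<epsilon> < inverse (real r) * inverse (qZ ^ (2 * r)) \<longrightarrow>
             (\<forall>\<theta> \<in> reduced_fracs Z. is_frac_ext (2 * real r) m \<epsilon> \<theta> (frac_ext (2 * real r) m \<epsilon> \<theta>)) \<and>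
             (\<forall>f \<in> lp_Z (2 * real r).
                (\<lambda>n. \<Sum>\<theta>\<in>reduced_fracs Z. frac_ext (2 * real r) m \<epsilon> \<theta> f n) \<in> lp_Z (2 * real r) \<and>
                lp_Z_norm (2 * real r) (\<lambda>n. \<Sum>\<theta>\<in>reduced_fracs Z. frac_ext (2 * real r) m \<epsilon> \<theta> f n)
                  \<le> C * (2 ^ Omega Z) powr (1 - 1 / real r) * lp_Z_norm (2 * real r) f)"
proof -
  note r = assms(1)
  obtain B where B: "Lp_multiplier (2 * real r) m B" using assms(2) by blast
  have m: "m \<in> borel_measurable lebesgue" "bounded (range m)" using B by (auto simp: Lp_multiplier_def)
  obtain b where b: "\<And>x. norm (m x) \<le> b" using m(2) by (auto simp: bounded_iff)
  obtain Ct where Ct: "transference_constant r m Ct"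
    using transference[OF r B assms(3)] unfolding transference_constant_def by blast
  then have Ct0: "Ct \<ge> 0" by (simp add: transference_constant_def)
  obtain c where c: "c \<ge> 0" and fb: "\<And>Z qZ \<epsilon> J A f. coprime_moduli Z qZ \<Longrightarrow> 0 < \<epsilon> \<Longrightarrow> \<epsilon> < inverse (real r) * inverse (qZ ^ (2 * r)) \<Longrightarrow>
      finite J \<Longrightarrow> finite A \<Longrightarrow>
      (\<Sum>n\<in>A. norm (\<Sum>\<theta>\<in>reduced_fracs Z. \<Sum>j\<in>J. f j * frac_kernel m \<epsilon> \<theta> (n - j)) ^ (2 * r))
        \<le> c * (2 ^ Omega Z) ^ (2 * r - 2) * (\<Sum>j\<in>J. norm (f j) ^ (2 * r))"
    using sum_fracs_finite_bound[OF r m(1) b assms(3) Ct] by blast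
  \<comment> \<open>The finite bound controls \<open>2r\<close>-th powers, hence the root. It turns
    the exponent \<open>2 * r - 2\<close> of \<open>2 ^ Omega Z\<close> into
    \<open>1 - 1 / r\<close>.\<close>
  define C where "C = root (2 * r) c"
  have C: "C \<ge> 0" "C ^ (2 * r) = c" using c r by (simp_all add: C_def)
  show ?thesis
  proof (intro exI[of _ C] conjI allI impI C(1))
    fix Z :: "nat set" and qZ \<epsilon> :: real
    assume Z: "finite Z" "pairwise coprime Z" "real ` Z \<subseteq> {1<..qZ}"
      and \<epsilon>: "0 < \<epsilon>" "\<epsilon> < inverse (real r) * inverse (qZ ^ (2 * r))"
    let ?P = "\<lambda>\<theta>. is_frac_ext (2 * real r) m \<epsilon> \<theta> (frac_ext (2 * real r) m \<epsilon> \<theta>)"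
    define K where "K = C * (2 ^ Omega Z) powr (1 - 1 / real r)"
    have K: "K \<ge> 0" using C by (simp add: K_def)
    have KP: "K ^ (2 * r) = c * (2 ^ Omega Z) ^ (2 * r - 2)"
      unfolding K_def power_mult_distrib C(2) two_power_powr[OF r] ..
    have "(\<forall>\<theta>\<in>reduced_fracs Z. ?P \<theta>) \<and>
      (\<forall>f\<in>lp_Z (2 * real r). (\<lambda>n. \<Sum>\<theta>\<in>reduced_fracs Z. frac_ext (2 * real r) m \<epsilon> \<theta> f n) \<in> lp_Z (2 * real r) \<and>
         lp_Z_norm (2 * real r) (\<lambda>n. \<Sum>\<theta>\<in>reduced_fracs Z. frac_ext (2 * real r) m \<epsilon> \<theta> f n) \<le> K * lp_Z_norm (2 * real r) f)"
    \<comment> \<open>Without moduli the sum over fractions is 0 and nothing has to be known about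
      \<open>qZ\<close> or \<open>\<epsilon>\<close>.\<close>
    proof (cases "Z = {}")
      case True
      then have "reduced_fracs Z = {}" by (simp add: reduced_fracs_def)
      moreover have "(\<lambda>n. 0) \<in> lp_Z (2 * real r)" "lp_Z_norm (2 * real r) (\<lambda>n. 0) \<le> K * lp_Z_norm (2 * real r) f" for f
        using mult_nonneg_nonneg[OF K Lp_norm_nonneg] by (simp_all add: Lp_def Lp_norm_def)
      ultimately show ?thesis by simp
    next
      case False
      then interpret coprime_moduli Z qZ using Z by unfold_locales auto
      have "\<epsilon> * 2 \<le> \<epsilon> * qZ ^ 1" using qZ_ge_2 \<epsilon> by simp
      also have "\<dots> \<le> 1" using r by (intro small_epsilon(2)[OF r \<epsilon>]) simp
      finally have "\<epsilon> \<le> 1/2" by simp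
      then interpret coprime_band_multiplier Z qZ m b \<epsilon>
        using m b assms(3) \<epsilon>(1) by unfold_locales auto
      note cb = conv_bounded_frac_kernel[OF r _ _ Ct]
      have Cc: "Ct * (1 + 12 * pi) ^ (2 * r) * 4 * pi \<ge> 0" using Ct0 by simp
      have ext: "?P \<theta>" if "\<theta> \<in> reduced_fracs Z" for \<theta>
      proof -
        have "\<exists>S. is_frac_ext (2 * real r) m \<epsilon> \<theta> S"
          by (rule is_frac_ext_exists[OF r _ _ cb Cc]) (use fracs_unit[OF that] in auto)
        then show ?thesis
          unfolding frac_ext_def by (rule someI_ex[where P = "is_frac_ext (2 * real r) m \<epsilon> \<theta>"])
      qed
      have "(\<lambda>n. \<Sum>\<theta>\<in>reduced_fracs Z. frac_ext (2 * real r) m \<epsilon> \<theta> f n) \<in> lp_Z (2 * real r) \<and>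
         lp_Z_norm (2 * real r) (\<lambda>n. \<Sum>\<theta>\<in>reduced_fracs Z. frac_ext (2 * real r) m \<epsilon> \<theta> f n) \<le> K * lp_Z_norm (2 * real r) f"
        if f: "f \<in> lp_Z (2 * real r)" for f
      proof -
        have lim: "(\<lambda>N. \<Sum>\<theta>\<in>reduced_fracs Z. partial_conv (frac_kernel m \<epsilon> \<theta>) N f n)
            \<longlonglongrightarrow> (\<Sum>\<theta>\<in>reduced_fracs Z. frac_ext (2 * real r) m \<epsilon> \<theta> f n)" for n
          using fracs_unit ext by (intro tendsto_sum frac_ext_LIMSEQ[OF r _ _ _ f]) auto
        \<comment> \<open>The truncated sums are finite convolutions, to which the uniform bound
          applies; their limits are the chosen extensions.\<close>
        have le: "(\<Sum>n\<in>A. norm (\<Sum>\<theta>\<in>reduced_fracs Z. partial_conv (frac_kernel m \<epsilon> \<theta>) N f n) ^ (2 * r))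
            \<le> K ^ (2 * r) * (\<Sum>j\<in>{- int N..int N}. norm (f j) ^ (2 * r))" if "finite A" for A N
          unfolding partial_conv_def KP
          by (rule fb[OF coprime_moduli_axioms \<epsilon> finite_atLeastAtMost_int that])
        show ?thesis using lp_Z_norm_limit_le[OF r lim K f le] by blast
      qed
      with ext show ?thesis by blast
    qed
    then show "\<forall>\<theta>\<in>reduced_fracs Z. ?P \<theta>"
      "\<forall>f\<in>lp_Z (2 * real r).
                (\<lambda>n. \<Sum>\<theta>\<in>reduced_fracs Z. frac_ext (2 * real r) m \<epsilon> \<theta> f n) \<in> lp_Z (2 * real r) \<and>
                lp_Z_norm (2 * real r) (\<lambda>n. \<Sum>\<theta>\<in>reduced_fracs Z. frac_ext (2 * real r) m \<epsilon> \<theta> f n)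
                  \<le> C * (2 ^ Omega Z) powr (1 - 1 / real r) * lp_Z_norm (2 * real r) f"
      unfolding K_def by blast+
  qed
qed

end
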